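(* Let $k\ge 0$ be an integer and $p$ a prime. Define $\delta_k=0$ if $\gcd(k,2)=1$ and $\delta_k=1$ if $\gcd(k,2)=2$. If $k\ge1$, assume that the polynomials $\mathfrak{R}_{2k+1,p}(z)$ and $(pz)^{2k}-1$ have no common roots when $k$ is odd, and have only the common roots $z=\pm i/p$ when $k$ is even. Then, with at most $2k+\delta_k$ exceptions, the quantity \[ (zp)^{2k}\mathfrak{F}_{2k+1,\chi_1}\!\left(-\frac{1}{p^2z}\right)-\mathfrak{F}_{2k+1,\chi_1}(z) \] is transcendental for every algebraic number $z\in\mathbb{H}$. Consequently, there are at most $2k+\delta_k$ algebraic numbers $z\in\mathbb{H}$ such that $\mathfrak{F}_{2k+1,\chi_1}(z)$ and $\mathfrak{F}_{2k+1,\chi_1}\!\left(-\frac{1}{p^2z}\right)$ are both algebraic.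
   Context: $\mathbb{H}$ is the upper half-plane. $\chi_1$ is the principal Dirichlet character modulo $p$; $a_n=1$ if $\gcd(n,p)=1$ and $a_n=1-p$ if $p\mid n$; $\sigma_{-m,\chi_1}(n)=\sum_{d\mid n}\chi_1(d)d^{-m}$; $\mathfrak{F}_{m,\chi_1}(z)=\sum_{n=1}^{\infty}a_n\sigma_{-m,\chi_1}(n)e^{2\pi i n z}$ for $z\in\mathbb{H}$. For $k\ge1$, $\mathfrak{R}_{2k+1,p}(z)=\sum_{j=1}^{k}(p^{2j}-1)(p^{2k+2-2j}-1)\frac{B_{2j}}{(2j)!}\frac{B_{2k+2-2j}}{(2k+2-2j)!}(pz)^{2k+2-2j}$, where $B_m$ is the $m$-th Bernoulli number. *)

theory Defs
  imports
    "HOL-Analysis.Analysis"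
    "HOL-Computational_Algebra.Computational_Algebra"
begin

definition upper_half_plane :: "complex set" where
  "upper_half_plane = {z. Im z > 0}"

(* Exponential generating function x / (exp x - 1), i.e. the convention B_1 = -1/2. *)
definition bernoulli_number :: "nat \<Rightarrow> real" where
  "bernoulli_number n = fact n * fps_nth (fps_X / (fps_exp 1 - 1)) n"

definition principal_char :: "nat \<Rightarrow> nat \<Rightarrow> complex" where
  "principal_char N n = (if coprime n N then 1 else 0)"

(* For prime p, "not coprime n p" is the case "p dvd n". *)
definition a_coeff :: "nat \<Rightarrow> nat \<Rightarrow> complex" where
  "a_coeff p n = (if coprime n p then 1 else 1 - of_nat p)"

definition sigma_char :: "nat \<Rightarrow> (nat \<Rightarrow> complex) \<Rightarrow> nat \<Rightarrow> complex" where
  "sigma_char m \<psi> n = (\<Sum>d | d dvd n. \<psi> d * of_nat d powi (- int m))"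

(* The series starts at index 1, hence the shift by Suc. *)
definition F_char :: "nat \<Rightarrow> nat \<Rightarrow> complex \<Rightarrow> complex" where
  "F_char m p z =
     (\<Sum>n. a_coeff p (Suc n) * sigma_char m (principal_char p) (Suc n) *
           exp (2 * of_real pi * \<i> * of_nat (Suc n) * z))"

(* R_poly k p is the polynomial of index 2k+1. *)
definition R_poly :: "nat \<Rightarrow> nat \<Rightarrow> complex poly" where
  "R_poly k p =
     (\<Sum>j = 1..k.
        smult ((of_nat p ^ (2 * j) - 1) * (of_nat p ^ (2 * k + 2 - 2 * j) - 1) *
               of_real (bernoulli_number (2 * j) / fact (2 * j)) *
               of_real (bernoulli_number (2 * k + 2 - 2 * j) / fact (2 * k + 2 - 2 * j)))
          ([:0, of_nat p:] ^ (2 * k + 2 - 2 * j)))"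

definition common_roots :: "complex poly \<Rightarrow> complex poly \<Rightarrow> complex set" where
  "common_roots f g = {z. poly f z = 0 \<and> poly g z = 0}"

definition delta :: "nat \<Rightarrow> nat" where
  "delta k = (if gcd k 2 = 1 then 0 else 1)"

end

theory Submission
  imports
    Defs
    "HOL-Complex_Analysis.Complex_Analysis"
    "HOL-Number_Theory.Cong"
    "Jordan_Normal_Form.Char_Poly"
begin

text \<open>
  Put \<open>t = p z\<close> and let \<open>D(z)\<close> be the quantity in question. Summing the Lambert series over \<open>n\<close> first turns
  \<open>F\<close> into a sum of cotangents, whose partial fractions give (for \<open>k \<ge> 1\<close>) an absolutely convergent double
  sum over \<open>d\<close> and \<open>n\<close> prime to \<open>p\<close> of \<open>1 / (d^(2k) (d^2 t^2 - n^2))\<close>. Exchanging \<open>d\<close> and \<open>n\<close> corresponds to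
  \<open>t \<mapsto> - 1 / t\<close>, so \<open>D(z)\<close> is a finite geometric sum of even zeta values:
  \<open>D(z) = c (t^(2k) - 1) + \<pi>^(2k+1) \<kappa> R(z) / z\<close> with \<open>\<kappa>\<close> algebraic and nonzero. As \<open>\<pi>\<close> is transcendental,
  exceptional \<open>z\<close> with \<open>t^(2k) = 1\<close> are common roots of \<open>R\<close> and \<open>t^(2k) - 1\<close>, and all other ones share the value
  \<open>\<alpha> = R(z) / (z (t^(2k) - 1))\<close>, i.e. are nonzero roots of a polynomial of degree at most \<open>2k + 1\<close> that
  vanishes at 0.

  For \<open>k = 0\<close> the double sum converges only conditionally, and the defect of exchanging the summations makes
  \<open>D(z)\<close> a nonzero rational multiple of \<open>log (t / i)\<close>, which is transcendental unless \<open>t = i\<close> by the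
  Hermite-Lindemann theorem.

  The latter is proved with Hermite-Pade approximants of \<open>1, e^x, \<dots>, e^(N x)\<close> at an algebraic point \<open>\<alpha>\<close>.
  If \<open>e^\<alpha>\<close> were algebraic too, the approximating form would be the eigenvalue of an integer matrix, whose
  determinant is nonzero by a congruence modulo a large prime; Cramer's rule then bounds the form from below,
  contradicting its contour integral.
\<close>

section \<open>Integer matrices acting on algebraic numbers\<close>

text \<open>The constant \<open>c\<close> carries an odd zeta value of unknown arithmetic nature, so
  off the roots of \<open>t^(2k) = 1\<close> a single exceptional point leads to no contradiction.
  Comparing two of them eliminates \<open>c\<close>, and root counting then bounds their number.
  \<open>R\<close> has no term below \<open>z^2\<close>, so the counting polynomial has the root 0
  outside the half-plane; this saves one and gives \<open>2k\<close>. The extra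
  \<open>delta k\<close> is \<open>i/p\<close> alone, since \<open>-i/p\<close> lies in the lower
  half-plane.

  The coefficients \<open>a_n\<close> suit the exchange of \<open>d\<close> and \<open>n\<close>:
  they turn the inner series into a difference of cotangents at \<open>u\<close> and
  \<open>p u\<close> whose poles at 0 cancel. What is left are the \<open>n\<close> prime to
  \<open>p\<close>, the condition that the character puts on \<open>d\<close>.

  Integer matrices with a common eigenvector stand in for a number field: no conjugates are needed,
  the determinant replaces the norm, and sums and products of algebraic numbers come for free. The
  price is a power of \<open>P!\<close> that grows with the matrix size, so the number of
  exponentials must grow with it.\<close>

lemma algebraic_monic_relation:
  fixes x :: complex
  assumes "algebraic x" "x \<noteq> 0"
  obtains c :: int and d :: nat and g :: "nat \<Rightarrow> int"
  where "c \<noteq> 0" "d > 0" "g 0 \<noteq> 0" "(of_int c * x) ^ d = (\<Sum>i<d. of_int (g i) * (of_int c * x) ^ i)"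
proof -
  \<comment> \<open>As \<open>x\<close> is nonzero, powers of the variable can be split off until
    the constant coefficient is nonzero. This later makes the companion matrix of \<open>x\<close>
    invertible.\<close>
  from assms obtain f where f: "f \<noteq> 0" "coeff f 0 \<noteq> 0" "poly (map_poly of_int f) x = 0"
    by (rule algebraicE'_nonzero)
  define d where "d = degree f"
  define c where "c = lead_coeff f"
  have c0: "c \<noteq> 0" using f by (simp add: c_def)
  have eq: "(\<Sum>i\<le>d. of_int (coeff f i) * x ^ i) = 0"
    using f(3) by (simp add: poly_altdef degree_map_poly coeff_map_poly d_def)
  have d0: "d > 0"
  proof (rule ccontr)
    assume "\<not> d > 0"
    then have "d = 0" by simp
    with eq f(2) show False by simp
  qed
  \<comment> \<open>Multiplying the relation by \<open>c ^ (d - 1)\<close> makes it monic in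
    \<open>c * x\<close>; the term of degree \<open>i\<close> uses up \<open>c ^ i\<close> and keeps
    the rest.\<close>
  define g where "g i = - (c ^ (d - 1 - i) * coeff f i)" for i
  have "of_int c ^ (d - 1) * (\<Sum>i\<le>d. of_int (coeff f i) * x ^ i) = (0::complex)"
    using eq by simp
  also have "{..d} = insert d {..<d}" by auto
  also have "of_int c ^ (d - 1) * (\<Sum>i\<in>insert d {..<d}. of_int (coeff f i) * x ^ i) =
      of_int c ^ (d - 1) * of_int c * x ^ d + (\<Sum>i<d. of_int c ^ (d - 1) * of_int (coeff f i) * x ^ i)"
    by (simp add: c_def d_def algebra_simps sum_distrib_left)
  also have "of_int c ^ (d - 1) * of_int c * x ^ d = (of_int c * x) ^ d"
    using d0 by (simp add: power_mult_distrib flip: power_Suc2)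
  also have "(\<Sum>i<d. of_int c ^ (d - 1) * of_int (coeff f i) * x ^ i) =
      (\<Sum>i<d. - of_int (g i) * (of_int c * x) ^ i)"
  proof (rule sum.cong)
    fix i assume "i \<in> {..<d}"
    then have "d - 1 = (d - 1 - i) + i" by auto
    then have "of_int c ^ (d - 1) = (of_int c ^ (d - 1 - i) * of_int c ^ i :: complex)"
      by (metis power_add)
    then show "of_int c ^ (d - 1) * of_int (coeff f i) * x ^ i = - of_int (g i) * (of_int c * x) ^ i"
      by (simp add: g_def power_mult_distrib)
  qed simp
  finally have "(of_int c * x) ^ d = (\<Sum>i<d. of_int (g i) * (of_int c * x) ^ i)"
    by (simp add: sum_negf)
  moreover have "g 0 \<noteq> 0" using c0 f(2) by (simp add: g_def)
  ultimately show ?thesis using that c0 d0 by blast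
qed

text \<open>An eigenvector relation with the matrix kept over the integers and only \<open>v\<close>
  complex. That \<open>v\<close> is nonzero is expressed elsewhere by \<open>v 0 = 1\<close>, which
  also normalises the lower bound. Numbers acting on the same \<open>v\<close> can be added and
  multiplied through their matrices.\<close>

definition acts_by :: "int mat \<Rightarrow> nat \<Rightarrow> (nat \<Rightarrow> complex) \<Rightarrow> complex \<Rightarrow> bool" where
  "acts_by A n v x \<longleftrightarrow> A \<in> carrier_mat n n \<and> (\<forall>k<n. (\<Sum>l<n. of_int (A $$ (k, l)) * v l) = x * v k)"

lemma acts_by_carrier: "acts_by A n v x \<Longrightarrow> A \<in> carrier_mat n n"
  by (simp add: acts_by_def)

lemma mat_mult_entry:
  assumes "A \<in> carrier_mat n n" "B \<in> carrier_mat n n" "k < n" "l < n"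
  shows "(A * B) $$ (k, l) = (\<Sum>m<n. A $$ (k, m) * B $$ (m, l))"
  using assms by (auto simp: scalar_prod_def lessThan_atLeast0 intro!: sum.cong)

lemma acts_by_mult:
  assumes "acts_by A n v x" "acts_by B n v y"
  shows "acts_by (A * B) n v (x * y)"
proof -
  have c: "A \<in> carrier_mat n n" "B \<in> carrier_mat n n" using assms by (auto simp: acts_by_def)
  have "(\<Sum>l<n. of_int ((A * B) $$ (k, l)) * v l) = x * y * v k" if k: "k < n" for k
  proof -
    have "(\<Sum>l<n. of_int ((A * B) $$ (k, l)) * v l) =
        (\<Sum>l<n. \<Sum>m<n. of_int (A $$ (k, m)) * (of_int (B $$ (m, l)) * v l))"
      using mat_mult_entry[OF c k] by (intro sum.cong) (auto simp: sum_distrib_right mult.assoc)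
    also have "\<dots> = (\<Sum>m<n. of_int (A $$ (k, m)) * (\<Sum>l<n. of_int (B $$ (m, l)) * v l))"
      by (subst sum.swap) (simp add: sum_distrib_left)
    also have "\<dots> = (\<Sum>m<n. of_int (A $$ (k, m)) * (y * v m))"
      using assms(2) by (intro sum.cong) (auto simp: acts_by_def)
    also have "\<dots> = y * (\<Sum>m<n. of_int (A $$ (k, m)) * v m)"
      by (simp add: sum_distrib_left mult_ac)
    also have "\<dots> = x * y * v k" using assms(1) k by (simp add: acts_by_def)
    finally show ?thesis .
  qed
  then show ?thesis using c by (auto simp: acts_by_def)
qed

lemma acts_by_one: "acts_by (1\<^sub>m n) n v 1"
  by (auto simp: acts_by_def if_distrib if_distribR sum.delta cong: if_cong)

lemma acts_by_pow:
  assumes "acts_by A n v x"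
  shows "acts_by (A ^\<^sub>m i) n v (x ^ i)"
proof (induction i)
  case 0
  then show ?case using acts_by_one acts_by_carrier[OF assms] by (auto simp: acts_by_def)
next
  case (Suc i)
  then show ?case using acts_by_mult[OF Suc assms] by (simp add: mult.commute)
qed

lemma acts_by_lincomb:
  assumes "finite I" "\<And>i. i \<in> I \<Longrightarrow> acts_by (A i) n v (x i)"
  shows "acts_by (mat n n (\<lambda>(k, l). \<Sum>i\<in>I. c i * A i $$ (k, l))) n v (\<Sum>i\<in>I. of_int (c i) * x i)"
proof -
  have "(\<Sum>l<n. of_int (\<Sum>i\<in>I. c i * A i $$ (k, l)) * v l) = (\<Sum>i\<in>I. of_int (c i) * x i) * v k"
    if k: "k < n" for k
  proof -
    have "(\<Sum>l<n. of_int (\<Sum>i\<in>I. c i * A i $$ (k, l)) * v l) =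
        (\<Sum>i\<in>I. of_int (c i) * (\<Sum>l<n. of_int (A i $$ (k, l)) * v l))"
      by (simp add: sum_distrib_left sum_distrib_right mult.assoc, subst sum.swap, simp)
    also have "\<dots> = (\<Sum>i\<in>I. of_int (c i) * x i) * v k"
      using assms(2) k by (auto simp: acts_by_def sum_distrib_right mult.assoc intro!: sum.cong)
    finally show ?thesis .
  qed
  then show ?thesis by (auto simp: acts_by_def)
qed

text \<open>Index bookkeeping for tensor products: \<open>l\<close> encodes the pair
  \<open>(l mod d, l div d)\<close>.\<close>

lemma sum_prod_index:
  fixes d e :: nat assumes "d > 0"
  shows "(\<Sum>l<d * e. f (l mod d) (l div d)) = (\<Sum>j<e. \<Sum>i<d. f i j)"
proof -
  have "(\<Sum>l<d * e. f (l mod d) (l div d)) = (\<Sum>j<e. \<Sum>l\<in>{j * d..<j * d + d}. f (l mod d) (l div d))"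
    using sum.nat_group[where g = "\<lambda>l. f (l mod d) (l div d)" and n = e and k = d]
    by (simp add: mult.commute)
  also have "\<dots> = (\<Sum>j<e. \<Sum>i<d. f i j)"
  proof (rule sum.cong)
    fix j
    have "(\<Sum>l\<in>{j * d..<j * d + d}. f (l mod d) (l div d)) = (\<Sum>i\<in>{0..<d}. f ((i + j * d) mod d) ((i + j * d) div d))"
      using sum.shift_bounds_nat_ivl[of "\<lambda>l. f (l mod d) (l div d)" 0 "j * d" d]
      by (simp add: add.commute)
    also have "\<dots> = (\<Sum>i<d. f i j)"
      by (intro sum.cong) (auto simp: assms)
    finally show "(\<Sum>l\<in>{j * d..<j * d + d}. f (l mod d) (l div d)) = (\<Sum>i<d. f i j)" .
  qed simp
  finally show ?thesis .
qed

text \<open>Tensor product of the companion matrices of \<open>x\<close> and \<open>y\<close>: the vector with entries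
  \<open>x ^ i * y ^ j\<close>, indexed by \<open>k = i + d * j\<close>, is a common eigenvector.\<close>
lemma common_eigenvector:
  fixes x y :: complex
  assumes de: "d > 0" "e > 0" and g0: "g 0 \<noteq> 0"
    and x: "x ^ d = (\<Sum>i<d. of_int (g i) * x ^ i)"
    and y: "y ^ e = (\<Sum>i<e. of_int (h i) * y ^ i)"
  obtains n A B v where "n > 0" "acts_by A n v x" "acts_by B n v y" "v 0 = 1" "det A \<noteq> 0"
proof -
  define n where "n = d * e"
  define v where "v k = x ^ (k mod d) * y ^ (k div d)" for k
  \<comment> \<open>\<open>A\<close> multiplies by \<open>x\<close> at fixed exponent of
    \<open>y\<close>: a shift to the next entry inside a block of length \<open>d\<close>, and the
    relation of \<open>x\<close> on the last entry. \<open>B\<close> does the same for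
    \<open>y\<close>, where the shift is by a whole block.\<close>
  define A where "A = mat n n (\<lambda>(k, l). if k mod d + 1 < d then (if l = k + 1 then 1 else 0)
      else if l div d = k div d then g (l mod d) else (0::int))"
  define B where "B = mat n n (\<lambda>(k, l). if k div d + 1 < e then (if l = k + d then 1 else 0)
      else if l mod d = k mod d then h (l div d) else (0::int))"
  have div_lt: "k div d < e" if "k < n" for k
    using that de by (simp add: n_def less_mult_imp_div_less mult.commute)
  have lt: "k + 1 < n" if "k < n" "k mod d + 1 < d" for k
  proof -
    have "k = d * (k div d) + k mod d" by simp
    then have "k + 1 < d * (k div d) + d" using that by linarith
    also have "d * (k div d) + d = d * (k div d + 1)" by simp
    also have "\<dots> \<le> n" using div_lt[OF that(1)] unfolding n_def by (intro mult_le_mono2) simp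
    finally show ?thesis .
  qed
  have lt': "k + d < n" if "k < n" "k div d + 1 < e" for k
  proof -
    have "k mod d < d" using de by simp
    moreover have "k = d * (k div d) + k mod d" by simp
    ultimately have "k < d * (k div d) + d" by linarith
    then have "k + d < d * (k div d + 2)" by simp
    also have "\<dots> \<le> n" using that unfolding n_def by (intro mult_le_mono2) simp
    finally show ?thesis .
  qed
  have mod_step: "(k + 1) mod d = k mod d + 1" "(k + 1) div d = k div d" if "k mod d + 1 < d" for k
    using that mod_Suc[of k d] div_Suc[of k d] by (auto simp del: One_nat_def simp: Suc_eq_plus1[symmetric] simp del: Suc_eq_plus1)
  have "acts_by A n v x"
    unfolding acts_by_def
  proof (intro conjI allI impI)
    fix k assume k: "k < n"
    show "(\<Sum>l<n. of_int (A $$ (k, l)) * v l) = x * v k"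
    proof (cases "k mod d + 1 < d")
      case True
      then have "(\<Sum>l<n. of_int (A $$ (k, l)) * v l) = (\<Sum>l<n. if l = k + 1 then v l else 0)"
        using k by (intro sum.cong) (auto simp: A_def)
      also have "\<dots> = v (k + 1)" using lt[OF k True] by simp
      also have "\<dots> = x * v k" using mod_step[OF True] by (simp add: v_def)
      finally show ?thesis .
    next
      case False
      then have kd: "k mod d + 1 = d" using de by (metis Suc_eq_plus1 Suc_lessI mod_less_divisor)
      have "(\<Sum>l<n. of_int (A $$ (k, l)) * v l) =
          (\<Sum>l<d * e. if l div d = k div d then of_int (g (l mod d)) * (x ^ (l mod d) * y ^ (l div d)) else 0)"
        using k False by (intro sum.cong) (auto simp: A_def n_def v_def)
      also have "\<dots> = (\<Sum>j<e. \<Sum>i<d. if j = k div d then of_int (g i) * (x ^ i * y ^ j) else 0)"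
        by (rule sum_prod_index[OF de(1)])
      also have "\<dots> = (\<Sum>j<e. if j = k div d then \<Sum>i<d. of_int (g i) * (x ^ i * y ^ j) else 0)"
        by (intro sum.cong) auto
      also have "\<dots> = (\<Sum>i<d. of_int (g i) * x ^ i) * y ^ (k div d)"
        using div_lt[OF k] by (simp add: sum_distrib_right mult.assoc)
      also have "\<dots> = x ^ (k mod d + 1) * y ^ (k div d)" unfolding kd x ..
      also have "\<dots> = x * v k" by (simp add: v_def)
      finally show ?thesis .
    qed
  qed (simp add: A_def)
  moreover have "acts_by B n v y"
    unfolding acts_by_def
  proof (intro conjI allI impI)
    fix k assume k: "k < n"
    show "(\<Sum>l<n. of_int (B $$ (k, l)) * v l) = y * v k"
    proof (cases "k div d + 1 < e")
      case True
      then have "(\<Sum>l<n. of_int (B $$ (k, l)) * v l) = (\<Sum>l<n. if l = k + d then v l else 0)"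
        using k by (intro sum.cong) (auto simp: B_def)
      also have "\<dots> = v (k + d)" using lt'[OF k True] by simp
      also have "\<dots> = y * v k" using de by (simp add: v_def)
      finally show ?thesis .
    next
      case False
      then have kd: "k div d + 1 = e" using div_lt[OF k] by simp
      have "(\<Sum>l<n. of_int (B $$ (k, l)) * v l) =
          (\<Sum>l<d * e. if l mod d = k mod d then of_int (h (l div d)) * (x ^ (l mod d) * y ^ (l div d)) else 0)"
        using k False by (intro sum.cong) (auto simp: B_def n_def v_def)
      also have "\<dots> = (\<Sum>j<e. \<Sum>i<d. if i = k mod d then of_int (h j) * (x ^ i * y ^ j) else 0)"
        by (rule sum_prod_index[OF de(1)])
      also have "\<dots> = (\<Sum>j<e. of_int (h j) * (x ^ (k mod d) * y ^ j))"
        using de by (intro sum.cong) (auto simp: sum.delta)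
      also have "\<dots> = x ^ (k mod d) * (\<Sum>j<e. of_int (h j) * y ^ j)"
        by (simp add: sum_distrib_left mult_ac)
      also have "\<dots> = x ^ (k mod d) * y ^ (k div d + 1)" unfolding kd y ..
      also have "\<dots> = y * v k" by (simp add: v_def)
      finally show ?thesis .
    qed
  qed (simp add: B_def)
  \<comment> \<open>A kernel vector vanishes. The shift rows kill its entries with
    \<open>l mod d\<close> nonzero; then the last row of each block reduces to \<open>g 0\<close>
    times the first entry of that block.\<close>
  moreover have "det A \<noteq> 0"
  proof
    have carr: "A \<in> carrier_mat n n" by (simp add: A_def)
    assume "det A = 0"
    then obtain u where u: "u \<in> carrier_vec n" "u \<noteq> 0\<^sub>v n" "A *\<^sub>v u = 0\<^sub>v n"
      using det_0_iff_vec_prod_zero[OF carr] by auto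
    have row: "(\<Sum>l<n. A $$ (k, l) * u $ l) = 0" if "k < n" for k
    proof -
      have "(A *\<^sub>v u) $ k = (\<Sum>l<n. A $$ (k, l) * u $ l)"
        using that u(1) carr by (auto simp: scalar_prod_def lessThan_atLeast0 intro!: sum.cong)
      then show ?thesis using u(3) that by simp
    qed
    have nz: "u $ l = 0" if l: "l < n" "l mod d \<noteq> 0" for l
    proof -
      define k where "k = l - 1"
      have l1: "l = k + 1" using l by (cases l) (auto simp: k_def)
      have kd: "k mod d + 1 < d"
      proof (rule ccontr)
        assume "\<not> k mod d + 1 < d"
        then have "k mod d + 1 = d" using de by (metis Suc_eq_plus1 Suc_lessI mod_less_divisor)
        then have "l mod d = 0" using l1 by (metis mod_add_left_eq mod_self)
        then show False using l by simp
      qed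
      have "0 = (\<Sum>m<n. A $$ (k, m) * u $ m)" using row[of k] l l1 by simp
      also have "\<dots> = (\<Sum>m<n. if m = l then u $ m else 0)"
        using l l1 kd by (intro sum.cong) (auto simp: A_def)
      also have "\<dots> = u $ l" using l by simp
      finally show ?thesis by simp
    qed
    have "u $ l = 0" if l: "l < n" "l mod d = 0" for l
    proof -
      define k where "k = l + (d - 1)"
      have ld: "l = d * (l div d)" using l by auto
      have kd: "k div d = l div d" "k mod d = d - 1"
      proof -
        have "k = (d - 1) + d * (l div d)" using ld by (simp add: k_def)
        then have "k div d = ((d - 1) + d * (l div d)) div d" "k mod d = ((d - 1) + d * (l div d)) mod d"
          by simp_all
        then show "k div d = l div d" "k mod d = d - 1"
          using de by (simp_all only: div_mult_self2 mod_mult_self2) simp_all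
      qed
      have kn: "k < n"
      proof -
        have "k < d * (l div d + 1)" using ld de unfolding k_def by simp
        also have "\<dots> \<le> n" using div_lt[OF l(1)] unfolding n_def by (intro mult_le_mono2) simp
        finally show ?thesis .
      qed
      have "0 = (\<Sum>m<n. A $$ (k, m) * u $ m)" using row[OF kn] by simp
      also have "\<dots> = (\<Sum>m<n. if m = l then g 0 * u $ m else 0)"
      proof (rule sum.cong)
        fix m assume m: "m \<in> {..<n}"
        show "A $$ (k, m) * u $ m = (if m = l then g 0 * u $ m else 0)"
        proof (cases "m mod d = 0")
          case True
          then have "m div d = l div d \<longleftrightarrow> m = l" using ld by (metis mult_div_mod_eq add.right_neutral)
          then show ?thesis using m kn kd True de by (auto simp: A_def)
        next
          case False
          then show ?thesis using nz[of m] m l by auto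
        qed
      qed simp
      also have "\<dots> = g 0 * u $ l" using l by simp
      finally show ?thesis using g0 by simp
    qed
    then have "u = 0\<^sub>v n" using u(1) nz by (intro eq_vecI) auto
    then show False using u(2) by simp
  qed
  moreover have "n > 0" "v 0 = 1" using de by (simp_all add: n_def v_def)
  ultimately show ?thesis using that by blast
qed

text \<open>The eigenvalue is a root of the characteristic polynomial, which is monic with integer
  coefficients.\<close>

lemma acts_by_algebraic:
  assumes "acts_by A n v x" "n > 0" "v 0 = 1"
  shows "algebraic x"
proof -
  have A: "A \<in> carrier_mat n n" using assms by (simp add: acts_by_def)
  let ?C = "map_mat complex_of_int A"
  have "eigenvector ?C (vec n v) x"
    unfolding eigenvector_def
  proof (intro conjI)
    show "vec n v \<in> carrier_vec (dim_row ?C)" using A by auto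
    have "vec n v $ 0 \<noteq> 0\<^sub>v n $ 0" using assms by simp
    then have "vec n v \<noteq> 0\<^sub>v n" by metis
    then show "vec n v \<noteq> 0\<^sub>v (dim_row ?C)" using A by auto
    show "?C *\<^sub>v vec n v = x \<cdot>\<^sub>v vec n v"
    proof (rule eq_vecI)
      fix k assume "k < dim_vec (x \<cdot>\<^sub>v vec n v)"
      then have k: "k < n" by simp
      then have "(?C *\<^sub>v vec n v) $ k = (\<Sum>l<n. of_int (A $$ (k, l)) * v l)"
        using A by (auto simp: scalar_prod_def lessThan_atLeast0 intro!: sum.cong)
      then show "(?C *\<^sub>v vec n v) $ k = (x \<cdot>\<^sub>v vec n v) $ k"
        using assms(1) k by (simp add: acts_by_def)
    qed (use A in auto)
  qed
  then have "eigenvalue ?C x" unfolding eigenvalue_def by blast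
  then have root: "poly (char_poly ?C) x = 0"
    using eigenvalue_root_char_poly[of ?C n x] A by simp
  have eq: "char_poly ?C = map_poly of_int (char_poly A)"
    by (rule of_int_hom.char_poly_hom[OF A])
  have "monic (char_poly A)" "degree (char_poly A) = n" using degree_monic_char_poly[OF A] by auto
  then have "char_poly A \<noteq> 0" by auto
  show ?thesis
  proof (rule algebraicI)
    show "poly (char_poly ?C) x = 0" by (rule root)
    show "char_poly ?C \<noteq> 0" using degree_monic_char_poly[of ?C n] A by auto
    show "coeff (char_poly ?C) i \<in> \<int>" for i unfolding eq by (simp add: coeff_map_poly)
  qed
qed

lemma algebraic_common_eigenvector:
  fixes x y :: complex
  assumes "algebraic x" "algebraic y" "x \<noteq> 0" "y \<noteq> 0"
  obtains n A B v and b c :: int where "n > 0" "b \<noteq> 0" "c \<noteq> 0" "v 0 = 1" "det A \<noteq> 0"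
    "acts_by A n v (of_int b * x)" "acts_by B n v (of_int c * y)"
proof -
  obtain b d g where b: "b \<noteq> 0" "d > 0" "g 0 \<noteq> 0"
      "(of_int b * x) ^ d = (\<Sum>i<d. of_int (g i) * (of_int b * x) ^ i)"
    using algebraic_monic_relation[OF assms(1,3)] by metis
  obtain c e h where c: "c \<noteq> 0" "e > 0"
      "(of_int c * y) ^ e = (\<Sum>i<e. of_int (h i) * (of_int c * y) ^ i)"
    using algebraic_monic_relation[OF assms(2,4)] by metis
  show ?thesis
    using common_eigenvector[OF b(2) c(2) b(3,4) c(3)] that b(1) c(1) by metis
qed

section \<open>Closure of the algebraic numbers under arithmetic\<close>

lemma algebraic_of_int_mult_cancel:
  fixes x :: complex
  assumes "algebraic (of_int b * x)" "b \<noteq> 0"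
  shows "algebraic x"
proof -
  obtain p where p: "\<And>i. coeff p i \<in> \<int>" "p \<noteq> 0" "poly p (of_int b * x) = 0"
    using assms(1) by (rule algebraicE) auto
  show ?thesis
  proof (rule algebraicI)
    show "poly (pcompose p [:0, of_int b:]) x = 0" using p(3) by (simp add: poly_pcompose mult.commute)
    show "pcompose p [:0, of_int b:] \<noteq> 0" using p(2) assms(2) by (subst pcompose_eq_0_iff) auto
    show "coeff (pcompose p [:0, of_int b:]) i \<in> \<int>" for i
      using p(1)[of i] by (simp add: coeff_pcompose_linear)
  qed
qed

lemma algebraic_mult:
  fixes x y :: complex
  assumes "algebraic x" "algebraic y"
  shows "algebraic (x * y)"
proof (cases "x = 0 \<or> y = 0")
  case False
  then obtain n A B v and b c :: int where *: "n > 0" "b \<noteq> 0" "c \<noteq> 0" "v 0 = 1"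
    "acts_by A n v (of_int b * x)" "acts_by B n v (of_int c * y)"
    using algebraic_common_eigenvector[OF assms] by metis
  have "algebraic (of_int (b * c) * (x * y))"
    using acts_by_algebraic[OF acts_by_mult[OF *(5,6)] *(1,4)] by (simp add: mult_ac)
  then show ?thesis by (rule algebraic_of_int_mult_cancel) (use * in simp)
qed auto

lemma algebraic_add:
  fixes x y :: complex
  assumes "algebraic x" "algebraic y"
  shows "algebraic (x + y)"
proof (cases "x = 0 \<or> y = 0")
  case True
  then show ?thesis using assms by auto
next
  case False
  then obtain n A B v and b c :: int where *: "n > 0" "b \<noteq> 0" "c \<noteq> 0" "v 0 = 1"
    "acts_by A n v (of_int b * x)" "acts_by B n v (of_int c * y)"
    using algebraic_common_eigenvector[OF assms] by metis
  \<comment> \<open>The two numbers come with different multipliers \<open>b\<close> and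
    \<open>c\<close>; the crossed weights \<open>c\<close> and \<open>b\<close> produce
    \<open>b * c * (x + y)\<close>.\<close>
  define C where "C = (\<lambda>i::nat. if i = 0 then A else B)"
  define k where "k = (\<lambda>i::nat. if i = 0 then c else b)"
  define z where "z = (\<lambda>i::nat. if i = 0 then of_int b * x else of_int c * y)"
  have "acts_by (mat n n (\<lambda>(r, l). \<Sum>i\<in>{..1}. k i * C i $$ (r, l))) n v (\<Sum>i\<in>{..1::nat}. of_int (k i) * z i)"
    by (rule acts_by_lincomb) (use * in \<open>auto simp: C_def z_def\<close>)
  then have "algebraic (\<Sum>i\<in>{..1::nat}. of_int (k i) * z i)"
    using acts_by_algebraic *(1,4) by blast
  also have "(\<Sum>i\<in>{..1::nat}. of_int (k i) * z i) = of_int (b * c) * (x + y)"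
    by (simp add: k_def z_def algebra_simps)
  finally show ?thesis by (rule algebraic_of_int_mult_cancel) (use * in simp)
qed

lemma algebraic_diff:
  fixes x y :: complex
  assumes "algebraic x" "algebraic y"
  shows "algebraic (x - y)"
  using algebraic_add[of x "- y"] assms by (simp add: algebraic_minus)

lemma algebraic_divide:
  fixes x y :: complex
  assumes "algebraic x" "algebraic y"
  shows "algebraic (x / y)"
  using algebraic_mult[of x "inverse y"] assms by (simp add: algebraic_inverse divide_inverse)

lemma algebraic_pow:
  fixes x :: complex
  assumes "algebraic x"
  shows "algebraic (x ^ n)"
  by (induction n) (auto intro: algebraic_mult assms)

lemma algebraic_sum:
  fixes f :: "'a \<Rightarrow> complex"
  assumes "\<And>i. i \<in> I \<Longrightarrow> algebraic (f i)"
  shows "algebraic (\<Sum>i\<in>I. f i)"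
  using assms by (induction I rule: infinite_finite_induct) (auto intro: algebraic_add)

section \<open>Size and congruences of integer determinants\<close>

lemma det_abs_le:
  fixes A :: "int mat"
  assumes "A \<in> carrier_mat n n" "\<And>i j. i < n \<Longrightarrow> j < n \<Longrightarrow> \<bar>A $$ (i, j)\<bar> \<le> H"
  shows "\<bar>det A\<bar> \<le> fact n * H ^ n"
proof -
  have "\<bar>det A\<bar> \<le> (\<Sum>p\<in>{p. p permutes {0..<n}}. \<bar>signof p * (\<Prod>i = 0..<n. A $$ (i, p i))\<bar>)"
    unfolding det_def'[OF assms(1)] by (rule sum_abs)
  also have "\<dots> \<le> (\<Sum>p\<in>{p. p permutes {0..<n}}. H ^ n)"
  proof (rule sum_mono)
    fix p assume "p \<in> {p. p permutes {0..<n}}"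
    then have p: "p i < n" if "i < n" for i
      using that permutes_in_image[of p "{0..<n}" i] by auto
    have "\<bar>signof p * (\<Prod>i = 0..<n. A $$ (i, p i))\<bar> = (\<Prod>i = 0..<n. \<bar>A $$ (i, p i)\<bar>)"
      by (simp add: abs_mult abs_prod sign_def)
    also have "\<dots> \<le> (\<Prod>i = 0..<n. H)"
      by (rule prod_mono) (use p assms(2) in auto)
    finally show "\<bar>signof p * (\<Prod>i = 0..<n. A $$ (i, p i))\<bar> \<le> H ^ n" by simp
  qed
  also have "\<dots> = fact n * H ^ n"
    using card_permutations[of "{0..<n}" n] by simp
  finally show ?thesis .
qed

text \<open>A lower bound in the style of Liouville: by Cramer's rule a nonzero integral determinant
  forces the eigenvalue away from zero.\<close>
lemma acts_by_lower_bound: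
  assumes act: "acts_by M n v \<theta>" and n: "n > 0" and v0: "v 0 = 1" and det: "det M \<noteq> 0"
    and H: "\<And>i j. i < n \<Longrightarrow> j < n \<Longrightarrow> \<bar>M $$ (i, j)\<bar> \<le> H" "H \<ge> 1"
    and V: "\<And>i. i < n \<Longrightarrow> norm (v i) \<le> V"
  shows "1 \<le> norm \<theta> * (real n * (fact n * of_int H ^ n * V))"
proof -
  have M: "M \<in> carrier_mat n n" using act by (simp add: acts_by_def)
  define a where "a = adj_mat M"
  have a: "a \<in> carrier_mat n n" "a * M = det M \<cdot>\<^sub>m 1\<^sub>m n" using adj_mat[OF M] by (simp_all add: a_def)
  have entry: "\<bar>a $$ (0, k)\<bar> \<le> fact n * H ^ n" if k: "k < n" for k
  proof -
    \<comment> \<open>The adjugate is the transposed cofactor matrix, so its row 0 consists of the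
      minors that omit column 0.\<close>
    have "a $$ (0, k) = cofactor M k 0" using M k n by (simp add: a_def adj_mat_def)
    then have "\<bar>a $$ (0, k)\<bar> = \<bar>det (mat_delete M k 0)\<bar>" by (simp add: cofactor_def abs_mult power_abs)
    also have "\<dots> \<le> fact (n - 1) * H ^ (n - 1)"
    proof (rule det_abs_le)
      show "mat_delete M k 0 \<in> carrier_mat (n - 1) (n - 1)" using M mat_delete_carrier by blast
      fix i j assume ij: "i < n - 1" "j < n - 1"
      have "mat_delete M k 0 $$ (i, j) = M $$ (if i < k then i else Suc i, Suc j)"
        using M ij by (simp add: mat_delete_def)
      then show "\<bar>mat_delete M k 0 $$ (i, j)\<bar> \<le> H"
        using H(1)[of "if i < k then i else Suc i" "Suc j"] ij by auto
    qed
    also have "\<dots> \<le> fact n * H ^ n"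
      using H(2) by (intro mult_mono fact_mono power_increasing) auto
    finally show ?thesis .
  qed
  have entry': "norm (complex_of_int (a $$ (0, k))) \<le> fact n * of_int H ^ n" if "k < n" for k
  proof -
    have "real_of_int \<bar>a $$ (0, k)\<bar> \<le> real_of_int (fact n * H ^ n)" using entry[OF that] by (simp only: of_int_le_iff)
    then show ?thesis by (simp only: of_int_mult of_int_fact of_int_power of_int_abs norm_of_int)
  qed
  \<comment> \<open>Row 0 of \<open>adj M * M = det M * 1\<close>, applied to \<open>v\<close>,
    isolates \<open>v 0 = 1\<close>; moving \<open>M\<close> onto \<open>v\<close> first brings out
    the factor \<open>\<theta>\<close>.\<close>
  have "of_int (det M) = (\<Sum>l<n. of_int ((a * M) $$ (0, l)) * v l)"
    unfolding a(2) using n v0 by (simp add: if_distrib if_distribR cong: if_cong)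
  also have "\<dots> = (\<Sum>l<n. \<Sum>k<n. of_int (a $$ (0, k)) * (of_int (M $$ (k, l)) * v l))"
    using mat_mult_entry[OF a(1) M n] by (intro sum.cong) (auto simp: sum_distrib_right mult.assoc)
  also have "\<dots> = (\<Sum>k<n. of_int (a $$ (0, k)) * (\<Sum>l<n. of_int (M $$ (k, l)) * v l))"
    by (subst sum.swap) (simp add: sum_distrib_left)
  also have "\<dots> = (\<Sum>k<n. of_int (a $$ (0, k)) * (\<theta> * v k))"
    using act by (intro sum.cong) (auto simp: acts_by_def)
  also have "\<dots> = \<theta> * (\<Sum>k<n. of_int (a $$ (0, k)) * v k)"
    by (simp add: sum_distrib_left mult_ac)
  finally have eq: "of_int (det M) = \<theta> * (\<Sum>k<n. of_int (a $$ (0, k)) * v k)" .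
  have "norm (\<Sum>k<n. of_int (a $$ (0, k)) * v k) \<le> (\<Sum>k<n. fact n * of_int H ^ n * V)"
    using entry' V H(2) by (intro sum_norm_le) (auto simp: norm_mult intro!: mult_mono)
  also have "\<dots> = real n * (fact n * of_int H ^ n * V)" by simp
  finally have le: "norm (\<Sum>k<n. of_int (a $$ (0, k)) * v k) \<le> real n * (fact n * of_int H ^ n * V)" .
  have "(1::real) \<le> of_int \<bar>det M\<bar>" using det by linarith
  also have "\<dots> = norm (complex_of_int (det M))" by simp
  also have "\<dots> \<le> norm \<theta> * (real n * (fact n * of_int H ^ n * V))"
    unfolding eq norm_mult using le by (intro mult_left_mono) auto
  finally show ?thesis .
qed

lemma mat_mult_entry_bound:
  fixes A B :: "int mat"
  assumes "A \<in> carrier_mat n n" "B \<in> carrier_mat n n"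
    and "\<And>i j. i < n \<Longrightarrow> j < n \<Longrightarrow> \<bar>A $$ (i, j)\<bar> \<le> a" "\<And>i j. i < n \<Longrightarrow> j < n \<Longrightarrow> \<bar>B $$ (i, j)\<bar> \<le> b"
    and "k < n" "l < n"
  shows "\<bar>(A * B) $$ (k, l)\<bar> \<le> int n * (a * b)"
proof -
  have "\<bar>(A * B) $$ (k, l)\<bar> \<le> (\<Sum>m<n. \<bar>A $$ (k, m) * B $$ (m, l)\<bar>)"
    unfolding mat_mult_entry[OF assms(1,2,5,6)] by (rule sum_abs)
  also have "\<dots> \<le> (\<Sum>m<n. a * b)"
    using assms(3-6) by (intro sum_mono) (force simp: abs_mult intro!: mult_mono order_trans[OF abs_ge_zero])
  finally show ?thesis by simp
qed

text \<open>The summand 1 keeps the base at least 1, so that the bound increases with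
  \<open>i\<close> and one value serves for all smaller exponents.\<close>

lemma pow_mat_entry_bound:
  fixes A :: "int mat"
  assumes A: "A \<in> carrier_mat n n" "\<And>i j. i < n \<Longrightarrow> j < n \<Longrightarrow> \<bar>A $$ (i, j)\<bar> \<le> a" and a: "a \<ge> 0"
    and "k < n" "l < n"
  shows "\<bar>(A ^\<^sub>m i) $$ (k, l)\<bar> \<le> (int n * a + 1) ^ i"
  using assms(4,5)
proof (induction i arbitrary: k l)
  case 0
  then show ?case using A by auto
next
  case (Suc i)
  have "\<bar>(A ^\<^sub>m i * A) $$ (k, l)\<bar> \<le> int n * ((int n * a + 1) ^ i * a)"
    using Suc A by (intro mat_mult_entry_bound pow_carrier_mat) auto
  also have "\<dots> \<le> (int n * a + 1) ^ i * (int n * a + 1)" using a by (simp add: algebra_simps)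
  finally show ?case by (simp add: mult.commute)
qed

text \<open>The determinant is a polynomial in the entries with integer coefficients.\<close>

lemma det_cong:
  fixes A B :: "int mat"
  assumes "A \<in> carrier_mat n n" "B \<in> carrier_mat n n"
    and "\<And>i j. i < n \<Longrightarrow> j < n \<Longrightarrow> [A $$ (i, j) = B $$ (i, j)] (mod m)"
  shows "[det A = det B] (mod m)"
  unfolding det_def'[OF assms(1)] det_def'[OF assms(2)]
proof (intro cong_sum cong_mult cong_prod cong_refl)
  fix p i assume "p \<in> {p. p permutes {0..<n}}" and i: "i \<in> {0..<n}"
  then have "p i < n" using permutes_in_image[of p "{0..<n}" i] by auto
  then show "[A $$ (i, p i) = B $$ (i, p i)] (mod m)" using assms(3) i by simp
qed

lemma det_pow_mat:
  fixes A :: "int mat"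
  assumes "A \<in> carrier_mat n n"
  shows "det (A ^\<^sub>m i) = det A ^ i"
  by (induction i) (use assms in \<open>auto simp: det_mult[OF pow_carrier_mat[OF assms] assms] mult.commute\<close>)

section \<open>The Hermite-Lindemann theorem\<close>

text \<open>Induction on the total pole order. With two different poles \<open>a\<close> and
  \<open>b\<close>, the identity \<open>(x - b) - (x - a) = a - b\<close> lowers one order or the
  other. Dividing by \<open>a - b\<close> costs one factor \<open>W\<close>, and the difference of
  two decompositions costs a factor 2, hence \<open>(2 * W) ^ T\<close>.\<close>

lemma partial_fraction_integral:
  fixes N L :: nat
  defines "W \<equiv> fact N :: int"
  assumes "T = (\<Sum>j\<le>N. nn j)" "T \<ge> 1" "\<And>j. j \<le> N \<Longrightarrow> nn j \<le> L"
  shows "\<exists>c :: nat \<Rightarrow> nat \<Rightarrow> int. (\<forall>j i. nn j \<le> i \<longrightarrow> c j i = 0) \<and> (\<forall>j i. \<bar>c j i\<bar> \<le> (2 * W) ^ T) \<and>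
    (\<forall>x :: complex. (\<forall>j\<le>N. x \<noteq> of_nat j) \<longrightarrow>
      of_int W ^ T / (\<Prod>j\<le>N. (x - of_nat j) ^ nn j) = (\<Sum>j\<le>N. \<Sum>i<L. of_int (c j i) / (x - of_nat j) ^ Suc i))"
  using assms(2-4)
proof (induction T arbitrary: nn)
  case 0
  then show ?case by simp
next
  case (Suc T)
  have W: "W \<ge> 1" by (simp add: W_def)
  obtain a where a: "a \<le> N" "nn a \<ge> 1"
  proof -
    have "\<exists>a\<le>N. nn a \<noteq> 0" using Suc.prems(1) by (metis sum.neutral atMost_iff Zero_not_Suc)
    then show ?thesis using that by (auto simp: Suc_le_eq)
  qed
  show ?case
  proof (cases "\<exists>b\<le>N. b \<noteq> a \<and> nn b \<ge> 1")
    \<comment> \<open>With \<open>a\<close> as the only pole the fraction is its own decomposition.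
      A pole of order \<open>Suc T\<close> has index \<open>T\<close>.\<close>
    case False
    then have nn0: "nn j = 0" if "j \<le> N" "j \<noteq> a" for j using False that by (metis not_one_le_zero not_less_eq_eq One_nat_def le_0_eq)
    have T: "Suc T = nn a"
    proof -
      have "(\<Sum>j\<le>N. nn j) = (\<Sum>j\<le>N. if j = a then nn j else 0)" using nn0 by (intro sum.cong) auto
      then show ?thesis using Suc.prems(1) a by simp
    qed
    define c where "c j i = (if j = a \<and> i = T then W ^ Suc T else 0)" for j i
    have "of_int W ^ Suc T / (\<Prod>j\<le>N. (x - of_nat j) ^ nn j) = (\<Sum>j\<le>N. \<Sum>i<L. of_int (c j i) / (x - of_nat j) ^ Suc i)"
      for x :: complex
    proof -
      have "(\<Prod>j\<le>N. (x - of_nat j) ^ nn j) = (\<Prod>j\<le>N. if j = a then (x - of_nat j) ^ nn j else 1)"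
        using nn0 by (intro prod.cong) auto
      then have p: "(\<Prod>j\<le>N. (x - of_nat j) ^ nn j) = (x - of_nat a) ^ Suc T" using a T by simp
      have "T < L" using T Suc.prems(3)[OF a(1)] by simp
      have "(\<Sum>j\<le>N. \<Sum>i<L. of_int (c j i) / (x - of_nat j) ^ Suc i) =
          (\<Sum>j\<le>N. if j = a then (\<Sum>i<L. if i = T then of_int W ^ Suc T / (x - of_nat j) ^ Suc i else 0) else 0)"
      proof (rule sum.cong)
        fix j
        show "(\<Sum>i<L. of_int (c j i) / (x - of_nat j) ^ Suc i) =
          (if j = a then (\<Sum>i<L. if i = T then of_int W ^ Suc T / (x - of_nat j) ^ Suc i else 0) else 0)"
        proof (cases "j = a")
          case True
          show ?thesis unfolding if_P[OF True] by (intro sum.cong) (use True in \<open>auto simp: c_def\<close>)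
        qed (simp add: c_def)
      qed simp
      also have "\<dots> = of_int W ^ Suc T / (x - of_nat a) ^ Suc T"
        using a \<open>T < L\<close> by simp
      finally show ?thesis using p by simp
    qed
    moreover have "\<bar>c j i\<bar> \<le> (2 * W) ^ Suc T" for j i
    proof (cases "j = a \<and> i = T")
      case True
      then have "\<bar>c j i\<bar> = W ^ Suc T" using W by (simp add: c_def)
      also have "\<dots> \<le> (2 * W) ^ Suc T" using W by (intro power_mono) auto
      finally show ?thesis .
    next
      case False
      then have "\<bar>c j i\<bar> = 0" by (auto simp: c_def)
      also have "0 \<le> (2 * W) ^ Suc T" using W by (intro zero_le_power) auto
      finally show ?thesis .
    qed
    moreover have "\<forall>j i. nn j \<le> i \<longrightarrow> c j i = 0" using T by (auto simp: c_def)
    ultimately show ?thesis by blast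
  next
    case True
    then obtain b where b: "b \<le> N" "b \<noteq> a" "nn b \<ge> 1" by blast
    define na where "na = nn(a := nn a - 1)"
    define nb where "nb = nn(b := nn b - 1)"
    have Ta: "T = (\<Sum>j\<le>N. na j)"
    proof -
      have "(\<Sum>j\<le>N. nn j) = nn a + (\<Sum>j\<in>{..N} - {a}. nn j)" using a by (intro sum.remove) auto
      moreover have "(\<Sum>j\<le>N. na j) = na a + (\<Sum>j\<in>{..N} - {a}. na j)" using a by (intro sum.remove) auto
      moreover have "(\<Sum>j\<in>{..N} - {a}. na j) = (\<Sum>j\<in>{..N} - {a}. nn j)"
        by (intro sum.cong) (auto simp: na_def)
      ultimately show ?thesis using Suc.prems(1) a by (simp add: na_def)
    qed
    have Tb: "T = (\<Sum>j\<le>N. nb j)"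
    proof -
      have "(\<Sum>j\<le>N. nn j) = nn b + (\<Sum>j\<in>{..N} - {b}. nn j)" using b by (intro sum.remove) auto
      moreover have "(\<Sum>j\<le>N. nb j) = nb b + (\<Sum>j\<in>{..N} - {b}. nb j)" using b by (intro sum.remove) auto
      moreover have "(\<Sum>j\<in>{..N} - {b}. nb j) = (\<Sum>j\<in>{..N} - {b}. nn j)"
        by (intro sum.cong) (auto simp: nb_def)
      ultimately show ?thesis using Suc.prems(1) b by (simp add: nb_def)
    qed
    have T1: "T \<ge> 1"
    proof -
      have "na b \<le> (\<Sum>j\<le>N. na j)" using b by (intro member_le_sum) auto
      then show ?thesis using b Ta by (simp add: na_def)
    qed
    have ble: "na j \<le> L" "nb j \<le> L" if "j \<le> N" for j
      using Suc.prems(3)[OF that] by (auto simp: na_def nb_def)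
    obtain ca where ca: "\<And>j i. na j \<le> i \<Longrightarrow> ca j i = 0" "\<And>j i. \<bar>ca j i\<bar> \<le> (2 * W) ^ T"
      "\<And>x :: complex. (\<forall>j\<le>N. x \<noteq> of_nat j) \<Longrightarrow>
      of_int W ^ T / (\<Prod>j\<le>N. (x - of_nat j) ^ na j) = (\<Sum>j\<le>N. \<Sum>i<L. of_int (ca j i) / (x - of_nat j) ^ Suc i)"
      using Suc.IH[OF Ta T1 ble(1)] by blast
    obtain cb where cb: "\<And>j i. nb j \<le> i \<Longrightarrow> cb j i = 0" "\<And>j i. \<bar>cb j i\<bar> \<le> (2 * W) ^ T"
      "\<And>x :: complex. (\<forall>j\<le>N. x \<noteq> of_nat j) \<Longrightarrow>
      of_int W ^ T / (\<Prod>j\<le>N. (x - of_nat j) ^ nb j) = (\<Sum>j\<le>N. \<Sum>i<L. of_int (cb j i) / (x - of_nat j) ^ Suc i)"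
      using Suc.IH[OF Tb T1 ble(2)] by blast
    \<comment> \<open>The choice of \<open>W\<close> as a factorial rests on this: all differences
      of two poles are at most \<open>N\<close> in absolute value.\<close>
    have "int a - int b dvd W"
    proof -
      have "nat \<bar>int a - int b\<bar> dvd fact N" using a b by (intro dvd_fact) auto
      then have "int (nat \<bar>int a - int b\<bar>) dvd int (fact N)" by (simp only: int_dvd_int_iff)
      then show ?thesis by (simp add: W_def)
    qed
    then obtain s where s: "W = (int a - int b) * s" by (auto elim: dvdE)
    have s_le: "\<bar>s\<bar> \<le> W"
    proof -
      have "s dvd W" using s by simp
      then show ?thesis using W dvd_imp_le_int[of W s] by simp
    qed
    define c where "c j i = s * (cb j i - ca j i)" for j i
    have "of_int W ^ Suc T / (\<Prod>j\<le>N. (x - of_nat j) ^ nn j) = (\<Sum>j\<le>N. \<Sum>i<L. of_int (c j i) / (x - of_nat j) ^ Suc i)"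
      if x: "\<forall>j\<le>N. x \<noteq> of_nat j" for x :: complex
    proof -
      define Q where "Q = (\<Prod>j\<le>N. (x - of_nat j) ^ nn j)"
      have "(\<Prod>j\<le>N. (x - of_nat j) ^ nn j) = (x - of_nat a) ^ nn a * (\<Prod>j\<in>{..N} - {a}. (x - of_nat j) ^ nn j)"
        using a by (intro prod.remove) auto
      moreover have "(\<Prod>j\<le>N. (x - of_nat j) ^ na j) = (x - of_nat a) ^ na a * (\<Prod>j\<in>{..N} - {a}. (x - of_nat j) ^ na j)"
        using a by (intro prod.remove) auto
      moreover have "(\<Prod>j\<in>{..N} - {a}. (x - of_nat j) ^ na j) = (\<Prod>j\<in>{..N} - {a}. (x - of_nat j) ^ nn j)"
        by (intro prod.cong) (auto simp: na_def)
      moreover have "(x - of_nat a) ^ nn a = (x - of_nat a) * (x - of_nat a) ^ na a"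
        using a by (simp add: na_def flip: power_Suc)
      ultimately have Qa: "Q = (x - of_nat a) * (\<Prod>j\<le>N. (x - of_nat j) ^ na j)" by (simp add: Q_def)
      have "(\<Prod>j\<le>N. (x - of_nat j) ^ nn j) = (x - of_nat b) ^ nn b * (\<Prod>j\<in>{..N} - {b}. (x - of_nat j) ^ nn j)"
        using b by (intro prod.remove) auto
      moreover have "(\<Prod>j\<le>N. (x - of_nat j) ^ nb j) = (x - of_nat b) ^ nb b * (\<Prod>j\<in>{..N} - {b}. (x - of_nat j) ^ nb j)"
        using b by (intro prod.remove) auto
      moreover have "(\<Prod>j\<in>{..N} - {b}. (x - of_nat j) ^ nb j) = (\<Prod>j\<in>{..N} - {b}. (x - of_nat j) ^ nn j)"
        by (intro prod.cong) (auto simp: nb_def)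
      moreover have "(x - of_nat b) ^ nn b = (x - of_nat b) * (x - of_nat b) ^ nb b"
        using b by (simp add: nb_def flip: power_Suc)
      ultimately have Qb: "Q = (x - of_nat b) * (\<Prod>j\<le>N. (x - of_nat j) ^ nb j)" by (simp add: Q_def)
      have xa: "x - of_nat a \<noteq> 0" "x - of_nat b \<noteq> 0" using x a b by auto
      have Q0: "Q \<noteq> 0" using x by (auto simp: Q_def)
      have "(\<Sum>j\<le>N. \<Sum>i<L. of_int (c j i) / (x - of_nat j) ^ Suc i) =
         of_int s * ((\<Sum>j\<le>N. \<Sum>i<L. of_int (cb j i) / (x - of_nat j) ^ Suc i) -
           (\<Sum>j\<le>N. \<Sum>i<L. of_int (ca j i) / (x - of_nat j) ^ Suc i))"
        by (simp add: c_def sum_distrib_left sum_subtractf[symmetric] right_diff_distrib diff_divide_distrib)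
      also have "\<dots> = of_int s * (of_int W ^ T / (Q / (x - of_nat b)) - of_int W ^ T / (Q / (x - of_nat a)))"
      proof -
        have "(\<Prod>j\<le>N. (x - of_nat j) ^ na j) = Q / (x - of_nat a)" unfolding Qa using xa by simp
        moreover have "(\<Prod>j\<le>N. (x - of_nat j) ^ nb j) = Q / (x - of_nat b)" unfolding Qb using xa by simp
        ultimately show ?thesis unfolding ca(3)[OF x, symmetric] cb(3)[OF x, symmetric] by (simp only:)
      qed
      also have "\<dots> = of_int s * of_int W ^ T * (of_nat a - of_nat b) / Q"
        using Q0 xa by (simp add: field_simps)
      also have "\<dots> = of_int W ^ Suc T / Q"
      proof -
        have "complex_of_int W = of_int ((int a - int b) * s)" using s by (rule arg_cong)
        then have "complex_of_int W = (of_nat a - of_nat b) * of_int s" by simp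
        then show ?thesis by (simp add: mult_ac)
      qed
      finally show ?thesis by (simp add: Q_def)
    qed
    moreover have "\<bar>c j i\<bar> \<le> (2 * W) ^ Suc T" for j i
    proof -
      have "\<bar>cb j i - ca j i\<bar> \<le> 2 * (2 * W) ^ T" using ca(2)[of j i] cb(2)[of j i] by linarith
      then have "\<bar>c j i\<bar> \<le> W * (2 * (2 * W) ^ T)" unfolding c_def abs_mult
        using s_le W by (intro mult_mono) auto
      then show ?thesis by (simp add: mult_ac)
    qed
    moreover have "\<forall>j i. nn j \<le> i \<longrightarrow> c j i = 0"
    proof (intro allI impI)
      fix j i assume "nn j \<le> i"
      then have "na j \<le> i" "nb j \<le> i" by (auto simp: na_def nb_def)
      then show "c j i = 0" using ca(1) cb(1) by (simp add: c_def)
    qed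
    ultimately show ?thesis by blast
  qed
qed

lemma higher_deriv_exp_mult: "(deriv ^^ k) (\<lambda>x. exp (z * x)) = (\<lambda>x::complex. z ^ k * exp (z * x))"
proof (induction k)
  case (Suc k)
  have "deriv (\<lambda>x. z ^ k * exp (z * x)) x = z ^ Suc k * exp (z * x)" for x
    by (rule DERIV_imp_deriv) (auto intro!: derivative_eq_intros)
  then show ?case using Suc by simp
qed simp

lemma exp_pole_contour_integral:
  fixes z w :: complex
  assumes "norm w < r"
  shows "((\<lambda>x. exp (z * x) / (x - w) ^ Suc i) has_contour_integral
           (2 * pi * \<i>) * (z ^ i / fact i * exp (z * w))) (circlepath 0 r)"
proof -
  have "((\<lambda>x. exp (z * x) / (x - w) ^ Suc i) has_contour_integral
           (2 * pi * \<i>) / fact i * (deriv ^^ i) (\<lambda>x. exp (z * x)) w) (circlepath 0 r)"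
    by (intro Cauchy_has_contour_integral_higher_derivative_circlepath holomorphic_intros continuous_intros)
       (use assms in auto)
  then show ?thesis by (simp add: higher_deriv_exp_mult)
qed

text \<open>Hermite-Pade approximation of \<open>1, exp z, \<dots>, exp (N z)\<close>: the sum is \<open>1 / (2 \<pi> i)\<close> times the integral
  over \<open>|x| = r\<close> of \<open>exp (z x)\<close> times the rational function just decomposed.\<close>
lemma hermite_pade_bound:
  fixes N L T :: nat and c :: "nat \<Rightarrow> nat \<Rightarrow> int" and z :: complex and W :: int
  assumes pf: "\<And>x :: complex. (\<forall>j\<le>N. x \<noteq> of_nat j) \<Longrightarrow>
      of_int W ^ T / (\<Prod>j\<le>N. (x - of_nat j) ^ nn j) = (\<Sum>j\<le>N. \<Sum>i<L. of_int (c j i) / (x - of_nat j) ^ Suc i)"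
    and T: "T = (\<Sum>j\<le>N. nn j)" and r: "r \<ge> 2 * real N" "r > 0" and W: "W \<ge> 0"
  shows "norm (\<Sum>j\<le>N. \<Sum>i<L. of_int (c j i) * (z ^ i / fact i * exp (z * of_nat j)))
           \<le> r * (of_int W ^ T * exp (norm z * r) * (2 / r) ^ T)"
proof -
  define S where "S = (\<Sum>j\<le>N. \<Sum>i<L. of_int (c j i) * (z ^ i / fact i * exp (z * of_nat j)))"
  have ne: "\<forall>j\<le>N. x \<noteq> of_nat j" if "norm x = r" for x :: complex
    using that r by (auto simp: norm_of_nat)
  have "((\<lambda>x. \<Sum>j\<le>N. \<Sum>i<L. of_int (c j i) * (exp (z * x) / (x - of_nat j) ^ Suc i)) has_contour_integral
      (\<Sum>j\<le>N. \<Sum>i<L. of_int (c j i) * ((2 * pi * \<i>) * (z ^ i / fact i * exp (z * of_nat j))))) (circlepath 0 r)"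
    by (intro has_contour_integral_sum has_contour_integral_lmul exp_pole_contour_integral)
       (use r in \<open>auto simp: norm_of_nat\<close>)
  also have "(\<Sum>j\<le>N. \<Sum>i<L. of_int (c j i) * ((2 * pi * \<i>) * (z ^ i / fact i * exp (z * of_nat j)))) = (2 * pi * \<i>) * S"
    by (simp add: S_def sum_distrib_left mult_ac)
  finally have int: "((\<lambda>x. exp (z * x) * (of_int W ^ T / (\<Prod>j\<le>N. (x - of_nat j) ^ nn j))) has_contour_integral (2 * pi * \<i>) * S) (circlepath 0 r)"
  proof (rule has_contour_integral_eq)
    fix x assume "x \<in> path_image (circlepath 0 r)"
    then have "norm x = r" using r by (simp add: dist_norm)
    note pf[OF ne[OF this]]
    then show "(\<Sum>j\<le>N. \<Sum>i<L. of_int (c j i) * (exp (z * x) / (x - of_nat j) ^ Suc i)) =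
       exp (z * x) * (of_int W ^ T / (\<Prod>j\<le>N. (x - of_nat j) ^ nn j))"
      by (simp add: sum_distrib_left mult_ac)
  qed
  have "norm ((2 * pi * \<i>) * S) \<le> (of_int W ^ T * exp (norm z * r) * (2 / r) ^ T) * (2 * pi * r)"
  proof (rule has_contour_integral_bound_circlepath[OF int])
    fix x :: complex assume "norm (x - 0) = r"
    then have x: "norm x = r" by simp
    \<comment> \<open>Since \<open>r\<close> is at least \<open>2 * N\<close>, every pole keeps
      distance \<open>r / 2\<close> from the circle.\<close>
    have "norm (x - of_nat j) \<ge> r / 2" if "j \<le> N" for j
    proof -
      have "norm (x - of_nat j) \<ge> norm x - norm (of_nat j :: complex)" by (rule norm_triangle_ineq2)
      moreover have "norm (of_nat j :: complex) \<le> real N" using that by simp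
      ultimately show ?thesis using r x by linarith
    qed
    then have "norm (\<Prod>j\<le>N. (x - of_nat j) ^ nn j) \<ge> (\<Prod>j\<le>N. (r / 2) ^ nn j)"
      unfolding prod_norm[symmetric] norm_power using r by (intro prod_mono conjI power_mono) auto
    also have "(\<Prod>j\<le>N. (r / 2) ^ nn j) = (r / 2) ^ T" by (simp add: T power_sum)
    finally have "norm (\<Prod>j\<le>N. (x - of_nat j) ^ nn j) \<ge> (r / 2) ^ T" .
    then have "of_int W ^ T / norm (\<Prod>j\<le>N. (x - of_nat j) ^ nn j) \<le> of_int W ^ T / (r / 2) ^ T"
      by (intro divide_left_mono mult_pos_pos) (use r W in \<open>auto intro: less_le_trans[of _ "(r / 2) ^ T"] simp del: zero_less_norm_iff\<close>)
    moreover have "norm (exp (z * x)) \<le> exp (norm z * r)"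
      using norm_exp[of "z * x"] x by (simp add: norm_mult)
    ultimately have "norm (exp (z * x)) * (of_int W ^ T / norm (\<Prod>j\<le>N. (x - of_nat j) ^ nn j))
        \<le> exp (norm z * r) * (of_int W ^ T / (r / 2) ^ T)"
      using W by (intro mult_mono) auto
    then show "norm (exp (z * x) * (of_int W ^ T / (\<Prod>j\<le>N. (x - of_nat j) ^ nn j)))
        \<le> of_int W ^ T * exp (norm z * r) * (2 / r) ^ T"
      using W by (simp add: norm_mult norm_divide norm_power power_divide mult_ac)
  qed (use r W in auto)
  then have "2 * pi * norm S \<le> 2 * pi * (r * (of_int W ^ T * exp (norm z * r) * (2 / r) ^ T))"
    by (simp add: norm_mult mult_ac)
  then show ?thesis unfolding S_def[symmetric] by simp
qed

text \<open>Multiply the decomposition by \<open>x ^ Suc P\<close> and let \<open>x\<close> tend to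
  0: only the pole of highest order at 0 contributes. Its coefficient thus divides a power of
  \<open>W\<close>, which for \<open>W = fact N\<close> excludes prime factors above
  \<open>N\<close>.\<close>

lemma partial_fraction_leading_coeff:
  fixes c :: "nat \<Rightarrow> nat \<Rightarrow> int" and W :: int
  assumes pf: "\<And>x :: complex. (\<forall>j\<le>N. x \<noteq> of_nat j) \<Longrightarrow>
      of_int W ^ T / (\<Prod>j\<le>N. (x - of_nat j) ^ nn j) = (\<Sum>j\<le>N. \<Sum>i<Suc P. of_int (c j i) / (x - of_nat j) ^ Suc i)"
    and nn0: "nn 0 = Suc P"
  shows "c 0 P * (\<Prod>j=1..N. (- int j) ^ nn j) = W ^ T"
proof -
  define lhs where "lhs x = of_int W ^ T / (\<Prod>j=1..N. (x - of_nat j) ^ nn j)" for x :: complex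
  \<comment> \<open>For \<open>j = 0\<close> the quotient of powers is cancelled in advance, so that
    all terms are continuous at 0.\<close>
  define t where "t j i x = (if j = 0 then of_int (c j i) * x ^ (P - i)
     else of_int (c j i) * (x ^ Suc P / (x - of_nat j) ^ Suc i))" for j i and x :: complex
  define rhs where "rhs x = (\<Sum>j\<le>N. \<Sum>i<Suc P. t j i x)" for x :: complex
  have "isCont lhs 0" unfolding lhs_def by (auto intro!: continuous_intros)
  then have l: "lhs \<midarrow>0\<rightarrow> lhs 0" by (simp add: isCont_def)
  have "isCont (t j i) 0" for j i
    by (cases "j = 0") (auto simp: t_def[abs_def] intro!: continuous_intros)
  then have "isCont rhs 0" unfolding rhs_def by (intro continuous_intros) auto
  then have r: "rhs \<midarrow>0\<rightarrow> rhs 0" by (simp add: isCont_def)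
  have "eventually (\<lambda>x. x \<in> ball 0 1 - {0}) (at (0::complex))"
    by (intro eventually_at_in_open) auto
  then have "eventually (\<lambda>x. lhs x = rhs x) (at 0)"
  proof eventually_elim
    case (elim x)
    have ne: "x \<noteq> of_nat j" for j
      using elim by (cases "j = 0") (auto simp: norm_of_nat)
    have "{..N} = insert 0 {1..N}" by auto
    then have "(\<Prod>j\<le>N. (x - of_nat j) ^ nn j) = x ^ Suc P * (\<Prod>j=1..N. (x - of_nat j) ^ nn j)"
      by (simp add: nn0)
    then have "lhs x = x ^ Suc P * (of_int W ^ T / (\<Prod>j\<le>N. (x - of_nat j) ^ nn j))"
      using elim by (simp add: lhs_def)
    also have "\<dots> = (\<Sum>j\<le>N. \<Sum>i<Suc P. x ^ Suc P * (of_int (c j i) / (x - of_nat j) ^ Suc i))"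
      using ne by (subst pf) (simp_all add: sum_distrib_left del: sum.lessThan_Suc)
    also have "\<dots> = rhs x" unfolding rhs_def
    proof (intro sum.cong refl)
      fix j i assume i: "i \<in> {..<Suc P}"
      show "x ^ Suc P * (of_int (c j i) / (x - of_nat j) ^ Suc i) = t j i x"
      proof (cases "j = 0")
        case True
        have "x ^ Suc P = x ^ (P - i) * x ^ Suc i" using i by (subst power_add[symmetric]) simp
        then show ?thesis using True elim by (simp add: t_def)
      qed (simp add: t_def)
    qed
    finally show ?case .
  qed
  then have "lhs \<midarrow>0\<rightarrow> rhs 0" using r by (simp cong: tendsto_cong)
  then have eq: "lhs 0 = rhs 0" using l LIM_unique by blast
  have "t j i 0 = (if j = 0 \<and> i = P then of_int (c 0 P) else 0)" if "i < Suc P" for j i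
    using that by (auto simp: t_def)
  then have "rhs 0 = (\<Sum>j\<le>N. \<Sum>i<Suc P. if j = 0 \<and> i = P then of_int (c 0 P) else 0)"
    by (auto simp: rhs_def intro!: sum.cong)
  also have "\<dots> = (\<Sum>j\<le>N. if j = 0 then \<Sum>i<Suc P. if i = P then of_int (c 0 P) else 0 else 0)"
    by (intro sum.cong) auto
  also have "\<dots> = of_int (c 0 P)" by simp
  finally have "rhs 0 = of_int (c 0 P)" .
  with eq have "of_int (c 0 P) = of_int W ^ T / (\<Prod>j=1..N. (- of_nat j :: complex) ^ nn j)"
    by (simp add: lhs_def)
  moreover have "(\<Prod>j=1..N. (- of_nat j :: complex) ^ nn j) \<noteq> 0" by auto
  ultimately have "of_int (c 0 P) * (\<Prod>j=1..N. (- of_nat j :: complex) ^ nn j) = of_int W ^ T" by simp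
  then have "complex_of_int (c 0 P * (\<Prod>j=1..N. (- int j) ^ nn j)) = of_int (W ^ T)" by simp
  then show ?thesis by (simp only: of_int_eq_iff)
qed

lemma entries_bounded:
  obtains a where "a \<ge> 0" "\<And>i j. i < n \<Longrightarrow> j < n \<Longrightarrow> \<bar>(A :: int mat) $$ (i, j)\<bar> \<le> a"
proof
  define S where "S = (\<lambda>(i, j). \<bar>A $$ (i, j)\<bar>) ` ({..<n} \<times> {..<n})"
  have fin: "finite (insert 0 S)" by (simp add: S_def)
  show "Max (insert 0 S) \<ge> 0" using fin by (intro Max_ge) auto
  show "\<bar>A $$ (i, j)\<bar> \<le> Max (insert 0 S)" if "i < n" "j < n" for i j
    using fin that by (intro Max_ge) (auto simp: S_def)
qed

text \<open>Modulo \<open>P\<close> only the pole of maximal order at \<open>0\<close> survives.\<close>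
lemma hermite_pade_form_lower_bound:
  fixes N P n :: nat and \<alpha> \<beta> :: complex and c :: "nat \<Rightarrow> nat \<Rightarrow> int" and A B :: "int mat"
  assumes act: "acts_by A n v (of_int b * \<alpha>)" "acts_by B n v (of_int b' * \<beta>)" and n: "n > 0" and v0: "v 0 = 1"
    and V: "\<And>i. i < n \<Longrightarrow> norm (v i) \<le> V"
    and a: "a \<ge> 0" "\<And>i j. i < n \<Longrightarrow> j < n \<Longrightarrow> \<bar>A $$ (i, j)\<bar> \<le> a" "\<And>i j. i < n \<Longrightarrow> j < n \<Longrightarrow> \<bar>B $$ (i, j)\<bar> \<le> a"
    and P: "prime P" "\<not> int P dvd det A" "\<not> int P dvd b'" "\<not> int P dvd c 0 P"
    and c0: "\<And>j. j > 0 \<Longrightarrow> c j P = 0"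
    and C: "\<And>j i. \<bar>c j i\<bar> \<le> C" "C \<ge> 1" and b: "b \<noteq> 0" "b' \<noteq> 0"
  defines "H \<equiv> int (N + 1) * int (P + 1) * (C * fact P * \<bar>b\<bar> ^ P * \<bar>b'\<bar> ^ N * (int n * ((int n * a + 1) ^ P * (int n * a + 1) ^ N)))"
  shows "1 \<le> norm (fact P * of_int b ^ P * of_int b' ^ N *
       (\<Sum>j\<le>N. \<Sum>i<Suc P. of_int (c j i) * (\<alpha> ^ i / fact i * \<beta> ^ j))) * (real n * (fact n * of_int H ^ n * V))"
proof -
  define I where "I = {..N} \<times> {..<Suc P}"
  \<comment> \<open>The integer coefficients left after multiplication by
    \<open>fact P * b ^ P * b' ^ N\<close>: the powers of \<open>b\<close> and \<open>b'\<close> not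
    absorbed by the matrices, and the integer \<open>P! / i!\<close>.\<close>
  define \<kappa> where "\<kappa> = (\<lambda>(j, i). c j i * (fact P div fact i) * b ^ (P - i) * b' ^ (N - j))"
  define X where "X = (\<lambda>(j, i). A ^\<^sub>m i * B ^\<^sub>m j)"
  define x where "x = (\<lambda>(j, i). (of_int b * \<alpha>) ^ i * (of_int b' * \<beta>) ^ j)"
  define M where "M = mat n n (\<lambda>(k, l). \<Sum>m\<in>I. \<kappa> m * X m $$ (k, l))"
  define g where "g = int n * a + 1"
  have g: "g \<ge> 1" using a by (simp add: g_def)
  have A: "A \<in> carrier_mat n n" and B: "B \<in> carrier_mat n n" using act by (auto simp: acts_by_def)
  have finI: "finite I" by (simp add: I_def)
  have actM: "acts_by M n v (\<Sum>m\<in>I. of_int (\<kappa> m) * x m)"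
    unfolding M_def
  proof (rule acts_by_lincomb[OF finI])
    fix m assume "m \<in> I"
    obtain j i where [simp]: "m = (j, i)" by (cases m)
    show "acts_by (X m) n v (x m)"
      using acts_by_mult[OF acts_by_pow[OF act(1), of i] acts_by_pow[OF act(2), of j]]
      by (simp add: X_def x_def)
  qed
  have dvd: "fact P = fact i * (fact P div fact i :: int)" if "i \<le> P" for i
    using fact_dvd[OF that, where 'a = int] by simp
  have theta: "(\<Sum>m\<in>I. of_int (\<kappa> m) * x m) = fact P * of_int b ^ P * of_int b' ^ N *
       (\<Sum>j\<le>N. \<Sum>i<Suc P. of_int (c j i) * (\<alpha> ^ i / fact i * \<beta> ^ j))"
  proof -
    have "(\<Sum>m\<in>I. of_int (\<kappa> m) * x m) = (\<Sum>j\<le>N. \<Sum>i<Suc P. of_int (\<kappa> (j, i)) * x (j, i))"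
      by (simp add: I_def sum.cartesian_product del: sum.lessThan_Suc)
    also have "\<dots> = (\<Sum>j\<le>N. \<Sum>i<Suc P. (fact P * of_int b ^ P * of_int b' ^ N) * (of_int (c j i) * (\<alpha> ^ i / fact i * \<beta> ^ j)))"
    proof (intro sum.cong refl)
      fix j i assume "j \<in> {..N}" "i \<in> {..<Suc P}"
      then have ji: "j \<le> N" "i \<le> P" by auto
      have "complex_of_int (fact P) = of_int (fact i * (fact P div fact i))"
        using dvd[OF ji(2)] by simp
      then have f: "complex_of_int (fact P div fact i) = fact P / fact i"
        by (simp add: field_simps)
      have "of_int b ^ P = (of_int b ^ (P - i) * of_int b ^ i :: complex)"
        "of_int b' ^ N = (of_int b' ^ (N - j) * of_int b' ^ j :: complex)"
        using ji by (simp_all flip: power_add)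
      then show "of_int (\<kappa> (j, i)) * x (j, i) =
          (fact P * of_int b ^ P * of_int b' ^ N) * (of_int (c j i) * (\<alpha> ^ i / fact i * \<beta> ^ j))"
        by (simp add: \<kappa>_def x_def f power_mult_distrib mult_ac)
    qed
    finally show ?thesis by (simp only: sum_distrib_left)
  qed
  have Xc: "X m \<in> carrier_mat n n" for m
    unfolding X_def by (cases m) (auto intro!: mult_carrier_mat pow_carrier_mat A B)
  have det: "det M \<noteq> 0"
  proof
    assume det0: "det M = 0"
    \<comment> \<open>The only index surviving modulo \<open>P\<close> is \<open>(0, P)\<close>,
      where the matrix is \<open>A ^ P\<close>. Hence \<open>det M\<close> is congruent to
      \<open>w ^ n * det A ^ P\<close>, which is prime to \<open>P\<close>.\<close>
    define w where "w = c 0 P * b' ^ N"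
    have "[det M = det (w \<cdot>\<^sub>m (A ^\<^sub>m P))] (mod int P)"
    proof (rule det_cong)
      show "M \<in> carrier_mat n n" by (simp add: M_def)
      show "w \<cdot>\<^sub>m A ^\<^sub>m P \<in> carrier_mat n n" using pow_carrier_mat[OF A] by simp
      fix k l assume kl: "k < n" "l < n"
      have "[M $$ (k, l) = (\<Sum>m\<in>I. if m = (0, P) then w * (A ^\<^sub>m P) $$ (k, l) else 0)] (mod int P)"
      proof -
        have "[(\<Sum>m\<in>I. \<kappa> m * X m $$ (k, l)) = (\<Sum>m\<in>I. if m = (0, P) then w * (A ^\<^sub>m P) $$ (k, l) else 0)] (mod int P)"
        proof (rule cong_sum)
          fix m assume m: "m \<in> I"
          obtain j i where ji: "m = (j, i)" by (cases m)
          have le: "j \<le> N" "i \<le> P" using m by (auto simp: ji I_def)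
          show "[\<kappa> m * X m $$ (k, l) = (if m = (0, P) then w * (A ^\<^sub>m P) $$ (k, l) else 0)] (mod int P)"
          proof (cases "i = P")
            case True
            show ?thesis
            proof (cases "j = 0")
              case True
              have "A ^\<^sub>m P * 1\<^sub>m n = A ^\<^sub>m P" using pow_carrier_mat[OF A] by (rule right_mult_one_mat)
              then show ?thesis using True \<open>i = P\<close> B by (simp add: ji \<kappa>_def X_def w_def)
            next
              case False
              then show ?thesis using True c0 by (simp add: ji \<kappa>_def)
            qed
          next
            case False
            then have "i < P" using le by simp
            \<comment> \<open>For \<open>i < P\<close> the prime \<open>P\<close> divides
              \<open>P!\<close> but not \<open>i!\<close>, so it divides the quotient and the term
              drops out.\<close>
            have "int P dvd fact P" using P(1) prime_gt_0_nat[of P] by (metis dvd_fact int_dvd_int_iff of_nat_fact order_refl Suc_leI One_nat_def)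
            then have "int P dvd fact i * (fact P div fact i)" using dvd[OF le(2)] by simp
            moreover have "\<not> int P dvd fact i"
            proof
              assume "int P dvd fact i"
              then have "P dvd fact i" by (metis int_dvd_int_iff of_nat_fact)
              then show False using P(1) \<open>i < P\<close> by (simp add: prime_dvd_fact_iff)
            qed
            ultimately have "int P dvd fact P div fact i"
              using P(1) prime_dvd_multD[of "int P"] by auto
            then have "int P dvd \<kappa> m * X m $$ (k, l)" by (auto simp: ji \<kappa>_def)
            then show ?thesis using False by (simp add: ji cong_0_iff)
          qed
        qed
        then show ?thesis using kl by (simp add: M_def)
      qed
      also have "(\<Sum>m\<in>I. if m = (0, P) then w * (A ^\<^sub>m P) $$ (k, l) else 0) = w * (A ^\<^sub>m P) $$ (k, l)"
        using finI by (simp add: I_def)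
      also have "\<dots> = (w \<cdot>\<^sub>m A ^\<^sub>m P) $$ (k, l)" using kl carrier_matD[OF pow_carrier_mat[OF A, of P]] by (simp del: pow_mat_dim)
      finally show "[M $$ (k, l) = (w \<cdot>\<^sub>m A ^\<^sub>m P) $$ (k, l)] (mod int P)" .
    qed
    then have "int P dvd det (w \<cdot>\<^sub>m (A ^\<^sub>m P))"
      using det0 by (metis cong_0_iff cong_sym)
    then have "int P dvd w ^ n * det A ^ P"
      using carrier_matD(2)[OF pow_carrier_mat[OF A, of P]] by (simp add: det_pow_mat[OF A] del: pow_mat_dim)
    then have "int P dvd w \<or> int P dvd det A"
      using P(1) by (meson prime_dvd_multD prime_dvd_power prime_nat_int_transfer prime_int_iff)
    then have "int P dvd c 0 P \<or> int P dvd b'"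
      using P unfolding w_def by (meson prime_dvd_multD prime_dvd_power prime_nat_int_transfer)
    then show False using P by auto
  qed
  have entry: "\<bar>M $$ (k, l)\<bar> \<le> H" if kl: "k < n" "l < n" for k l
  proof -
    have "\<bar>M $$ (k, l)\<bar> \<le> (\<Sum>m\<in>I. \<bar>\<kappa> m * X m $$ (k, l)\<bar>)"
      using kl by (simp add: M_def sum_abs)
    also have "\<dots> \<le> (\<Sum>m\<in>I. C * fact P * \<bar>b\<bar> ^ P * \<bar>b'\<bar> ^ N * (int n * (g ^ P * g ^ N)))"
    proof (rule sum_mono)
      fix m assume m: "m \<in> I"
      obtain j i where ji: "m = (j, i)" by (cases m)
      have le: "j \<le> N" "i \<le> P" using m by (auto simp: ji I_def)
      have "\<bar>X m $$ (k, l)\<bar> \<le> int n * (g ^ i * g ^ j)"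
        unfolding X_def ji g_def prod.case
        by (intro mat_mult_entry_bound pow_carrier_mat pow_mat_entry_bound A B a kl) auto
      also have "\<dots> \<le> int n * (g ^ P * g ^ N)"
        using g le by (intro mult_left_mono mult_mono power_increasing) auto
      finally have X: "\<bar>X m $$ (k, l)\<bar> \<le> int n * (g ^ P * g ^ N)" .
      have "(fact P div fact i :: int) \<le> fact P" using zdiv_mono2[of "fact P" 1 "fact i :: int"] by simp
      then have "\<bar>\<kappa> m\<bar> \<le> C * fact P * \<bar>b\<bar> ^ P * \<bar>b'\<bar> ^ N"
        unfolding \<kappa>_def ji prod.case abs_mult power_abs using C b le
        by (intro mult_mono power_increasing) (auto simp: pos_imp_zdiv_nonneg_iff)
      then show "\<bar>\<kappa> m * X m $$ (k, l)\<bar> \<le> C * fact P * \<bar>b\<bar> ^ P * \<bar>b'\<bar> ^ N * (int n * (g ^ P * g ^ N))"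
        unfolding abs_mult using X C by (intro mult_mono) auto
    qed
    also have "\<dots> = H" unfolding H_def I_def g_def by (simp add: algebra_simps)
    finally show ?thesis .
  qed
  have H1: "H \<ge> 1"
  proof -
    have "H > 0" unfolding H_def g_def[symmetric]
      using C b n g by (intro mult_pos_pos zero_less_power) auto
    then show ?thesis by simp
  qed
  show ?thesis
    using acts_by_lower_bound[OF actM n v0 det entry H1 V] unfolding theta by simp
qed

theorem hermite_lindemann:
  fixes \<alpha> :: complex
  assumes "algebraic \<alpha>" "\<alpha> \<noteq> 0"
  shows "\<not> algebraic (exp \<alpha>)"
proof
  assume "algebraic (exp \<alpha>)"
  then obtain n A B v and b b' :: int where act: "n > 0" "b \<noteq> 0" "b' \<noteq> 0" "v 0 = 1" "det A \<noteq> 0"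
    "acts_by A n v (of_int b * \<alpha>)" "acts_by B n v (of_int b' * exp \<alpha>)"
    using algebraic_common_eigenvector[OF assms(1) _ assms(2)] by (metis exp_not_eq_zero)
  obtain aA aB where aA: "aA \<ge> 0" "\<And>i j. i < n \<Longrightarrow> j < n \<Longrightarrow> \<bar>A $$ (i, j)\<bar> \<le> aA"
    and aB: "aB \<ge> 0" "\<And>i j. i < n \<Longrightarrow> j < n \<Longrightarrow> \<bar>B $$ (i, j)\<bar> \<le> aB"
    using entries_bounded[of n A] entries_bounded[of n B] by metis
  define a where "a = max aA aB"
  have a: "a \<ge> 0" "\<And>i j. i < n \<Longrightarrow> j < n \<Longrightarrow> \<bar>A $$ (i, j)\<bar> \<le> a" "\<And>i j. i < n \<Longrightarrow> j < n \<Longrightarrow> \<bar>B $$ (i, j)\<bar> \<le> a"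
    using aA aB unfolding a_def by (auto intro: order_trans[of _ aA] order_trans[of _ aB])
  define V where "V = (\<Sum>i<n. norm (v i))"
  have V: "norm (v i) \<le> V" if "i < n" for i
    unfolding V_def using that by (intro member_le_sum) auto
  have V0: "V \<ge> 0" unfolding V_def by (intro sum_nonneg) auto
  \<comment> \<open>The lower bound costs \<open>fact P ^ (n + 1)\<close>, one factor from the form
    and \<open>n\<close> from the cofactors, while the \<open>N + 1\<close> poles gain
    \<open>P ^ (P * (N + 1))\<close>. With \<open>N = n + 1\<close> a factor \<open>P ^ P\<close> is
    left over, which beats every geometric growth.\<close>
  define N where "N = n + 1"
  define W where "W = (fact N :: int)"
  have W: "W \<ge> 1" by (simp add: W_def)
  define g where "g = real_of_int (int n * a + 1)"
  have g: "g \<ge> 1" using a by (simp add: g_def)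
  \<comment> \<open>The matrix entries will be at most \<open>C0 * C1 ^ P * fact P\<close>;
    \<open>C2\<close> and \<open>C3\<close> play the same part for the linear form.
    \<open>E0\<close> and \<open>E1\<close> collect them in the final bound
    \<open>E0 * (E1 / P) ^ P\<close>.\<close>
  define C0 where "C0 = real (N + 1) * (2 * real_of_int W) * \<bar>real_of_int b'\<bar> ^ N * real n * g ^ N"
  define C1 where "C1 = 2 * (2 * real_of_int W) ^ (N + 1) * \<bar>real_of_int b\<bar> * g"
  define C2 where "C2 = \<bar>real_of_int b'\<bar> ^ N * real_of_int W * 2"
  define C3 where "C3 = \<bar>real_of_int b\<bar> * 2 * real_of_int W ^ (N + 1) * exp (norm \<alpha>) * 2 ^ (N + 1)"
  define E0 where "E0 = C2 * (real n * (fact n * C0 ^ n * V))"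
  define E1 where "E1 = C3 * C1 ^ n"
  have pos: "C0 \<ge> 0" "C1 \<ge> 0" "C2 \<ge> 0" "C3 \<ge> 0" using W g by (auto simp: C0_def C1_def C2_def C3_def)
  have E: "E0 \<ge> 0" "E1 \<ge> 0" using pos V0 by (auto simp: E0_def E1_def)
  have "(\<lambda>P. E0 * (1 / 2 :: real) ^ P) \<longlonglongrightarrow> E0 * 0" by (intro tendsto_intros) simp_all
  then have "eventually (\<lambda>P. E0 * (1 / 2 :: real) ^ P < 1) sequentially"
    by (auto dest: order_tendstoD(2)[of _ 0 _ 1])
  then obtain P0 where P0: "\<And>P. P \<ge> P0 \<Longrightarrow> E0 * (1 / 2) ^ P < 1" by (auto simp: eventually_sequentially)
  \<comment> \<open>\<open>P0\<close> serves the final limit, \<open>2 * N\<close> the contour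
    radius and the primality of \<open>P\<close> to \<open>N!\<close>, \<open>2 * E1\<close> the
    ratio 1/2 in the last estimate; the last two terms keep \<open>P\<close> from dividing
    \<open>b'\<close> and \<open>det A\<close>.\<close>
  obtain P where P: "prime P" "P > P0 + 2 * N + nat \<lceil>2 * E1\<rceil> + nat \<bar>b'\<bar> + nat \<bar>det A\<bar>"
    using bigger_prime by blast
  have small: "\<not> int P dvd z" if "z \<noteq> 0" "\<bar>z\<bar> < int P" for z
    using that dvd_imp_le_int[of z "int P"] by auto
  have P1: "P \<ge> 1" using P by simp
  \<comment> \<open>One order more at 0 than elsewhere: exactly one coefficient then has index
    \<open>P\<close>, as the argument modulo \<open>P\<close> requires.\<close>
  define nn where "nn j = (if j = 0 then Suc P else P)" for j :: nat
  define T where "T = (\<Sum>j\<le>N. nn j)"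
  have T: "T = Suc P + N * P"
  proof -
    have "{..N} = insert 0 {1..N}" by auto
    then show ?thesis by (simp add: T_def nn_def)
  qed
  have "T \<ge> 1" "\<And>j. j \<le> N \<Longrightarrow> nn j \<le> Suc P" using T by (auto simp: nn_def)
  from partial_fraction_integral[OF T_def this] obtain c where c: "\<And>j i. nn j \<le> i \<Longrightarrow> c j i = 0" "\<And>j i. \<bar>c j i\<bar> \<le> (2 * W) ^ T"
    "\<And>x :: complex. (\<forall>j\<le>N. x \<noteq> of_nat j) \<Longrightarrow>
      of_int W ^ T / (\<Prod>j\<le>N. (x - of_nat j) ^ nn j) = (\<Sum>j\<le>N. \<Sum>i<Suc P. of_int (c j i) / (x - of_nat j) ^ Suc i)"
    unfolding W_def[symmetric] by blast
  have "c 0 P * (\<Prod>j=1..N. (- int j) ^ nn j) = W ^ T"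
    by (rule partial_fraction_leading_coeff[OF c(3)]) (auto simp: nn_def)
  then have c0P: "\<not> int P dvd c 0 P"
  proof -
    assume eq: "c 0 P * (\<Prod>j=1..N. (- int j) ^ nn j) = W ^ T"
    show ?thesis
    proof
      assume "int P dvd c 0 P"
      then have "int P dvd W ^ T" using eq by (metis dvd_mult2)
      then have "int P dvd W" using P(1) by (meson prime_dvd_power prime_nat_int_transfer)
      then have "P dvd fact N" unfolding W_def by (metis int_dvd_int_iff of_nat_fact)
      then show False using P by (simp add: prime_dvd_fact_iff)
    qed
  qed
  define S where "S = (\<Sum>j\<le>N. \<Sum>i<Suc P. of_int (c j i) * (\<alpha> ^ i / fact i * exp \<alpha> ^ j))"
  define H where "H = int (N + 1) * int (P + 1) * ((2 * W) ^ T * fact P * \<bar>b\<bar> ^ P * \<bar>b'\<bar> ^ N *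
      (int n * ((int n * a + 1) ^ P * (int n * a + 1) ^ N)))"
  have lower: "1 \<le> norm (fact P * of_int b ^ P * of_int b' ^ N * S) * (real n * (fact n * of_int H ^ n * V))"
    unfolding S_def H_def
  proof (rule hermite_pade_form_lower_bound[OF act(6,7,1,4) V a P(1)])
    show "\<not> int P dvd det A" "\<not> int P dvd b'" using P(2) act(3,5) by (simp_all add: small)
    show "c j P = 0" if "j > 0" for j using c(1) that by (simp add: nn_def)
    show "(2 * W) ^ T \<ge> 1" using W by (intro one_le_power) auto
  qed (use c act c0P in auto)
  \<comment> \<open>The radius is \<open>P\<close> itself: the exponential factor grows only
    geometrically in \<open>P\<close>, and the denominator gains a full power of \<open>P\<close>
    for every pole order.\<close>
  have S_le: "norm S \<le> real P * (of_int W ^ T * exp (norm \<alpha> * real P) * (2 / real P) ^ T)"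
  proof -
    have "norm (\<Sum>j\<le>N. \<Sum>i<Suc P. of_int (c j i) * (\<alpha> ^ i / fact i * exp (\<alpha> * of_nat j))) \<le>
        real P * (of_int W ^ T * exp (norm \<alpha> * real P) * (2 / real P) ^ T)"
      by (rule hermite_pade_bound[OF c(3) T_def]) (use P W in auto)
    then show ?thesis by (simp add: S_def exp_of_nat2_mult mult.commute del: sum.lessThan_Suc)
  qed
  have H_le: "real_of_int H \<le> C0 * C1 ^ P * fact P"
  proof -
    have "real_of_int H = real (N + 1) * real (P + 1) * ((2 * real_of_int W) ^ T * fact P * \<bar>real_of_int b\<bar> ^ P * \<bar>real_of_int b'\<bar> ^ N *
      (real n * (g ^ P * g ^ N)))"
      by (simp add: H_def g_def)
    also have "\<dots> \<le> real (N + 1) * 2 ^ P * ((2 * real_of_int W) ^ T * fact P * \<bar>real_of_int b\<bar> ^ P * \<bar>real_of_int b'\<bar> ^ N *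
      (real n * (g ^ P * g ^ N)))"
    proof -
      have "P + 1 \<le> 2 ^ P" using less_exp[of P] by linarith
      then have "real (P + 1) \<le> 2 ^ P" by (metis of_nat_le_iff of_nat_power of_nat_numeral)
      then show ?thesis using W g by (intro mult_right_mono mult_left_mono) auto
    qed
    also have "(2 * real_of_int W) ^ T = (2 * real_of_int W) * ((2 * real_of_int W) ^ (N + 1)) ^ P"
      unfolding T power_mult[symmetric] by (subst power_Suc[symmetric]) (simp add: algebra_simps)
    also have "real (N + 1) * 2 ^ P * ((2 * real_of_int W) * ((2 * real_of_int W) ^ (N + 1)) ^ P * fact P * \<bar>real_of_int b\<bar> ^ P * \<bar>real_of_int b'\<bar> ^ N *
      (real n * (g ^ P * g ^ N))) = C0 * C1 ^ P * fact P"
      unfolding C0_def C1_def power_mult_distrib by (simp only: mult_ac)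
    finally show ?thesis .
  qed
  have theta_le: "norm (fact P * of_int b ^ P * of_int b' ^ N * S) \<le> C2 * C3 ^ P * fact P / (real P ^ P) ^ (N + 1)"
  proof -
    have "norm (fact P * of_int b ^ P * of_int b' ^ N * S) = fact P * \<bar>real_of_int b\<bar> ^ P * \<bar>real_of_int b'\<bar> ^ N * norm S"
      by (simp add: norm_mult norm_power)
    also have "\<dots> \<le> fact P * \<bar>real_of_int b\<bar> ^ P * \<bar>real_of_int b'\<bar> ^ N *
        (2 ^ P * (of_int W ^ T * exp (norm \<alpha>) ^ P * (2 / real P) ^ T))"
    proof -
      have "P \<le> 2 ^ P" using less_exp[of P] by linarith
      then have "real P \<le> 2 ^ P" by (metis of_nat_le_iff of_nat_power of_nat_numeral)
      then have "real P * (of_int W ^ T * exp (norm \<alpha> * real P) * (2 / real P) ^ T) \<le>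
          2 ^ P * (of_int W ^ T * exp (norm \<alpha> * real P) * (2 / real P) ^ T)"
        using W by (intro mult_right_mono) auto
      also have "exp (norm \<alpha> * real P) = exp (norm \<alpha>) ^ P" by (simp add: exp_of_nat2_mult)
      finally show ?thesis using S_le by (intro mult_left_mono) (auto simp: exp_of_nat2_mult)
    qed
    also have "(2 / real P) ^ T = (2 / real P) * ((2 / real P) ^ (N + 1)) ^ P"
      unfolding T power_mult[symmetric] by (subst power_Suc[symmetric]) (simp add: algebra_simps)
    also have "(of_int W ^ T :: real) = of_int W * (of_int W ^ (N + 1)) ^ P"
      unfolding T power_mult[symmetric] by (subst power_Suc[symmetric]) (simp add: algebra_simps)
    also have "fact P * \<bar>real_of_int b\<bar> ^ P * \<bar>real_of_int b'\<bar> ^ N *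
        (2 ^ P * ((of_int W * (of_int W ^ (N + 1)) ^ P) * exp (norm \<alpha>) ^ P * ((2 / real P) * ((2 / real P) ^ (N + 1)) ^ P)))
      \<le> fact P * \<bar>real_of_int b\<bar> ^ P * \<bar>real_of_int b'\<bar> ^ N *
        (2 ^ P * ((of_int W * (of_int W ^ (N + 1)) ^ P) * exp (norm \<alpha>) ^ P * (2 * ((2 / real P) ^ (N + 1)) ^ P)))"
      using P1 W by (intro mult_left_mono mult_right_mono) (auto simp: field_simps)
    also have "((2 / real P) ^ (N + 1)) ^ P = (2 ^ (N + 1)) ^ P / (real P ^ P) ^ (N + 1)"
      unfolding power_divide power_mult[symmetric] by (simp only: mult.commute)
    also have "fact P * \<bar>real_of_int b\<bar> ^ P * \<bar>real_of_int b'\<bar> ^ N *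
        (2 ^ P * ((of_int W * (of_int W ^ (N + 1)) ^ P) * exp (norm \<alpha>) ^ P * (2 * ((2 ^ (N + 1)) ^ P / (real P ^ P) ^ (N + 1)))))
       = C2 * C3 ^ P * fact P / (real P ^ P) ^ (N + 1)"
      unfolding C2_def C3_def power_mult_distrib times_divide_eq_right by (simp only: mult_ac)
    finally show ?thesis .
  qed
  have H0: "real_of_int H \<ge> 0" using W a by (simp add: H_def)
  have Ppos: "real P ^ P > 0" using P1 by simp
  have "1 \<le> C2 * C3 ^ P * fact P / (real P ^ P) ^ (N + 1) * (real n * (fact n * (C0 * C1 ^ P * fact P) ^ n * V))"
  proof (rule order_trans[OF lower], rule mult_mono[OF theta_le])
    show "real n * (fact n * real_of_int H ^ n * V) \<le> real n * (fact n * (C0 * C1 ^ P * fact P) ^ n * V)"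
      using H_le H0 V0 by (intro mult_left_mono mult_right_mono power_mono) auto
  qed (use pos H0 V0 in auto)
  also have "\<dots> = E0 * E1 ^ P * (fact P ^ (n + 1) / (real P ^ P) ^ (N + 1))"
    unfolding E0_def E1_def by (simp add: power_mult_distrib power_mult[symmetric] mult_ac)
  also have "\<dots> \<le> E0 * E1 ^ P * ((real P ^ P) ^ (n + 1) / (real P ^ P) ^ (N + 1))"
  proof -
    have "(fact P :: real) \<le> real P ^ P" by (metis fact_le_power of_nat_fact of_nat_le_iff of_nat_power order_refl)
    then show ?thesis using E Ppos by (intro mult_left_mono divide_right_mono power_mono) auto
  qed
  also have "\<dots> = E0 * (E1 / real P) ^ P"
    using Ppos by (simp add: N_def power_divide)
  also have "\<dots> \<le> E0 * (1 / 2) ^ P"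
  proof -
    have "real P \<ge> 2 * E1" using P(2) by linarith
    then have "E1 / real P \<le> 1 / 2" using P1 by (simp add: field_simps)
    then show ?thesis using E by (intro mult_left_mono power_mono) auto
  qed
  also have "\<dots> < 1" using P(2) by (intro P0) simp
  finally show False by simp
qed

corollary pi_transcendental: "\<not> algebraic (complex_of_real pi)"
proof
  assume "algebraic (complex_of_real pi)"
  then have "algebraic (\<i> * complex_of_real pi)" by (intro algebraic_mult) auto
  then have "\<not> algebraic (exp (\<i> * complex_of_real pi))" by (rule hermite_lindemann) auto
  moreover have "exp (\<i> * complex_of_real pi) = -1" by (metis exp_pi_i mult.commute)
  ultimately show False by (metis algebraic_minus_iff algebraic_1)
qed

section \<open>Partial fractions of the cotangent\<close>

definition pi_cot :: "complex \<Rightarrow> complex" where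
  "pi_cot u = of_real pi * cot (of_real pi * u)"

text \<open>Differentiate the reflection formula, with the sine moved to the side of the Gamma
  factors so that the other side is constant.\<close>

lemma pi_cot_Digamma:
  assumes "u \<notin> \<int>"
  shows "pi_cot u = Digamma (1 - u) - Digamma u"
proof -
  have u1: "1 - u \<notin> \<int>" using assms Ints_diff[of 1 "1 - u"] by auto
  have np: "u \<notin> \<int>\<^sub>\<le>\<^sub>0" "1 - u \<notin> \<int>\<^sub>\<le>\<^sub>0" using assms u1 nonpos_Ints_subset_Ints by auto
  have s0: "sin (of_real pi * u) \<noteq> 0" using assms by (subst sin_eq_0) auto
  define G where "G w = Gamma w * Gamma (1 - w) * sin (of_real pi * w)" for w :: complex
  have "eventually (\<lambda>w. w \<in> UNIV - \<int>) (nhds u)"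
    using assms by (intro eventually_nhds_in_open) (auto simp: open_Diff)
  then have "eventually (\<lambda>w. G w = of_real pi) (nhds u)"
  proof eventually_elim
    case (elim w)
    then have "sin (of_real pi * w) \<noteq> 0" by (subst sin_eq_0) auto
    then show ?case by (simp add: G_def Gamma_reflection_complex)
  qed
  moreover have "((\<lambda>_. complex_of_real pi) has_field_derivative 0) (at u)" by simp
  ultimately have "(G has_field_derivative 0) (at u)" by (subst DERIV_cong_ev[OF refl _ refl])
  moreover have "(G has_field_derivative Gamma u * Gamma (1 - u) *
      ((Digamma u - Digamma (1 - u)) * sin (of_real pi * u) + of_real pi * cos (of_real pi * u))) (at u)"
    unfolding G_def[abs_def] using np by (auto intro!: derivative_eq_intros simp: algebra_simps)
  ultimately have "Gamma u * Gamma (1 - u) *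
      ((Digamma u - Digamma (1 - u)) * sin (of_real pi * u) + of_real pi * cos (of_real pi * u)) = 0"
    using DERIV_unique by blast
  then have "(Digamma u - Digamma (1 - u)) * sin (of_real pi * u) + of_real pi * cos (of_real pi * u) = 0"
    using np by (auto simp: Gamma_eq_zero_iff)
  then have "(Digamma (1 - u) - Digamma u) * sin (of_real pi * u) = of_real pi * cos (of_real pi * u)"
    by (simp add: algebra_simps)
  then show ?thesis using s0 by (simp add: pi_cot_def cot_def field_simps)
qed

text \<open>The difference of two digamma series. Passing from \<open>Digamma u\<close> to
  \<open>Digamma (u + 1)\<close> splits off the pole \<open>1 / u\<close> and pairs the terms
  \<open>n\<close> and \<open>- n\<close>.\<close>

lemma pi_cot_sums:
  assumes "u \<notin> \<int>"
  shows "(\<lambda>n. 2 * u / (u\<^sup>2 - of_nat (Suc n) ^ 2)) sums (pi_cot u - 1 / u)"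
proof -
  have u0: "u \<noteq> 0" using assms by auto
  have ne: "1 - u \<noteq> 0" "u + 1 \<noteq> 0" using assms by (auto simp: add_eq_0_iff2)
  have s: "(\<lambda>k. inverse (of_nat (Suc k)) - inverse (z + of_nat k)) sums (Digamma z + euler_mascheroni)"
    if "z \<noteq> 0" for z :: complex
    using summable_Digamma[OF that] by (simp add: Digamma_def summable_sums)
  have "(\<lambda>k. (inverse (of_nat (Suc k)) - inverse (1 - u + of_nat k)) -
            (inverse (of_nat (Suc k)) - inverse (u + 1 + of_nat k))) sums
        ((Digamma (1 - u) + euler_mascheroni) - (Digamma (u + 1) + euler_mascheroni))"
    by (intro sums_diff s ne)
  also have "(Digamma (1 - u) + euler_mascheroni) - (Digamma (u + 1) + euler_mascheroni) = pi_cot u - 1 / u"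
    using u0 by (simp add: Digamma_plus1 pi_cot_Digamma[OF assms])
  also have "(\<lambda>k. (inverse (of_nat (Suc k)) - inverse (1 - u + of_nat k)) -
            (inverse (of_nat (Suc k)) - inverse (u + 1 + of_nat k))) = (\<lambda>n. 2 * u / (u\<^sup>2 - of_nat (Suc n) ^ 2))"
  proof
    fix k
    define a b where "a = u - of_nat (Suc k)" and "b = u + of_nat (Suc k)"
    have "u \<noteq> of_nat (Suc k)" "u \<noteq> - of_nat (Suc k)" using assms by auto
    then have ab: "a \<noteq> 0" "b \<noteq> 0" by (auto simp: a_def b_def add_eq_0_iff2)
    have "1 - u + of_nat k = - a" "u + 1 + of_nat k = b" "2 * u = a + b"
      "u\<^sup>2 - of_nat (Suc k) ^ 2 = a * b"
      by (simp_all add: a_def b_def power2_eq_square algebra_simps)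
    then show "(inverse (of_nat (Suc k)) - inverse (1 - u + of_nat k)) -
            (inverse (of_nat (Suc k)) - inverse (u + 1 + of_nat k)) = 2 * u / (u\<^sup>2 - of_nat (Suc k) ^ 2)"
      using ab by (simp only:) (simp add: field_simps)
  qed
  finally show ?thesis .
qed

text \<open>The imaginary part of \<open>x t + y\<close> controls \<open>x\<close>, and then the
  triangle inequality controls \<open>y\<close>. The kernel factors into the values at
  \<open>y\<close> and \<open>- y\<close>, whose bounds multiply. The dominated convergence of the
  cotangent and kernel sums rests on this.\<close>

lemma kernel_lower_bound:
  fixes t :: complex
  assumes "Im t > 0"
  obtains K :: real where "K > 0"
    "\<And>x y :: real. x\<^sup>2 + y\<^sup>2 \<le> K * norm ((of_real x * t)\<^sup>2 - of_real y ^ 2)"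
    "\<And>x y :: real. x\<^sup>2 + y\<^sup>2 \<le> K * norm (of_real x * t + of_real y) ^ 2"
proof -
  define m where "m = Im t"
  define K where "K = (1 / m)\<^sup>2 + (1 + norm t / m)\<^sup>2"
  have m: "m > 0" using assms by (simp add: m_def)
  then have K: "K > 0" unfolding K_def by (intro add_pos_nonneg) auto
  have lin: "x\<^sup>2 + y\<^sup>2 \<le> K * norm (of_real x * t + of_real y) ^ 2" for x y :: real
  proof -
    define A where "A = norm (of_real x * t + of_real y)"
    have "\<bar>Im (of_real x * t + of_real y)\<bar> \<le> A" unfolding A_def by (rule abs_Im_le_cmod)
    then have x: "\<bar>x\<bar> * m \<le> A" using m by (simp add: m_def abs_mult)
    then have x': "\<bar>x\<bar> \<le> A * (1 / m)" using m by (simp add: field_simps)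
    have "norm (complex_of_real y) \<le> A + norm (of_real x * t)"
      unfolding A_def by (metis add_diff_cancel_left' norm_triangle_ineq4)
    then have "\<bar>y\<bar> \<le> A + \<bar>x\<bar> * norm t" by (simp add: norm_mult)
    also have "\<dots> \<le> A + A * (1 / m) * norm t" using x' by (intro add_left_mono mult_right_mono) auto
    also have "\<dots> = A * (1 + norm t / m)" by (simp add: algebra_simps)
    finally have y': "\<bar>y\<bar> \<le> A * (1 + norm t / m)" .
    have "x\<^sup>2 + y\<^sup>2 \<le> (A * (1 / m))\<^sup>2 + (A * (1 + norm t / m))\<^sup>2"
      using power_mono[OF x', of 2] power_mono[OF y', of 2] by simp
    also have "\<dots> = K * A\<^sup>2" unfolding K_def power_mult_distrib by (rule distrib_left[symmetric, THEN trans, OF mult.commute])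
    finally show ?thesis by (simp add: A_def)
  qed
  have "x\<^sup>2 + y\<^sup>2 \<le> K * norm ((of_real x * t)\<^sup>2 - of_real y ^ 2)" for x y :: real
  proof -
    define a where "a = norm (of_real x * t + of_real y)"
    define b where "b = norm (of_real x * t - of_real y)"
    have "(x\<^sup>2 + y\<^sup>2) * (x\<^sup>2 + y\<^sup>2) \<le> (K * a\<^sup>2) * (K * b\<^sup>2)"
      using lin[of x y] lin[of x "-y"] K unfolding a_def b_def by (intro mult_mono) auto
    then have "(x\<^sup>2 + y\<^sup>2)\<^sup>2 \<le> (K * (a * b))\<^sup>2" by (simp add: power2_eq_square mult_ac)
    moreover have "0 \<le> K * (a * b)" using K by (simp add: a_def b_def)
    ultimately have "x\<^sup>2 + y\<^sup>2 \<le> K * (a * b)" by (rule power2_le_imp_le)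
    also have "a * b = norm ((of_real x * t)\<^sup>2 - of_real y ^ 2)"
      unfolding a_def b_def norm_mult[symmetric] by (simp add: power2_eq_square algebra_simps)
    finally show ?thesis .
  qed
  then show ?thesis using that K lin by blast
qed

lemma upper_half_plane_not_Int: "Im u > 0 \<Longrightarrow> u \<notin> \<int>"
  by (auto elim!: Ints_cases)

lemma inverse_squares_summable: "(\<lambda>n. 1 / real n ^ 2) summable_on A"
proof -
  have "summable (\<lambda>n. 1 / real n ^ 2)"
    using inverse_power_summable[of 2, where 'a = real] by (simp add: inverse_eq_divide)
  then have "(\<lambda>n. 1 / real n ^ 2) summable_on UNIV"
    by (subst summable_on_UNIV_nonneg_real_iff) auto
  then show ?thesis by (rule summable_on_subset_banach) auto
qed

lemma pi_cot_abs_summable: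
  assumes "Im u > 0"
  shows "(\<lambda>n. norm (2 * u / (u\<^sup>2 - of_nat n ^ 2))) summable_on A"
proof -
  obtain K where K: "K > 0" "\<And>x y :: real. x\<^sup>2 + y\<^sup>2 \<le> K * norm ((of_real x * u)\<^sup>2 - of_real y ^ 2)"
    using kernel_lower_bound[OF assms] by metis
  \<comment> \<open>At \<open>n = 0\<close> the majorant is 0 by the convention for division, so
    this index is left out and put back afterwards.\<close>
  have "(\<lambda>n. (2 * norm u * K) * (1 / real n ^ 2)) summable_on (A - {0})"
    by (intro summable_on_cmult_right inverse_squares_summable)
  then have "(\<lambda>n. norm (2 * u / (u\<^sup>2 - of_nat n ^ 2))) summable_on (A - {0})"
  proof (rule Infinite_Sum.abs_summable_on_comparison_test')
    fix n assume n: "n \<in> A - {0}"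
    have "real n ^ 2 \<le> 1\<^sup>2 + real n ^ 2" by simp
    also have "\<dots> \<le> K * norm (u\<^sup>2 - of_nat n ^ 2)" using K(2)[of 1 "real n"] by simp
    finally have le: "real n ^ 2 \<le> K * norm (u\<^sup>2 - of_nat n ^ 2)" .
    moreover have "real n ^ 2 > 0" using n by simp
    ultimately have "norm (u\<^sup>2 - of_nat n ^ 2) > 0" using K(1) by (metis less_le_trans zero_less_mult_pos)
    then show "norm (2 * u / (u\<^sup>2 - of_nat n ^ 2)) \<le> (2 * norm u * K) * (1 / real n ^ 2)"
      using le n mult_left_mono[OF le, of "2 * norm u"] by (simp add: norm_divide norm_mult field_simps)
  qed
  then have "(\<lambda>n. norm (2 * u / (u\<^sup>2 - of_nat n ^ 2))) summable_on (insert 0 (A - {0}))"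
    by (subst summable_on_insert_iff) auto
  then show ?thesis by (rule summable_on_subset_banach) auto
qed

section \<open>The Lambert series\<close>

lemma pi_cot_has_sum:
  assumes "Im u > 0"
  shows "((\<lambda>n. 2 * u / (u\<^sup>2 - of_nat n ^ 2)) has_sum (pi_cot u - 1 / u)) {1..}"
proof -
  let ?f = "\<lambda>n::nat. 2 * u / (u\<^sup>2 - of_nat n ^ 2)"
  have "(\<lambda>n. norm (?f n)) summable_on {1..}" by (rule pi_cot_abs_summable[OF assms])
  also have "?this \<longleftrightarrow> (\<lambda>n. norm (?f (Suc n))) summable_on UNIV"
    by (rule summable_on_reindex_bij_witness[of _ Suc "\<lambda>n. n - 1"]) auto
  finally have "summable (\<lambda>n. norm (?f (Suc n)))" by (rule summable_on_imp_summable)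
  moreover have "(\<lambda>n. ?f (Suc n)) sums (pi_cot u - 1 / u)"
    using pi_cot_sums[OF upper_half_plane_not_Int[OF assms]] by simp
  ultimately have "((\<lambda>n. ?f (Suc n)) has_sum (pi_cot u - 1 / u)) UNIV"
    by (rule norm_summable_imp_has_sum)
  also have "?this \<longleftrightarrow> ?thesis"
    by (rule has_sum_reindex_bij_witness[of _ "\<lambda>n. n - 1" Suc]) auto
  finally show ?thesis .
qed

definition q_exp :: "complex \<Rightarrow> complex" where
  "q_exp u = exp (2 * of_real pi * \<i> * u)"

definition geom_q :: "complex \<Rightarrow> complex" where
  "geom_q u = q_exp u / (1 - q_exp u)"

lemma norm_q_exp: "norm (q_exp u) = exp (- (2 * pi * Im u))"
  by (simp add: q_exp_def norm_exp_eq_Re)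

lemma norm_q_exp_less: "Im u > 0 \<Longrightarrow> norm (q_exp u) < 1"
  by (simp add: norm_q_exp)

lemma q_exp_of_nat_mult: "q_exp (of_nat n * u) = q_exp u ^ n"
  by (simp add: q_exp_def exp_of_nat_mult[symmetric] mult_ac)

text \<open>Assumed is only that the denominator does not vanish: besides the half-plane, the
  punctured disc around 0 is needed for the generating function of the Bernoulli numbers.\<close>

lemma geom_q_pi_cot_general:
  assumes "q_exp u \<noteq> 1"
  shows "geom_q u = - 1 / 2 + \<i> / (2 * of_real pi) * pi_cot u"
proof -
  define w where "w = exp (\<i> * (of_real pi * u))"
  have w0: "w \<noteq> 0" by (simp add: w_def)
  have q: "q_exp u = w\<^sup>2" by (simp add: q_exp_def w_def exp_double[symmetric] mult_ac)
  have q1: "w\<^sup>2 \<noteq> 1" using assms q by simp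
  have inv: "exp (- (\<i> * (of_real pi * u))) = inverse w" by (simp add: w_def exp_minus)
  have sc: "sin (of_real pi * u) = (w - inverse w) / (2 * \<i>)" "cos (of_real pi * u) = (w + inverse w) / 2"
    using inv by (simp_all add: sin_exp_eq cos_exp_eq w_def)
  have "cot (of_real pi * u) = \<i> * ((w + inverse w) / (w - inverse w))"
  proof -
    have "(w + x) / 2 / ((w - x) / (2 * \<i>)) = \<i> * ((w + x) / (w - x))" for x
      by (cases "w - x = 0") (simp_all add: field_simps)
    then show ?thesis unfolding cot_def sc .
  qed
  also have "w + inverse w = (w\<^sup>2 + 1) / w" using w0 by (simp add: field_simps power2_eq_square)
  also have "w - inverse w = (w\<^sup>2 - 1) / w" using w0 by (simp add: field_simps power2_eq_square)
  finally have cot: "cot (of_real pi * u) = \<i> * (w\<^sup>2 + 1) / (w\<^sup>2 - 1)" using w0 by simp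
  have "1 - w\<^sup>2 \<noteq> 0" "w\<^sup>2 - 1 \<noteq> 0" using q1 by auto
  then show ?thesis
    by (simp add: geom_q_def q pi_cot_def cot divide_simps) (simp add: algebra_simps)
qed

lemma geom_q_pi_cot:
  assumes "Im u > 0"
  shows "geom_q u = - 1 / 2 + \<i> / (2 * of_real pi) * pi_cot u"
  by (rule geom_q_pi_cot_general) (use norm_q_exp_less[OF assms] in auto)

text \<open>The inner Lambert sum for the coefficients \<open>a_coeff\<close>, which equal 1 minus
  \<open>p\<close> times the indicator of the multiples of \<open>p\<close>. In terms of cotangents
  its poles at \<open>u = 0\<close> cancel.\<close>

definition twisted_geom :: "nat \<Rightarrow> complex \<Rightarrow> complex" where
  "twisted_geom p u = geom_q u - of_nat p * geom_q (of_nat p * u)"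

lemma geom_q_has_sum:
  assumes "Im u > 0"
  shows "((\<lambda>e. q_exp (of_nat e * u)) has_sum geom_q u) {1..}"
  using has_sum_geometric_from_1[OF norm_q_exp_less[OF assms]]
  by (simp add: q_exp_of_nat_mult geom_q_def)

lemma multiples_has_sum:
  fixes f :: "nat \<Rightarrow> complex"
  assumes "p > 0" "((\<lambda>n. f (p * n)) has_sum S) {1..}"
  shows "(f has_sum S) {n \<in> {1..}. p dvd n}"
proof -
  have "((\<lambda>n. f (p * n)) has_sum S) {1..} \<longleftrightarrow> (f has_sum S) {n \<in> {1..}. p dvd n}"
    by (rule has_sum_reindex_bij_witness[of _ "\<lambda>n. n div p" "\<lambda>n. p * n"]) (use assms(1) in \<open>auto elim!: dvdE\<close>)
  then show ?thesis using assms(2) by simp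
qed

lemma coprime_prime_iff: "prime p \<Longrightarrow> coprime n p \<longleftrightarrow> \<not> p dvd n" for p n :: nat
  by (metis coprime_commute prime_imp_coprime coprime_absorb_left not_prime_unit)

lemma twisted_geom_has_sum:
  assumes "prime p" "Im u > 0"
  shows "((\<lambda>e. a_coeff p e * q_exp (of_nat e * u)) has_sum twisted_geom p u) {1..}"
proof -
  have p0: "p > 0" using assms(1) by (rule prime_gt_0_nat)
  have Ip: "Im (of_nat p * u) > 0" using p0 assms(2) by simp
  have "((\<lambda>e. q_exp (of_nat (p * e) * u)) has_sum geom_q (of_nat p * u)) {1..}"
    using geom_q_has_sum[OF Ip] by (simp add: mult_ac)
  then have "((\<lambda>e. q_exp (of_nat e * u)) has_sum geom_q (of_nat p * u)) {e \<in> {1..}. p dvd e}"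
    by (rule multiples_has_sum[OF p0])
  then have "((\<lambda>e. if p dvd e then q_exp (of_nat e * u) else 0) has_sum geom_q (of_nat p * u)) {1..}"
    by (rule has_sum_cong_neutral[THEN iffD1, rotated -1]) auto
  then have "((\<lambda>e. of_nat p * (if p dvd e then q_exp (of_nat e * u) else 0)) has_sum of_nat p * geom_q (of_nat p * u)) {1..}"
    by (rule has_sum_cmult_right)
  then have "((\<lambda>e. - (of_nat p * (if p dvd e then q_exp (of_nat e * u) else 0))) has_sum - (of_nat p * geom_q (of_nat p * u))) {1..}"
    by (rule has_sum_uminusI)
  from has_sum_add[OF geom_q_has_sum[OF assms(2)] this] show ?thesis
    unfolding twisted_geom_def diff_conv_add_uminus
  proof (rule has_sum_cong[THEN iffD1, rotated])
    fix e :: nat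
    show "q_exp (of_nat e * u) + - (of_nat p * (if p dvd e then q_exp (of_nat e * u) else 0)) =
        a_coeff p e * q_exp (of_nat e * u)"
      by (simp add: a_coeff_def coprime_prime_iff[OF assms(1)] algebra_simps)
  qed
qed

text \<open>The index 0 is excluded automatically, since \<open>p\<close> divides it.\<close>

definition prime_to :: "nat \<Rightarrow> nat set" where
  "prime_to p = {d. \<not> p dvd d}"

lemma prime_to_pos: "d \<in> prime_to p \<Longrightarrow> d > 0"
  by (cases d) (auto simp: prime_to_def)

lemma prime_to_eq: "prime_to p = {1..} - {n \<in> {1..}. p dvd n}"
  by (auto simp: prime_to_def Suc_le_eq intro: Nat.gr0I)

lemma product_summable_on:
  fixes f :: "'a \<Rightarrow> real" and g :: "'b \<Rightarrow> real"
  assumes "f summable_on A" "g summable_on B" "\<And>x. x \<in> A \<Longrightarrow> f x \<ge> 0" "\<And>y. y \<in> B \<Longrightarrow> g y \<ge> 0"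
  shows "(\<lambda>(x, y). f x * g y) summable_on A \<times> B"
proof (rule summable_on_SigmaI)
  show "((\<lambda>y. case (x, y) of (x, y) \<Rightarrow> f x * g y) has_sum f x * infsum g B) B" for x
    using assms(2) by (auto intro!: has_sum_cmult_right has_sum_infsum)
  show "(\<lambda>x. f x * infsum g B) summable_on A" by (intro summable_on_cmult_left assms)
qed (use assms in auto)

text \<open>Write \<open>n = d * e\<close> with \<open>d\<close> the divisor in
  \<open>sigma_char\<close>. The character forces \<open>d\<close> to be prime to \<open>p\<close>,
  so \<open>p\<close> divides \<open>d * e\<close> iff it divides \<open>e\<close>, and
  \<open>a_coeff\<close> depends on \<open>e\<close> alone. Absolute convergence allows summing over
  \<open>e\<close> first.\<close>

theorem F_char_lambert:
  assumes p: "prime p" and z: "Im z > 0"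
  shows "((\<lambda>d. twisted_geom p (of_nat d * z) / of_nat d ^ m) has_sum F_char m p z) (prime_to p)"
proof -
  define r where "r = norm (q_exp z)"
  have r: "0 < r" "r < 1" using norm_q_exp_less[OF z] by (auto simp: r_def q_exp_def)
  define f where "f = (\<lambda>(d, e). a_coeff p e * q_exp (of_nat e * (of_nat d * z)) / of_nat d ^ m)"
  have "(\<lambda>n. r ^ n) summable_on {1::nat..}"
    using has_sum_geometric_from_1[of r] r by (auto simp: summable_on_def)
  moreover from this have "(\<lambda>n. r ^ n) summable_on prime_to p"
    by (rule summable_on_subset_banach) (auto simp: prime_to_eq)
  ultimately have "(\<lambda>(d, e :: nat). r ^ d * r ^ e) summable_on (prime_to p \<times> {1..})"
    using r by (intro product_summable_on) auto
  then have "(\<lambda>x. (real p / r) * (case x of (d, e) \<Rightarrow> r ^ d * r ^ e)) summable_on (prime_to p \<times> {1..})"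
    by (rule summable_on_cmult_right)
  then have "(\<lambda>x. norm (f x)) summable_on (prime_to p \<times> {1..})"
  proof (rule Infinite_Sum.abs_summable_on_comparison_test')
    fix x :: "nat \<times> nat" assume x: "x \<in> prime_to p \<times> {1..}"
    obtain d e where de: "x = (d, e)" by (cases x)
    have d: "d \<ge> 1" "e \<ge> 1" using x prime_to_pos by (auto simp: de Suc_le_eq)
    have "norm (a_coeff p e) \<le> real p"
    proof -
      have "(1 - of_nat p :: complex) = - of_nat (p - 1)" using prime_gt_0_nat[OF p] by simp
      then have "norm (1 - of_nat p :: complex) = real (p - 1)" by (metis norm_minus_cancel norm_of_nat)
      then show ?thesis using prime_gt_0_nat[OF p] by (simp add: a_coeff_def)
    qed
    moreover have "norm (q_exp (of_nat e * (of_nat d * z))) \<le> r ^ (d + e - 1)"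
    proof -
      have "q_exp (of_nat e * (of_nat d * z)) = q_exp z ^ (d * e)"
        by (simp add: q_exp_of_nat_mult power_mult del: power_mult_distrib)
      \<comment> \<open>From \<open>(d - 1) * (e - 1)\<close> being nonnegative. It replaces the
        exponent \<open>d * e\<close> by a sum, so the majorant becomes a product of two geometric
        series, up to the factor \<open>p / r\<close>.\<close>
      moreover have "d + e - 1 \<le> d * e"
      proof -
        obtain a b where "d = Suc a" "e = Suc b" using d by (cases d; cases e) auto
        then show ?thesis by simp
      qed
      ultimately show ?thesis using r power_decreasing[of "d + e - 1" "d * e" r]
        by (simp add: norm_power flip: r_def)
    qed
    ultimately have "norm (a_coeff p e) * norm (q_exp (of_nat e * (of_nat d * z))) \<le> real p * r ^ (d + e - 1)"
      using r by (intro mult_mono) auto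
    moreover have "norm (f x) \<le> norm (a_coeff p e) * norm (q_exp (of_nat e * (of_nat d * z)))"
    proof -
      have "norm (f x) = norm (a_coeff p e) * norm (q_exp (of_nat e * (of_nat d * z))) / real d ^ m"
        by (simp add: f_def de norm_mult norm_divide norm_power)
      also have "\<dots> \<le> norm (a_coeff p e) * norm (q_exp (of_nat e * (of_nat d * z))) / 1"
        using d by (intro divide_left_mono one_le_power) auto
      finally show ?thesis by simp
    qed
    moreover have "real p * r ^ (d + e - 1) = (real p / r) * (r ^ d * r ^ e)"
    proof -
      have "r ^ d * r ^ e = r ^ Suc (d + e - 1)" using d by (simp flip: power_add)
      then show ?thesis using r by simp
    qed
    ultimately show "norm (f x) \<le> (real p / r) * (case x of (d, e) \<Rightarrow> r ^ d * r ^ e)" by (simp add: de)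
  qed
  then have "f summable_on (prime_to p \<times> {1..})" by (rule abs_summable_summable)
  then obtain S where S: "(f has_sum S) (prime_to p \<times> {1..})" by (auto simp: summable_on_def)
  have rows: "((\<lambda>d. twisted_geom p (of_nat d * z) / of_nat d ^ m) has_sum S) (prime_to p)"
  proof (rule has_sum_SigmaD[OF S])
    fix d assume "d \<in> prime_to p"
    then have "Im (of_nat d * z) > 0" using z prime_to_pos[of d p] by simp
    from has_sum_divide_const[OF twisted_geom_has_sum[OF p this], of "of_nat d ^ m"]
    show "((\<lambda>e. f (d, e)) has_sum twisted_geom p (of_nat d * z) / of_nat d ^ m) {1..}"
      by (simp add: f_def)
  qed
  define g where "g = (\<lambda>(n, d). a_coeff p n * q_exp (of_nat n * z) / of_nat d ^ m)"
  have "(f has_sum S) (prime_to p \<times> {1..}) \<longleftrightarrow> (g has_sum S) (Sigma {1..} (\<lambda>n. {d \<in> prime_to p. d dvd n}))"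
  proof (rule has_sum_reindex_bij_witness[of _ "\<lambda>(n, d). (d, n div d)" "\<lambda>(d, e). (d * e, d)"])
    fix x :: "nat \<times> nat" assume x: "x \<in> prime_to p \<times> {1..}"
    obtain d e where de: "x = (d, e)" by (cases x)
    have d: "d > 0" using x prime_to_pos by (auto simp: de)
    show "(case (case x of (d, e) \<Rightarrow> (d * e, d)) of (n, d) \<Rightarrow> (d, n div d)) = x" using d by (simp add: de)
    show "(case x of (d, e) \<Rightarrow> (d * e, d)) \<in> Sigma {1..} (\<lambda>n. {d \<in> prime_to p. d dvd n})"
      using x d by (auto simp: de Suc_le_eq)
    have "p dvd d * e \<longleftrightarrow> p dvd e" using x p by (auto simp: de prime_to_def prime_dvd_mult_iff)
    then show "g (case x of (d, e) \<Rightarrow> (d * e, d)) = f x"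
      using p by (simp add: g_def f_def de a_coeff_def coprime_prime_iff mult_ac)
  next
    fix y :: "nat \<times> nat" assume y: "y \<in> Sigma {1..} (\<lambda>n. {d \<in> prime_to p. d dvd n})"
    obtain n d where nd: "y = (n, d)" by (cases y)
    have d: "d > 0" using y prime_to_pos by (auto simp: nd)
    show "(case (case y of (n, d) \<Rightarrow> (d, n div d)) of (d, e) \<Rightarrow> (d * e, d)) = y"
      using y by (simp add: nd)
    show "(case y of (n, d) \<Rightarrow> (d, n div d)) \<in> prime_to p \<times> {1..}"
      using y d by (auto simp: nd Suc_le_eq elim!: dvdE intro: Nat.gr0I)
  qed simp
  with S have "(g has_sum S) (Sigma {1..} (\<lambda>n. {d \<in> prime_to p. d dvd n}))" by simp
  then have "((\<lambda>n. a_coeff p n * sigma_char m (principal_char p) n * exp (2 * of_real pi * \<i> * of_nat n * z)) has_sum S) {1..}"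
  proof (rule has_sum_SigmaD)
    fix n :: nat assume n: "n \<in> {1..}"
    have fin: "finite {d \<in> prime_to p. d dvd n}" "finite {d. d dvd n}" using n by auto
    have "sigma_char m (principal_char p) n = (\<Sum>d\<in>{d \<in> prime_to p. d dvd n}. 1 / of_nat d ^ m)"
    proof -
      have "sigma_char m (principal_char p) n = (\<Sum>d\<in>{d. d dvd n}. if d \<in> prime_to p then 1 / of_nat d ^ m else 0)"
        unfolding sigma_char_def
        by (intro sum.cong) (auto simp: principal_char_def coprime_prime_iff[OF p] prime_to_def power_int_minus power_int_def inverse_eq_divide power_inverse power_one_over)
      also have "\<dots> = (\<Sum>d\<in>{d \<in> prime_to p. d dvd n}. 1 / of_nat d ^ m)"
        using fin by (intro sum.mono_neutral_cong_right) auto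
      finally show ?thesis .
    qed
    then have "a_coeff p n * sigma_char m (principal_char p) n * exp (2 * of_real pi * \<i> * of_nat n * z) =
        (\<Sum>d\<in>{d \<in> prime_to p. d dvd n}. g (n, d))"
      by (simp add: g_def q_exp_def sum_distrib_left sum_distrib_right mult_ac)
    then show "((\<lambda>d. g (n, d)) has_sum a_coeff p n * sigma_char m (principal_char p) n * exp (2 * of_real pi * \<i> * of_nat n * z))
        {d \<in> prime_to p. d dvd n}"
      using fin by (intro has_sum_finiteI) auto
  qed
  also have "?this \<longleftrightarrow> ((\<lambda>n. a_coeff p (Suc n) * sigma_char m (principal_char p) (Suc n) * exp (2 * of_real pi * \<i> * of_nat (Suc n) * z)) has_sum S) UNIV"
    by (rule has_sum_reindex_bij_witness[of _ Suc "\<lambda>n. n - 1"]) auto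
  finally have "S = F_char m p z"
    unfolding F_char_def by (auto dest!: has_sum_imp_sums sums_unique)
  then show ?thesis using rows by simp
qed

section \<open>The reciprocity formula for positive \<open>k\<close>\<close>

lemma Im_neg_inverse_pos: "Im t > 0 \<Longrightarrow> Im (- 1 / t) > 0"
  by (subst Im_complex_div_gt_0) simp

lemma has_sum_diff:
  fixes f g :: "'a \<Rightarrow> complex"
  assumes "(f has_sum a) A" "(g has_sum b) A"
  shows "((\<lambda>x. f x - g x) has_sum (a - b)) A"
  using has_sum_add[OF assms(1) has_sum_uminusI[OF assms(2)]] by simp

lemma has_sum_sum:
  fixes f :: "'i \<Rightarrow> 'a \<Rightarrow> 'b :: real_normed_vector"
  assumes "\<And>i. i \<in> I \<Longrightarrow> (f i has_sum s i) A"
  shows "((\<lambda>x. \<Sum>i\<in>I. f i x) has_sum (\<Sum>i\<in>I. s i)) A"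
  using assms by (induction I rule: infinite_finite_induct) (auto intro: has_sum_add)

text \<open>From the expansion at \<open>p * u\<close> the multiples of \<open>p\<close> are
  removed; they form the expansion at \<open>u\<close>. The two polar terms agree and
  cancel.\<close>

lemma prime_to_pi_cot_has_sum:
  assumes p: "prime p" and u: "Im u > 0"
  shows "((\<lambda>n. 2 * u * of_nat p ^ 2 / ((of_nat p * u)\<^sup>2 - of_nat n ^ 2)) has_sum
           (of_nat p * pi_cot (of_nat p * u) - pi_cot u)) (prime_to p)"
proof -
  have p0: "p > 0" using p by (rule prime_gt_0_nat)
  have Ip: "Im (of_nat p * u) > 0" using p0 u by simp
  define f where "f n = 2 * u * of_nat p ^ 2 / ((of_nat p * u)\<^sup>2 - of_nat n ^ 2)" for n :: nat
  have all: "(f has_sum of_nat p * (pi_cot (of_nat p * u) - 1 / (of_nat p * u))) {1..}"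
    using has_sum_cmult_right[OF pi_cot_has_sum[OF Ip], of "of_nat p"]
    by (simp add: f_def[abs_def] power2_eq_square mult_ac)
  have "(\<lambda>n. f (p * n)) = (\<lambda>n. 2 * u / (u\<^sup>2 - of_nat n ^ 2))"
  proof
    fix n
    have "(of_nat p * u)\<^sup>2 - of_nat (p * n) ^ 2 = of_nat p ^ 2 * (u\<^sup>2 - of_nat n ^ 2)"
      by (simp add: power_mult_distrib algebra_simps)
    then show "f (p * n) = 2 * u / (u\<^sup>2 - of_nat n ^ 2)" using p0 by (simp add: f_def)
  qed
  then have "((\<lambda>n. f (p * n)) has_sum pi_cot u - 1 / u) {1..}" using pi_cot_has_sum[OF u] by simp
  then have "(f has_sum pi_cot u - 1 / u) {n \<in> {1..}. p dvd n}" by (rule multiples_has_sum[OF p0])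
  from has_sum_Diff[OF all this]
  have "(f has_sum of_nat p * (pi_cot (of_nat p * u) - 1 / (of_nat p * u)) - (pi_cot u - 1 / u)) (prime_to p)"
    unfolding prime_to_eq by auto
  also have "of_nat p * (pi_cot (of_nat p * u) - 1 / (of_nat p * u)) - (pi_cot u - 1 / u) =
      of_nat p * pi_cot (of_nat p * u) - pi_cot u"
    using p0 by (simp add: algebra_simps)
  finally show ?thesis by (simp add: f_def[abs_def])
qed

lemma twisted_geom_pi_cot:
  assumes "prime p" "Im u > 0"
  shows "twisted_geom p u = (of_nat p - 1) / 2 - \<i> / (2 * of_real pi) * (of_nat p * pi_cot (of_nat p * u) - pi_cot u)"
proof -
  have "Im (of_nat p * u) > 0" using prime_gt_0_nat[OF assms(1)] assms(2) by simp
  then show ?thesis using assms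
    by (simp add: twisted_geom_def geom_q_pi_cot) (simp add: field_simps)
qed

section \<open>Zeta sums and the symmetric kernel over integers prime to \<open>p\<close>\<close>

definition zeta_prime_to :: "nat \<Rightarrow> nat \<Rightarrow> complex" where
  "zeta_prime_to p s = (\<Sum>\<^sub>\<infinity>n\<in>prime_to p. 1 / of_nat n ^ s)"

lemma power_abs_summable:
  assumes "s \<ge> 2"
  shows "(\<lambda>n. norm (1 / complex_of_nat n ^ s)) summable_on A"
proof (rule Infinite_Sum.abs_summable_on_comparison_test'[OF inverse_squares_summable])
  fix n :: nat
  show "norm (1 / complex_of_nat n ^ s) \<le> 1 / real n ^ 2"
  proof (cases "n = 0")
    case False
    then have "real n ^ 2 \<le> real n ^ s" using assms by (intro power_increasing) auto
    then have "1 / real n ^ s \<le> 1 / real n ^ 2" by (intro frac_le) (use False in simp_all)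
    then show ?thesis by (simp add: norm_divide norm_power)
  qed (use assms in simp)
qed

lemma zeta_prime_to_has_sum:
  assumes "s \<ge> 2"
  shows "((\<lambda>n. 1 / of_nat n ^ s) has_sum zeta_prime_to p s) (prime_to p)"
  unfolding zeta_prime_to_def
  by (rule has_sum_infsum, rule abs_summable_summable, rule power_abs_summable, rule assms)

lemma zeta_prime_to_product_has_sum:
  assumes "a \<ge> 2" "b \<ge> 2"
  shows "((\<lambda>(d, n). (1 / of_nat d ^ a) * (1 / of_nat n ^ b)) has_sum zeta_prime_to p a * zeta_prime_to p b)
           (prime_to p \<times> prime_to p)"
proof (rule has_sum_SigmaI)
  show "((\<lambda>n. case (d, n) of (d, n) \<Rightarrow> (1 / of_nat d ^ a) * (1 / of_nat n ^ b)) has_sum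
      (1 / of_nat d ^ a) * zeta_prime_to p b) (prime_to p)" for d
    by (simp only: prod.case) (intro has_sum_cmult_right zeta_prime_to_has_sum assms)
  show "((\<lambda>d. (1 / of_nat d ^ a) * zeta_prime_to p b) has_sum zeta_prime_to p a * zeta_prime_to p b) (prime_to p)"
    by (intro has_sum_cmult_left zeta_prime_to_has_sum assms)
  have "(\<lambda>(d, n). norm (1 / complex_of_nat d ^ a) * norm (1 / complex_of_nat n ^ b)) summable_on (prime_to p \<times> prime_to p)"
    by (intro product_summable_on power_abs_summable assms) auto
  then have "(\<lambda>x. norm (case x of (d, n) \<Rightarrow> (1 / complex_of_nat d ^ a) * (1 / of_nat n ^ b))) summable_on (prime_to p \<times> prime_to p)"
    by (rule summable_on_cong[THEN iffD1, rotated]) (auto simp: norm_mult norm_divide)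
  then show "(\<lambda>(d, n). (1 / complex_of_nat d ^ a) * (1 / of_nat n ^ b)) summable_on (prime_to p \<times> prime_to p)"
    by (rule abs_summable_summable)
qed

definition kernel_sum :: "nat \<Rightarrow> nat \<Rightarrow> complex \<Rightarrow> complex" where
  "kernel_sum p k t = (\<Sum>\<^sub>\<infinity>(d, n)\<in>prime_to p \<times> prime_to p. 1 / of_nat d ^ (2 * k) * (1 / ((of_nat d * t)\<^sup>2 - of_nat n ^ 2)))"

text \<open>A product majorant: the kernel bound yields the inverse square of \<open>n\<close>, and
  the power of \<open>d\<close> is summable precisely because \<open>k\<close> is positive.\<close>

lemma kernel_sum_has_sum:
  assumes "Im t > 0" "k \<ge> 1"
  shows "((\<lambda>(d, n). 1 / of_nat d ^ (2 * k) * (1 / ((of_nat d * t)\<^sup>2 - of_nat n ^ 2))) has_sum kernel_sum p k t)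
           (prime_to p \<times> prime_to p)"
proof -
  obtain K where K: "K > 0" "\<And>x y :: real. x\<^sup>2 + y\<^sup>2 \<le> K * norm ((of_real x * t)\<^sup>2 - of_real y ^ 2)"
    using kernel_lower_bound[OF assms(1)] by metis
  define f where "f = (\<lambda>(d, n). 1 / of_nat d ^ (2 * k) * (1 / ((of_nat d * t)\<^sup>2 - of_nat n ^ 2)))"
  have "(\<lambda>(d, n). norm (1 / complex_of_nat d ^ (2 * k)) * (K * (1 / real n ^ 2))) summable_on (prime_to p \<times> prime_to p)"
    using K(1) assms(2)
    by (intro product_summable_on power_abs_summable summable_on_cmult_right inverse_squares_summable) auto
  then have "(\<lambda>x. norm (f x)) summable_on (prime_to p \<times> prime_to p)"
  proof (rule Infinite_Sum.abs_summable_on_comparison_test')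
    fix x assume x: "x \<in> prime_to p \<times> prime_to p"
    obtain d n where dn: "x = (d, n)" by (cases x)
    have n: "n > 0" using x prime_to_pos by (auto simp: dn)
    have le: "real n ^ 2 \<le> K * norm ((of_nat d * t)\<^sup>2 - of_nat n ^ 2)"
      using K(2)[of "real d" "real n"] by (simp add: order_trans[rotated])
    moreover have "real n ^ 2 > 0" using n by simp
    ultimately have "norm ((of_nat d * t)\<^sup>2 - of_nat n ^ 2) > 0" using K(1) by (metis less_le_trans zero_less_mult_pos)
    then have "norm (1 / ((of_nat d * t)\<^sup>2 - of_nat n ^ 2)) \<le> K * (1 / real n ^ 2)"
      using le n by (simp add: norm_divide field_simps)
    then show "norm (f x) \<le> (case x of (d, n) \<Rightarrow> norm (1 / complex_of_nat d ^ (2 * k)) * (K * (1 / real n ^ 2)))"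
      unfolding f_def dn prod.case norm_mult by (rule mult_left_mono) auto
  qed
  then have "f summable_on (prime_to p \<times> prime_to p)" by (rule abs_summable_summable)
  then show ?thesis unfolding kernel_sum_def f_def by (rule has_sum_infsum)
qed

text \<open>The constant \<open>(p - 1) / 2\<close> of the twisted geometric series produces the odd
  zeta value, and its cotangent part, expanded in partial fractions, the kernel.\<close>

lemma F_char_kernel_sum:
  assumes p: "prime p" and z: "Im z > 0" and k: "k \<ge> 1"
  shows "F_char (2 * k + 1) p z = (of_nat p - 1) / 2 * zeta_prime_to p (2 * k + 1) -
           \<i> * of_nat p * (of_nat p * z) / of_real pi * kernel_sum p k (of_nat p * z)"
proof -
  define t where "t = of_nat p * z"
  have t: "Im t > 0" using prime_gt_0_nat[OF p] z by (simp add: t_def)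
  define D where "D d = of_nat p * pi_cot (of_nat p * (of_nat d * z)) - pi_cot (of_nat d * z)" for d
  have D: "((\<lambda>d. D d / (2 * z * of_nat p ^ 2 * of_nat d ^ (2 * k + 1))) has_sum kernel_sum p k t) (prime_to p)"
  proof (rule has_sum_SigmaD[OF kernel_sum_has_sum[OF t k]])
    fix d assume "d \<in> prime_to p"
    then have d: "d > 0" by (rule prime_to_pos)
    then have "Im (of_nat d * z) > 0" using z by simp
    from has_sum_divide_const[OF prime_to_pi_cot_has_sum[OF p this], of "2 * z * of_nat p ^ 2 * of_nat d ^ (2 * k + 1)"]
    have "((\<lambda>n. 2 * (of_nat d * z) * of_nat p ^ 2 / ((of_nat p * (of_nat d * z))\<^sup>2 - of_nat n ^ 2) /
        (2 * z * of_nat p ^ 2 * of_nat d ^ (2 * k + 1))) has_sum D d / (2 * z * of_nat p ^ 2 * of_nat d ^ (2 * k + 1))) (prime_to p)"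
      by (simp add: D_def)
    also have "(\<lambda>n. 2 * (of_nat d * z) * of_nat p ^ 2 / ((of_nat p * (of_nat d * z))\<^sup>2 - of_nat n ^ 2) /
        (2 * z * of_nat p ^ 2 * of_nat d ^ (2 * k + 1))) =
        (\<lambda>n. 1 / of_nat d ^ (2 * k) * (1 / ((of_nat d * t)\<^sup>2 - of_nat n ^ 2)))"
    proof
      fix n
      have "z \<noteq> 0" "of_nat p \<noteq> (0 :: complex)" "of_nat d \<noteq> (0 :: complex)" using z d prime_gt_0_nat[OF p] by auto
      then show "2 * (of_nat d * z) * of_nat p ^ 2 / ((of_nat p * (of_nat d * z))\<^sup>2 - of_nat n ^ 2) /
        (2 * z * of_nat p ^ 2 * of_nat d ^ (2 * k + 1)) =
        1 / of_nat d ^ (2 * k) * (1 / ((of_nat d * t)\<^sup>2 - of_nat n ^ 2))"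
        by (simp add: t_def mult_ac)
    qed
    finally show "((\<lambda>n. case (d, n) of (d, n) \<Rightarrow> 1 / of_nat d ^ (2 * k) * (1 / ((of_nat d * t)\<^sup>2 - of_nat n ^ 2)))
        has_sum D d / (2 * z * of_nat p ^ 2 * of_nat d ^ (2 * k + 1))) (prime_to p)" by simp
  qed
  have "((\<lambda>d. (of_nat p - 1) / 2 * (1 / of_nat d ^ (2 * k + 1)) +
        - (\<i> * of_nat p * t / of_real pi) * (D d / (2 * z * of_nat p ^ 2 * of_nat d ^ (2 * k + 1)))) has_sum
      (of_nat p - 1) / 2 * zeta_prime_to p (2 * k + 1) + - (\<i> * of_nat p * t / of_real pi) * kernel_sum p k t) (prime_to p)"
    using k by (intro has_sum_add has_sum_cmult_right D zeta_prime_to_has_sum) auto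
  moreover have "((\<lambda>d. (of_nat p - 1) / 2 * (1 / of_nat d ^ (2 * k + 1)) +
        - (\<i> * of_nat p * t / of_real pi) * (D d / (2 * z * of_nat p ^ 2 * of_nat d ^ (2 * k + 1)))) has_sum
      F_char (2 * k + 1) p z) (prime_to p)"
  proof (rule has_sum_cong[THEN iffD1, OF _ F_char_lambert[OF p z]])
    fix d assume "d \<in> prime_to p"
    then have d: "d > 0" by (rule prime_to_pos)
    then have "Im (of_nat d * z) > 0" using z by simp
    then have tg: "twisted_geom p (of_nat d * z) = (of_nat p - 1) / 2 - \<i> / (2 * of_real pi) * D d"
      using twisted_geom_pi_cot[OF p] by (simp add: D_def)
    have "z \<noteq> 0" "of_nat p \<noteq> (0 :: complex)" "of_nat d \<noteq> (0 :: complex)" using z d prime_gt_0_nat[OF p] by auto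
    then have "(\<i> * of_nat p * t / of_real pi) * (D d / (2 * z * of_nat p ^ 2 * of_nat d ^ (2 * k + 1))) =
       \<i> / (2 * of_real pi) * D d / of_nat d ^ (2 * k + 1)"
      by (simp add: t_def field_simps power2_eq_square)
    then show "twisted_geom p (of_nat d * z) / of_nat d ^ (2 * k + 1) =
      (of_nat p - 1) / 2 * (1 / of_nat d ^ (2 * k + 1)) +
        - (\<i> * of_nat p * t / of_real pi) * (D d / (2 * z * of_nat p ^ 2 * of_nat d ^ (2 * k + 1)))"
      unfolding tg by (simp only: minus_mult_left[symmetric]) (simp add: diff_divide_distrib)
  qed
  ultimately show ?thesis using has_sum_unique by (fastforce simp: t_def)
qed

lemma geometric_difference:
  fixes x y :: complex
  assumes "x \<noteq> y"
  shows "(x ^ k - y ^ k) / (x - y) = (\<Sum>a<k. x ^ a * y ^ (k - 1 - a))"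
proof -
  have "x ^ k - y ^ k = (x - y) * (\<Sum>a<k. x ^ a * y ^ (k - Suc a))"
    by (simp add: power_diff_sumr2 mult_ac)
  then show ?thesis using assms by simp
qed

text \<open>Since \<open>t \<mapsto> - 1 / t\<close> exchanges the roles of \<open>d\<close> and \<open>n\<close> in the kernel, the combination below is a
  sum of \<open>(t^(2k) / n^(2k) - 1 / d^(2k)) / (d^2 t^2 - n^2)\<close>, a finite geometric sum.\<close>
lemma kernel_sum_reciprocity:
  assumes t: "Im t > 0" and k: "k \<ge> 1"
  shows "- (t ^ (2 * k)) / t\<^sup>2 * kernel_sum p k (- 1 / t) - kernel_sum p k t =
           (\<Sum>a<k. t ^ (2 * a) * (zeta_prime_to p (2 * k - 2 * a) * zeta_prime_to p (2 * a + 2)))"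
proof -
  let ?C = "prime_to p \<times> prime_to p"
  have t0: "t \<noteq> 0" using t by auto
  have t': "Im (- 1 / t) > 0" by (rule Im_neg_inverse_pos[OF t])
  have ne: "(of_nat d * t)\<^sup>2 \<noteq> of_nat n ^ 2" if "d \<in> prime_to p" for d n
  proof
    assume "(of_nat d * t)\<^sup>2 = of_nat n ^ 2"
    then have "of_nat d * t = of_nat n \<or> of_nat d * t = - of_nat n" by (simp add: power2_eq_iff)
    then have "Im (of_nat d * t) = 0" by (elim disjE) (simp_all only: complex_Im_of_nat uminus_complex.sel minus_zero)
    then show False using t prime_to_pos[OF that] by simp
  qed
  have "((\<lambda>(d, n). 1 / of_nat n ^ (2 * k) * (1 / ((of_nat n * (- 1 / t))\<^sup>2 - of_nat d ^ 2))) has_sum kernel_sum p k (- 1 / t)) ?C"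
    using has_sum_swap[THEN iffD1, OF kernel_sum_has_sum[OF t' k]] by (simp add: case_prod_unfold)
  from has_sum_diff[OF has_sum_cmult_right[OF this, of "- (t ^ (2 * k)) / t\<^sup>2"] kernel_sum_has_sum[OF t k]]
  have "((\<lambda>(d, n). (- (t ^ (2 * k)) / t\<^sup>2) * (1 / of_nat n ^ (2 * k) * (1 / ((of_nat n * (- 1 / t))\<^sup>2 - of_nat d ^ 2))) -
      1 / of_nat d ^ (2 * k) * (1 / ((of_nat d * t)\<^sup>2 - of_nat n ^ 2))) has_sum
     (- (t ^ (2 * k)) / t\<^sup>2 * kernel_sum p k (- 1 / t) - kernel_sum p k t)) ?C"
    by (simp add: case_prod_unfold)
  moreover have "((\<lambda>(d, n). \<Sum>a<k. t ^ (2 * a) * (1 / of_nat d ^ (2 * k - 2 * a) * (1 / of_nat n ^ (2 * a + 2)))) has_sum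
     (\<Sum>a<k. t ^ (2 * a) * (zeta_prime_to p (2 * k - 2 * a) * zeta_prime_to p (2 * a + 2)))) ?C"
  proof -
    have "((\<lambda>x. \<Sum>a<k. t ^ (2 * a) * (case x of (d, n) \<Rightarrow> 1 / of_nat d ^ (2 * k - 2 * a) * (1 / of_nat n ^ (2 * a + 2)))) has_sum
     (\<Sum>a<k. t ^ (2 * a) * (zeta_prime_to p (2 * k - 2 * a) * zeta_prime_to p (2 * a + 2)))) ?C"
      by (intro has_sum_sum has_sum_cmult_right zeta_prime_to_product_has_sum) auto
    then show ?thesis by (simp add: case_prod_unfold)
  qed
  moreover have "(- (t ^ (2 * k)) / t\<^sup>2) * (1 / of_nat n ^ (2 * k) * (1 / ((of_nat n * (- 1 / t))\<^sup>2 - of_nat d ^ 2))) -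
      1 / of_nat d ^ (2 * k) * (1 / ((of_nat d * t)\<^sup>2 - of_nat n ^ 2)) =
      (\<Sum>a<k. t ^ (2 * a) * (1 / of_nat d ^ (2 * k - 2 * a) * (1 / of_nat n ^ (2 * a + 2))))"
    if dn: "d \<in> prime_to p" "n \<in> prime_to p" for d n
  proof -
    define x where "x = (of_nat d * t)\<^sup>2"
    define y where "y = complex_of_nat n ^ 2"
    have d0: "complex_of_nat d \<noteq> 0" "complex_of_nat n \<noteq> 0" using prime_to_pos dn by auto
    have xy: "x \<noteq> y" using ne[OF dn(1)] by (simp add: x_def y_def)
    have "(of_nat n * (- 1 / t))\<^sup>2 - of_nat d ^ 2 = - (x - y) / t\<^sup>2"
      using t0 by (simp add: x_def y_def field_simps power2_eq_square)
    then have "(- (t ^ (2 * k)) / t\<^sup>2) * (1 / of_nat n ^ (2 * k) * (1 / ((of_nat n * (- 1 / t))\<^sup>2 - of_nat d ^ 2))) =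
        t ^ (2 * k) / of_nat n ^ (2 * k) / (x - y)"
      using t0 xy by (simp add: divide_simps) (simp add: algebra_simps)
    then have "(- (t ^ (2 * k)) / t\<^sup>2) * (1 / of_nat n ^ (2 * k) * (1 / ((of_nat n * (- 1 / t))\<^sup>2 - of_nat d ^ 2))) -
      1 / of_nat d ^ (2 * k) * (1 / ((of_nat d * t)\<^sup>2 - of_nat n ^ 2)) =
      (t ^ (2 * k) / of_nat n ^ (2 * k) - 1 / of_nat d ^ (2 * k)) / (x - y)"
      by (simp add: x_def y_def diff_divide_distrib)
    also have "t ^ (2 * k) / of_nat n ^ (2 * k) - 1 / of_nat d ^ (2 * k) =
        (x ^ k - y ^ k) / (of_nat d ^ (2 * k) * of_nat n ^ (2 * k))"
      using d0 by (simp add: x_def y_def power_mult_distrib field_simps flip: power_mult)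
    also have "\<dots> / (x - y) = (x ^ k - y ^ k) / (x - y) / (of_nat d ^ (2 * k) * of_nat n ^ (2 * k))"
      by simp
    also have "(x ^ k - y ^ k) / (x - y) = (\<Sum>a<k. x ^ a * y ^ (k - 1 - a))"
      by (rule geometric_difference[OF xy])
    also have "\<dots> / (of_nat d ^ (2 * k) * of_nat n ^ (2 * k)) =
        (\<Sum>a<k. t ^ (2 * a) * (1 / of_nat d ^ (2 * k - 2 * a) * (1 / of_nat n ^ (2 * a + 2))))"
      unfolding sum_divide_distrib
    proof (rule sum.cong)
      fix a assume "a \<in> {..<k}"
      then have a: "a < k" by simp
      have "complex_of_nat d ^ (2 * k) = of_nat d ^ (2 * a) * of_nat d ^ (2 * k - 2 * a)"
        using a by (simp flip: power_add)
      moreover have "complex_of_nat n ^ (2 * k) = of_nat n ^ (2 * (k - 1 - a)) * of_nat n ^ (2 * a + 2)"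
      proof -
        have "2 * k = 2 * (k - 1 - a) + (2 * a + 2)" using a by simp
        then show ?thesis by (metis power_add)
      qed
      ultimately show "x ^ a * y ^ (k - 1 - a) / (of_nat d ^ (2 * k) * of_nat n ^ (2 * k)) =
          t ^ (2 * a) * (1 / of_nat d ^ (2 * k - 2 * a) * (1 / of_nat n ^ (2 * a + 2)))"
        using d0 by (simp add: x_def y_def power_mult_distrib flip: power_mult)
    qed simp
    finally show ?thesis .
  qed
  ultimately show ?thesis
    by (intro has_sum_unique[where A = ?C]) (auto elim!: has_sum_cong[THEN iffD1, rotated])
qed

theorem F_char_reciprocity:
  assumes p: "prime p" and z: "Im z > 0" and k: "k \<ge> 1"
  defines "t \<equiv> of_nat p * z"
  shows "t ^ (2 * k) * F_char (2 * k + 1) p (- 1 / (of_nat p ^ 2 * z)) - F_char (2 * k + 1) p z =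
     (of_nat p - 1) / 2 * zeta_prime_to p (2 * k + 1) * (t ^ (2 * k) - 1) -
     \<i> * of_nat p * t / of_real pi *
       (\<Sum>a<k. t ^ (2 * a) * (zeta_prime_to p (2 * k - 2 * a) * zeta_prime_to p (2 * a + 2)))"
proof -
  define w where "w = - 1 / (of_nat p ^ 2 * z)"
  have p0: "p > 0" by (rule prime_gt_0_nat[OF p])
  have t: "Im t > 0" using p0 z by (simp add: t_def)
  have t0: "t \<noteq> 0" using t by auto
  \<comment> \<open>In the coordinate \<open>t = p z\<close> the involution of the theorem becomes
    \<open>t \<mapsto> - 1 / t\<close>.\<close>
  have pw: "of_nat p * w = - 1 / t" using p0 by (simp add: w_def t_def power2_eq_square)
  have "Im (- 1 / t) > 0" by (rule Im_neg_inverse_pos[OF t])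
  then have w: "Im w > 0" using p0 unfolding pw[symmetric] by (simp add: zero_less_mult_iff)
  define c where "c = (of_nat p - 1) / 2 * zeta_prime_to p (2 * k + 1)"
  have Fw: "F_char (2 * k + 1) p w = c - \<i> * of_nat p * (- 1 / t) / of_real pi * kernel_sum p k (- 1 / t)"
    unfolding F_char_kernel_sum[OF p w k] pw c_def ..
  have Fz: "F_char (2 * k + 1) p z = c - \<i> * of_nat p * t / of_real pi * kernel_sum p k t"
    unfolding F_char_kernel_sum[OF p z k] t_def c_def ..
  have "t ^ (2 * k) * F_char (2 * k + 1) p w - F_char (2 * k + 1) p z = c * (t ^ (2 * k) - 1) -
     \<i> * of_nat p * t / of_real pi * (- (t ^ (2 * k)) / t\<^sup>2 * kernel_sum p k (- 1 / t) - kernel_sum p k t)"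
    unfolding Fw Fz using t0 by (simp add: field_simps power2_eq_square)
  then show ?thesis unfolding kernel_sum_reciprocity[OF t k] by (simp add: w_def c_def)
qed

section \<open>Even zeta values\<close>

definition zeta_nat :: "nat \<Rightarrow> complex" where
  "zeta_nat s = (\<Sum>\<^sub>\<infinity>n\<in>{1..}. 1 / of_nat n ^ s)"

lemma zeta_nat_has_sum:
  assumes "s \<ge> 2"
  shows "((\<lambda>n. 1 / of_nat n ^ s) has_sum zeta_nat s) {1..}"
  unfolding zeta_nat_def
  by (rule has_sum_infsum, rule abs_summable_summable, rule power_abs_summable, rule assms)

text \<open>The Euler factor at \<open>p\<close>: the multiples of \<open>p\<close> contribute
  \<open>p ^ (- s)\<close> times the full sum.\<close>

lemma zeta_prime_to_eq:
  assumes "s \<ge> 2" "p > 0"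
  shows "zeta_prime_to p s = (1 - 1 / of_nat p ^ s) * zeta_nat s"
proof -
  have "((\<lambda>n. 1 / complex_of_nat (p * n) ^ s) has_sum 1 / of_nat p ^ s * zeta_nat s) {1..}"
    using has_sum_cmult_right[OF zeta_nat_has_sum[OF assms(1)], of "1 / of_nat p ^ s"]
    by (simp add: power_mult_distrib)
  then have "((\<lambda>n. 1 / complex_of_nat n ^ s) has_sum 1 / of_nat p ^ s * zeta_nat s) {n \<in> {1..}. p dvd n}"
    by (rule multiples_has_sum[OF assms(2), of "\<lambda>n. 1 / complex_of_nat n ^ s"])
  from has_sum_Diff[OF zeta_nat_has_sum[OF assms(1)] this]
  have "((\<lambda>n. 1 / complex_of_nat n ^ s) has_sum zeta_nat s - 1 / of_nat p ^ s * zeta_nat s) (prime_to p)"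
    unfolding prime_to_eq by auto
  then have "zeta_prime_to p s = zeta_nat s - 1 / of_nat p ^ s * zeta_nat s"
    using has_sum_unique zeta_prime_to_has_sum[OF assms(1)] by blast
  then show ?thesis by (simp add: algebra_simps)
qed

text \<open>Every partial fraction is a geometric series in \<open>(x / n) ^ 2\<close>; the double
  sum converges absolutely, and summing over \<open>n\<close> first gives the zeta values.\<close>

lemma pi_cot_power_series:
  assumes x: "norm x < 1" "x \<noteq> 0"
  shows "((\<lambda>j. - 2 * (zeta_nat (2 * j) * x ^ (2 * j))) has_sum (x * pi_cot x - 1)) {1..}"
proof -
  have not_Int: "x \<notin> \<int>"
  proof
    assume "x \<in> \<int>"
    then obtain m where "x = of_int m" by (auto elim: Ints_cases)
    then show False using x by (auto simp: abs_less_iff)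
  qed
  define f where "f = (\<lambda>(n, j). - 2 * ((x / of_nat n)\<^sup>2) ^ j)"
  have "(\<lambda>j. (norm x) ^ j) summable_on {1::nat..}"
    using has_sum_geometric_from_1[of "norm x"] x by (auto simp: summable_on_def)
  then have "(\<lambda>(n, j). (2 * (1 / real n ^ 2)) * (norm x) ^ j) summable_on ({1..} \<times> {1..})"
    by (intro product_summable_on summable_on_cmult_right inverse_squares_summable) auto
  then have "(\<lambda>y. norm (f y)) summable_on ({1..} \<times> {1..})"
  proof (rule Infinite_Sum.abs_summable_on_comparison_test')
    fix y :: "nat \<times> nat" assume y: "y \<in> {1..} \<times> {1..}"
    obtain n j where nj: "y = (n, j)" by (cases y)
    have n: "n \<ge> 1" "j \<ge> 1" using y by (auto simp: nj)
    have "((norm x)\<^sup>2) ^ j \<le> (norm x) ^ j" using x by (intro power_mono) (auto simp: power2_eq_square mult_left_le)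
    moreover have "1 / (real n ^ 2) ^ j \<le> 1 / real n ^ 2"
    proof (rule frac_le)
      have "(real n ^ 2) ^ 1 \<le> (real n ^ 2) ^ j" using n by (intro power_increasing) auto
      then show "real n ^ 2 \<le> (real n ^ 2) ^ j" by simp
    qed (use n in auto)
    ultimately have "((norm x)\<^sup>2) ^ j * (1 / (real n ^ 2) ^ j) \<le> (norm x) ^ j * (1 / real n ^ 2)"
      by (intro mult_mono) auto
    then show "norm (f y) \<le> (case y of (n, j) \<Rightarrow> (2 * (1 / real n ^ 2)) * (norm x) ^ j)"
      by (simp add: f_def nj norm_mult norm_power norm_divide power_divide mult_ac)
  qed
  then have "f summable_on ({1..} \<times> {1..})" by (rule abs_summable_summable)
  then obtain S where S: "(f has_sum S) ({1..} \<times> {1..})" by (auto simp: summable_on_def)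
  have "((\<lambda>n. x * (2 * x / (x\<^sup>2 - of_nat n ^ 2))) has_sum S) {1..}"
  proof (rule has_sum_SigmaD[OF S])
    fix n :: nat assume n: "n \<in> {1..}"
    define y where "y = (x / of_nat n)\<^sup>2"
    have "norm (x / of_nat n) < 1" using n x by (simp add: norm_divide divide_less_eq)
    then have y: "norm y < 1" unfolding y_def norm_power by (intro power_less_one_iff[THEN iffD2]) auto
    have "(of_nat n)\<^sup>2 \<noteq> x\<^sup>2"
    proof
      assume "(of_nat n)\<^sup>2 = x\<^sup>2"
      then have "y = (of_nat n)\<^sup>2 / (of_nat n)\<^sup>2" by (simp only: y_def power_divide)
      then have "y = 1" using n by simp
      then show False using y by simp
    qed
    then have "- 2 * (y / (1 - y)) = x * (2 * x / (x\<^sup>2 - of_nat n ^ 2))"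
      using n unfolding y_def by (simp add: power_divide divide_simps) (simp add: power2_eq_square algebra_simps)
    then show "((\<lambda>j. f (n, j)) has_sum x * (2 * x / (x\<^sup>2 - of_nat n ^ 2))) {1..}"
      using has_sum_cmult_right[OF has_sum_geometric_from_1[OF y], of "- 2"] by (simp add: f_def y_def)
  qed
  also have "?this \<longleftrightarrow> ((\<lambda>n. x * (2 * x / (x\<^sup>2 - of_nat (Suc n) ^ 2))) has_sum S) UNIV"
    by (rule has_sum_reindex_bij_witness[of _ Suc "\<lambda>n. n - 1"]) auto
  finally have "(\<lambda>n. x * (2 * x / (x\<^sup>2 - of_nat (Suc n) ^ 2))) sums S" by (rule has_sum_imp_sums)
  moreover have "(\<lambda>n. x * (2 * x / (x\<^sup>2 - of_nat (Suc n) ^ 2))) sums (x * (pi_cot x - 1 / x))"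
    by (rule sums_mult[OF pi_cot_sums[OF not_Int]])
  ultimately have "S = x * (pi_cot x - 1 / x)" using sums_unique2 by blast
  then have SS: "S = x * pi_cot x - 1" using x by (simp add: algebra_simps)
  have "((\<lambda>j. - 2 * (zeta_nat (2 * j) * x ^ (2 * j))) has_sum S) {1..}"
  proof (rule has_sum_SigmaD[OF has_sum_swap[THEN iffD1, OF S]])
    fix j :: nat assume "j \<in> {1..}"
    then have "2 * j \<ge> 2" by simp
    from has_sum_cmult_right[OF zeta_nat_has_sum[OF this], of "- 2 * x ^ (2 * j)"]
    show "((\<lambda>n. case (j, n) of (x, y) \<Rightarrow> f (y, x)) has_sum - 2 * (zeta_nat (2 * j) * x ^ (2 * j))) {1..}"
      by (simp add: f_def power_divide power_mult[symmetric] mult_ac)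
  qed
  then show ?thesis by (simp add: SS)
qed

text \<open>The power series of \<open>x / (exp x - 1)\<close> with its coefficients given by zeta
  values. It is identified with the Bernoulli series by uniqueness; the entry \<open>- 1 / 2\<close>
  at index 1 fits the convention for the first Bernoulli number.\<close>

definition zeta_fps :: "complex fps" where
  "zeta_fps = Abs_fps (\<lambda>n. if n = 0 then 1 else if n = 1 then - 1 / 2
     else if even n then - 2 * (zeta_nat n / (2 * of_real pi * \<i>) ^ n) else 0)"

lemma exp_neq_1_small:
  fixes u :: complex
  assumes u: "norm u < 1" "u \<noteq> 0"
  shows "exp u \<noteq> 1"
proof
  assume "exp u = 1"
  then obtain n :: int where n: "Re u = 0" "Im u = of_int (2 * n) * pi" by (auto simp: exp_eq_1)
  then have "n \<noteq> 0" using u by (auto simp: complex_eq_iff)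
  then have "(1::real) \<le> \<bar>of_int n\<bar>" by linarith
  then have "1 * 1 \<le> \<bar>of_int n :: real\<bar> * (2 * pi)" using pi_gt3 by (intro mult_mono) auto
  then have "\<bar>Im u\<bar> \<ge> 1" using n by (simp add: abs_mult mult_ac)
  then show False using u abs_Im_le_cmod[of u] by simp
qed

text \<open>With \<open>u = 2 * pi * i * x\<close> the function is
  \<open>- u * (1 + geom_q x)\<close>. The cotangent formula turns this into
  \<open>1 - u / 2\<close>, the terms of index 0 and 1, plus \<open>x * pi_cot x - 1\<close>, the
  even ones.\<close>

lemma zeta_fps_sums:
  assumes u: "norm u < 1" "u \<noteq> 0"
  shows "(\<lambda>n. fps_nth zeta_fps n * u ^ n) sums (u / (exp u - 1))"
proof -
  define x where "x = u / (2 * of_real pi * \<i>)"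
  have ux: "u = 2 * of_real pi * \<i> * x" by (simp add: x_def)
  have "norm x = norm u / (2 * pi)" by (simp add: x_def norm_divide norm_mult)
  also have "\<dots> < 1" using u pi_gt3 by (simp add: divide_less_eq)
  finally have x: "norm x < 1" "x \<noteq> 0" using u by (auto simp: x_def)
  have q: "q_exp x = exp u" by (simp add: q_exp_def ux)
  have q1: "exp u \<noteq> 1" by (rule exp_neq_1_small[OF u])
  have "1 / (exp u - 1) = - (1 + geom_q x)" using q1 by (simp add: geom_q_def q divide_simps)
  also have "geom_q x = - 1 / 2 + \<i> / (2 * of_real pi) * pi_cot x" using q1 q by (intro geom_q_pi_cot_general) simp
  finally have inv: "1 / (exp u - 1) = - (1 + (- 1 / 2 + \<i> / (2 * of_real pi) * pi_cot x))" .
  have "u * (1 / (exp u - 1)) = - u / 2 - u * (\<i> / (2 * of_real pi) * pi_cot x)"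
    unfolding inv by (simp add: algebra_simps)
  also have "u * (\<i> / (2 * of_real pi) * pi_cot x) = - x * pi_cot x" by (simp add: ux mult_ac)
  finally have val: "u / (exp u - 1) = (1 - u / 2) + (x * pi_cot x - 1)" by simp
  let ?g = "\<lambda>n. fps_nth zeta_fps n * u ^ n"
  have "(?g has_sum (x * pi_cot x - 1)) {n. even n \<and> n \<ge> 2}"
  proof -
    have "((\<lambda>j. - 2 * (zeta_nat (2 * j) * x ^ (2 * j))) has_sum (x * pi_cot x - 1)) {1..} \<longleftrightarrow>
        (?g has_sum (x * pi_cot x - 1)) {n. even n \<and> n \<ge> 2}"
    proof (rule has_sum_reindex_bij_witness[of _ "\<lambda>n. n div 2" "\<lambda>j. 2 * j"])
      fix j :: nat assume "j \<in> {1..}"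
      then have "2 * j \<noteq> 0" "2 * j \<noteq> 1" by auto
      then have "fps_nth zeta_fps (2 * j) = - 2 * (zeta_nat (2 * j) / (2 * of_real pi * \<i>) ^ (2 * j))"
        by (simp add: zeta_fps_def)
      then show "fps_nth zeta_fps (2 * j) * u ^ (2 * j) = - 2 * (zeta_nat (2 * j) * x ^ (2 * j))"
        by (simp add: x_def power_divide)
    qed auto
    then show ?thesis using pi_cot_power_series[OF x] by simp
  qed
  moreover have "(?g has_sum (1 - u / 2)) {0, 1}"
    by (intro has_sum_finiteI) (auto simp: zeta_fps_def)
  ultimately have "(?g has_sum ((x * pi_cot x - 1) + (1 - u / 2))) ({n. even n \<and> n \<ge> 2} \<union> {0, 1})"
    by (intro has_sum_Un_disjoint) auto
  also have "?this \<longleftrightarrow> (?g has_sum ((x * pi_cot x - 1) + (1 - u / 2))) UNIV"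
    by (rule has_sum_cong_neutral) (auto simp: zeta_fps_def)
  finally show ?thesis unfolding val by (auto dest!: has_sum_imp_sums simp: add.commute)
qed

lemma zeta_fps_mult: "zeta_fps * (fps_exp 1 - 1) = fps_X"
proof -
  \<comment> \<open>The value 1 fills the removable singularity at 0.\<close>
  define f :: "complex \<Rightarrow> complex" where "f u = (if u = 0 then 1 else u / (exp u - 1))" for u
  have ev: "eventually (\<lambda>u. u \<in> ball 0 1) (nhds (0::complex))" by (intro eventually_nhds_in_open) auto
  have "eventually (\<lambda>u. (\<lambda>n. fps_nth zeta_fps n * u ^ n) sums f u) (nhds 0)"
    using ev
  proof eventually_elim
    case (elim u)
    show ?case
    proof (cases "u = 0")
      case True
      have "(\<lambda>n. fps_nth zeta_fps n * 0 ^ n) sums fps_nth zeta_fps 0" by (rule powser_sums_zero)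
      then show ?thesis using True by (simp add: f_def zeta_fps_def)
    qed (use zeta_fps_sums elim in \<open>simp add: f_def\<close>)
  qed
  then have f: "f has_fps_expansion zeta_fps" by (rule has_fps_expansionI)
  have h: "(\<lambda>u. f u * (exp (1 * u) - 1)) has_fps_expansion (zeta_fps * (fps_exp 1 - 1))"
    by (intro has_fps_expansion_mult f has_fps_expansion_diff has_fps_expansion_exp has_fps_expansion_1)
  have "eventually (\<lambda>u. f u * (exp (1 * u) - 1) = u) (nhds 0)"
    using ev
  proof eventually_elim
    case (elim u)
    have "exp u \<noteq> 1" if "u \<noteq> 0" using elim that by (intro exp_neq_1_small) auto
    then show ?case by (auto simp: f_def)
  qed
  with h have "(\<lambda>u. u) has_fps_expansion (zeta_fps * (fps_exp 1 - 1))"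
    unfolding has_fps_expansion_def by (auto elim: eventually_elim2)
  then show ?thesis using has_fps_expansion_fps_X by (rule fps_expansion_unique_complex)
qed

section \<open>Bernoulli numbers and the even zeta values\<close>

definition bernoulli_coeff :: "nat \<Rightarrow> real" where
  "bernoulli_coeff n = fps_nth (fps_X / (fps_exp 1 - 1)) n"

lemma bernoulli_number_over_fact: "bernoulli_number n / fact n = bernoulli_coeff n"
  by (simp add: bernoulli_number_def bernoulli_coeff_def)

text \<open>The division is exact: \<open>fps_exp 1 - 1\<close> has subdegree 1 and therefore
  divides \<open>fps_X\<close>.\<close>

lemma bernoulli_fps_mult: "fps_X / (fps_exp 1 - 1) * (fps_exp 1 - 1) = (fps_X :: real fps)"
proof -
  have nth1: "fps_nth (fps_exp 1 - 1 :: real fps) 1 = 1" by simp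
  then have nz: "fps_exp 1 - 1 \<noteq> (0 :: real fps)" by (metis fps_zero_nth zero_neq_one)
  have "subdegree (fps_exp 1 - 1 :: real fps) \<le> 1" using nth1 by (intro subdegree_leI) simp
  then have "fps_exp 1 - 1 dvd (fps_X :: real fps)" using nz by (simp add: fps_dvd_iff)
  then show ?thesis by simp
qed

text \<open>Both series have product \<open>fps_X\<close> with \<open>fps_exp 1 - 1\<close>, which
  may be cancelled. The real identity is carried over to complex coefficients by comparing them one
  at a time.\<close>

lemma bernoulli_coeff_eq_zeta_fps: "of_real (bernoulli_coeff n) = fps_nth zeta_fps n"
proof -
  define Bc where "Bc = Abs_fps (\<lambda>n. complex_of_real (bernoulli_coeff n))"
  have "Bc * (fps_exp 1 - 1) = fps_X"
  proof (rule fps_ext)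
    fix n
    have "fps_nth (Bc * (fps_exp 1 - 1)) n =
        of_real (fps_nth (fps_X / (fps_exp 1 - 1) * (fps_exp 1 - 1) :: real fps) n)"
      unfolding fps_mult_nth of_real_sum
      by (intro sum.cong) (simp_all add: Bc_def bernoulli_coeff_def)
    then show "fps_nth (Bc * (fps_exp 1 - 1)) n = fps_nth fps_X n"
      unfolding bernoulli_fps_mult by simp
  qed
  then have "Bc * (fps_exp 1 - 1) = zeta_fps * (fps_exp 1 - 1)" by (simp add: zeta_fps_mult)
  moreover have "fps_nth (fps_exp 1 - 1 :: complex fps) 1 = 1" by simp
  then have "fps_exp 1 - 1 \<noteq> (0 :: complex fps)" by (metis fps_zero_nth zero_neq_one)
  ultimately have "Bc = zeta_fps" by simp
  then show ?thesis by (simp add: Bc_def fps_eq_iff)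
qed

lemma zeta_nat_even:
  assumes "n \<ge> 2" "even n"
  shows "zeta_nat n = - ((2 * of_real pi * \<i>) ^ n) * of_real (bernoulli_coeff n) / 2"
  using assms unfolding bernoulli_coeff_eq_zeta_fps by (simp add: zeta_fps_def)

text \<open>The usual recursion, read off at degree \<open>Suc n\<close> from the product with
  \<open>fps_exp 1 - 1\<close>. Rationality is what makes the coefficients of \<open>R_poly\<close>
  algebraic.\<close>

lemma bernoulli_coeff_rat: "bernoulli_coeff n \<in> \<rat>"
proof (induction n rule: less_induct)
  case (less n)
  define E where "E = (fps_exp 1 - 1 :: real fps)"
  have fact: "(fact k :: real) \<in> \<rat>" for k by (metis of_nat_fact Rats_of_nat)
  have E: "fps_nth E k \<in> \<rat>" for k by (auto simp: E_def intro: Rats_divide fact)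
  have E0: "fps_nth E 0 = 0" and E1: "fps_nth E 1 = 1" by (simp_all add: E_def)
  have "fps_nth fps_X (Suc n) = fps_nth (fps_X / (fps_exp 1 - 1) * (fps_exp 1 - 1) :: real fps) (Suc n)"
    by (simp only: bernoulli_fps_mult)
  also have "\<dots> = (\<Sum>i=0..Suc n. bernoulli_coeff i * fps_nth E (Suc n - i))"
    unfolding fps_mult_nth by (simp only: bernoulli_coeff_def E_def)
  also have "\<dots> = (\<Sum>i=0..n. bernoulli_coeff i * fps_nth E (Suc n - i))" using E0 by simp
  also have "{0..n} = insert n {..<n}" by auto
  also have "(\<Sum>i\<in>insert n {..<n}. bernoulli_coeff i * fps_nth E (Suc n - i)) =
      bernoulli_coeff n + (\<Sum>i<n. bernoulli_coeff i * fps_nth E (Suc n - i))" using E1 by simp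
  finally have "bernoulli_coeff n = fps_nth fps_X (Suc n) - (\<Sum>i<n. bernoulli_coeff i * fps_nth E (Suc n - i))" by simp
  also have "\<dots> \<in> \<rat>"
    by (intro Rats_diff Rats_sum Rats_mult E less) (auto simp: fps_X_def)
  finally show ?case .
qed

lemma poly_R_poly:
  "poly (R_poly k p) z = (\<Sum>j=1..k. (of_nat p ^ (2 * j) - 1) * (of_nat p ^ (2 * k + 2 - 2 * j) - 1) *
     of_real (bernoulli_coeff (2 * j)) * of_real (bernoulli_coeff (2 * k + 2 - 2 * j)) * (of_nat p * z) ^ (2 * k + 2 - 2 * j))"
  by (simp add: R_poly_def poly_sum bernoulli_number_over_fact del: of_real_divide mult_Suc_right) (simp add: mult_ac)

text \<open>By Euler's evaluation every product of two even zeta values carries the same power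
  \<open>pi ^ (2 * k + 2)\<close>, of which the prefactor \<open>1 / pi\<close> removes one.
  Everything else in the second summand is algebraic for algebraic \<open>z\<close>.\<close>

theorem F_char_reciprocity_R_poly:
  assumes p: "prime p" and z: "Im z > 0" and k: "k \<ge> 1"
  shows "(z * of_nat p) ^ (2 * k) * F_char (2 * k + 1) p (- 1 / (of_nat p ^ 2 * z)) - F_char (2 * k + 1) p z =
     (of_nat p - 1) / 2 * zeta_prime_to p (2 * k + 1) * ((of_nat p * z) ^ (2 * k) - 1) +
     of_real pi ^ (2 * k + 1) * ((- \<i> * (2 * \<i>) ^ (2 * k + 2) / (4 * of_nat p ^ (2 * k + 2))) * (poly (R_poly k p) z / z))"
proof -
  define t where "t = of_nat p * z"
  have p0: "complex_of_nat p \<noteq> 0" "p > 0" using prime_gt_0_nat[OF p] by auto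
  have z0: "z \<noteq> 0" using z by auto
  have t0: "t \<noteq> 0" using p0 z0 by (simp add: t_def)
  have zeta: "zeta_prime_to p n = - (of_nat p ^ n - 1) / of_nat p ^ n * (2 * of_real pi * \<i>) ^ n * of_real (bernoulli_coeff n) / 2"
    if "n \<ge> 2" "even n" for n
    using p0 by (simp add: zeta_prime_to_eq[OF that(1) p0(2)] zeta_nat_even[OF that] field_simps)
  define C where "C = (2 * of_real pi * \<i>) ^ (2 * k + 2) / (4 * of_nat p ^ (2 * k + 2))"
  \<comment> \<open>The factor \<open>t ^ 2\<close> raises the exponent \<open>2 * a\<close> to
    \<open>2 * a + 2\<close>, which is \<open>2 * k + 2 - 2 * j\<close> under
    \<open>j = k - a\<close>.\<close>
  have "t\<^sup>2 * (\<Sum>a<k. t ^ (2 * a) * (zeta_prime_to p (2 * k - 2 * a) * zeta_prime_to p (2 * a + 2))) = C * poly (R_poly k p) z"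
    unfolding poly_R_poly sum_distrib_left
  proof (rule sum.reindex_bij_witness[of _ "\<lambda>j. k - j" "\<lambda>a. k - a"])
    fix a assume "a \<in> {..<k}"
    then have a: "a < k" by simp
    define m where "m = 2 * k - 2 * a"
    define l where "l = 2 * a + 2"
    have ml: "2 * (k - a) = m" "2 * k + 2 - 2 * (k - a) = l" "m \<ge> 2" "l \<ge> 2" "even m" "even l" "2 * k + 2 = m + l"
      using a by (auto simp: m_def l_def)
    have "t\<^sup>2 * t ^ (2 * a) = t ^ l" by (simp add: l_def power_add power2_eq_square mult.commute)
    then have "t\<^sup>2 * (t ^ (2 * a) * (zeta_prime_to p m * zeta_prime_to p l)) = t ^ l * (zeta_prime_to p m * zeta_prime_to p l)"
      by simp
    also have "\<dots> = C * ((of_nat p ^ m - 1) * (of_nat p ^ l - 1) * of_real (bernoulli_coeff m) * of_real (bernoulli_coeff l) * t ^ l)"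
      unfolding C_def ml(7) power_add using p0 by (simp add: zeta ml divide_simps) (simp add: algebra_simps)
    finally show "C * ((of_nat p ^ (2 * (k - a)) - 1) * (of_nat p ^ (2 * k + 2 - 2 * (k - a)) - 1) * of_real (bernoulli_coeff (2 * (k - a))) *
       of_real (bernoulli_coeff (2 * k + 2 - 2 * (k - a))) * (of_nat p * z) ^ (2 * k + 2 - 2 * (k - a))) =
       t\<^sup>2 * (t ^ (2 * a) * (zeta_prime_to p (2 * k - 2 * a) * zeta_prime_to p (2 * a + 2)))"
      unfolding ml(2) unfolding ml(1) by (simp only: m_def l_def t_def)
  qed auto
  then have sum: "(\<Sum>a<k. t ^ (2 * a) * (zeta_prime_to p (2 * k - 2 * a) * zeta_prime_to p (2 * a + 2))) = C * poly (R_poly k p) z / t\<^sup>2"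
    using t0 by (simp add: field_simps)
  have "\<i> * of_nat p * t / of_real pi * (C * poly (R_poly k p) z / t\<^sup>2) =
      - (of_real pi ^ (2 * k + 1) * ((- \<i> * (2 * \<i>) ^ (2 * k + 2) / (4 * of_nat p ^ (2 * k + 2))) * (poly (R_poly k p) z / z)))"
    using p0 z0 unfolding C_def t_def
    by (simp add: power_mult_distrib power2_eq_square field_simps)
  then show ?thesis
    using F_char_reciprocity[OF p z k] unfolding t_def[symmetric] sum
    by (simp add: t_def mult.commute)
qed

section \<open>The reciprocity formula for \<open>k = 0\<close>\<close>

definition geom_q_deriv :: "complex \<Rightarrow> complex" where
  "geom_q_deriv u = 2 * of_real pi * \<i> * q_exp u / (1 - q_exp u) ^ 2"

lemma geom_q_has_field_derivative:
  assumes "Im u > 0"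
  shows "(geom_q has_field_derivative geom_q_deriv u) (at u)"
proof -
  have "q_exp u \<noteq> 1" using norm_q_exp_less[OF assms] by auto
  then have q: "exp (2 * of_real pi * \<i> * u) \<noteq> 1" "1 - exp (2 * of_real pi * \<i> * u) \<noteq> 0"
    by (auto simp: q_exp_def)
  show ?thesis
    unfolding geom_q_def[abs_def] geom_q_deriv_def q_exp_def
    by (rule derivative_eq_intros refl q)+ (use q in \<open>simp add: field_simps power2_eq_square\<close>)
qed

text \<open>The sum of \<open>1 / (u + n) ^ 2\<close> over all integers \<open>n\<close>, split into
  two half-lines.\<close>

definition trigamma_sum :: "complex \<Rightarrow> complex" where
  "trigamma_sum u = Polygamma 1 u + Polygamma 1 (1 - u)"

text \<open>The derivative of the cotangent formula for \<open>geom_q\<close>: Lipschitz's formula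
  in weight two.\<close>

lemma trigamma_sum_eq:
  assumes u: "Im u > 0"
  shows "trigamma_sum u = 2 * of_real pi * \<i> * geom_q_deriv u"
proof -
  have nI: "v \<notin> \<int>" "1 - v \<notin> \<int>" if "Im v > 0" for v
    using that by (auto elim!: Ints_cases dest: arg_cong[where f = Im])
  have np: "u \<notin> \<int>\<^sub>\<le>\<^sub>0" "1 - u \<notin> \<int>\<^sub>\<le>\<^sub>0" using nI[OF u] nonpos_Ints_subset_Ints by auto
  have "((\<lambda>v. - 1 / 2 + \<i> / (2 * of_real pi) * (Digamma (1 - v) - Digamma v)) has_field_derivative
      - (\<i> / (2 * of_real pi)) * trigamma_sum u) (at u)"
    unfolding trigamma_sum_def using np
    by (auto intro!: derivative_eq_intros simp: algebra_simps)
  moreover have "eventually (\<lambda>v. Im v > 0) (nhds u)"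
    using u eventually_nhds_in_open[OF open_halfspace_Im_gt[of 0]] by auto
  then have "eventually (\<lambda>v. geom_q v = - 1 / 2 + \<i> / (2 * of_real pi) * (Digamma (1 - v) - Digamma v)) (nhds u)"
    by eventually_elim (simp add: geom_q_pi_cot pi_cot_Digamma upper_half_plane_not_Int)
  ultimately have "(geom_q has_field_derivative - (\<i> / (2 * of_real pi)) * trigamma_sum u) (at u)"
    by (subst DERIV_cong_ev[OF refl _ refl])
  then have "geom_q_deriv u = - (\<i> / (2 * of_real pi)) * trigamma_sum u"
    using geom_q_has_field_derivative[OF u] DERIV_unique by blast
  then show ?thesis by (simp add: field_simps)
qed

section \<open>The Lambert series of weight two and its antiderivative\<close>

lemma norm_one_minus_ge:
  assumes "Im z > 0" "d \<ge> 1"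
  shows "1 - norm (q_exp z) \<le> norm (1 - q_exp (of_nat d * z))"
proof -
  have "norm (q_exp z) ^ d \<le> norm (q_exp z) ^ 1"
    using norm_q_exp_less[OF assms(1)] assms(2) by (intro power_decreasing) auto
  then have "norm (q_exp (of_nat d * z)) \<le> norm (q_exp z)" by (simp add: q_exp_of_nat_mult norm_power)
  then show ?thesis using norm_triangle_ineq2[of 1 "q_exp (of_nat d * z)"] by simp
qed

lemma q_exp_power_summable: "Im z > 0 \<Longrightarrow> (\<lambda>d. c * norm (q_exp z) ^ d) summable_on {1::nat..}"
  using has_sum_geometric_from_1[of "norm (q_exp z)"] norm_q_exp_less[of z]
  by (intro summable_on_cmult_right) (auto simp: summable_on_def)

lemma geom_q_deriv_norm_le:
  assumes "Im z > 0" "d \<ge> 1"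
  shows "norm (geom_q_deriv (of_nat d * z)) \<le> 2 * pi / (1 - norm (q_exp z)) ^ 2 * norm (q_exp z) ^ d"
proof -
  have r: "0 < 1 - norm (q_exp z)" using norm_q_exp_less[OF assms(1)] by simp
  have "norm (geom_q_deriv (of_nat d * z)) = 2 * pi * norm (q_exp z) ^ d / norm (1 - q_exp (of_nat d * z)) ^ 2"
    by (simp add: geom_q_deriv_def norm_mult norm_divide norm_power q_exp_of_nat_mult)
  also have "\<dots> \<le> 2 * pi * norm (q_exp z) ^ d / (1 - norm (q_exp z)) ^ 2"
    using r norm_one_minus_ge[OF assms] by (intro frac_le power_mono) auto
  finally show ?thesis by simp
qed

text \<open>Equals \<open>2 * pi * i\<close> times the generating series of the divisor sums
  \<open>sigma_1\<close>: the weight two Eisenstein series without its constant term, up to a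
  factor.\<close>

definition lambert_deriv :: "complex \<Rightarrow> complex" where
  "lambert_deriv z = (\<Sum>\<^sub>\<infinity>d\<in>{1..}. geom_q_deriv (of_nat d * z))"

lemma lambert_deriv_has_sum:
  assumes "Im z > 0"
  shows "((\<lambda>d. geom_q_deriv (of_nat d * z)) has_sum lambert_deriv z) {1..}"
proof -
  have "(\<lambda>d. norm (geom_q_deriv (of_nat d * z))) summable_on {1..}"
    by (rule Infinite_Sum.abs_summable_on_comparison_test'[OF q_exp_power_summable[OF assms, of "2 * pi / (1 - norm (q_exp z)) ^ 2"]])
       (use geom_q_deriv_norm_le[OF assms] in auto)
  then have "(\<lambda>d. geom_q_deriv (of_nat d * z)) summable_on {1..}" by (rule abs_summable_summable)
  then show ?thesis unfolding lambert_deriv_def by (rule has_sum_infsum)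
qed

text \<open>Expanding \<open>geom_q\<close> and summing over \<open>d\<close> gives the sum of
  \<open>- log (1 - q^n)\<close>: minus the logarithm of the eta function stripped of its factor
  \<open>q^(1/24)\<close>.\<close>

definition lambert_log :: "complex \<Rightarrow> complex" where
  "lambert_log z = (\<Sum>\<^sub>\<infinity>d\<in>{1..}. geom_q (of_nat d * z) / of_nat d)"

lemma lambert_log_has_sum:
  assumes "Im z > 0"
  shows "((\<lambda>d. geom_q (of_nat d * z) / of_nat d) has_sum lambert_log z) {1..}"
proof -
  have r: "0 < 1 - norm (q_exp z)" using norm_q_exp_less[OF assms(1)] by simp
  have "(\<lambda>d. norm (geom_q (of_nat d * z) / of_nat d)) summable_on {1..}"
  proof (rule Infinite_Sum.abs_summable_on_comparison_test'[OF q_exp_power_summable[OF assms, of "1 / (1 - norm (q_exp z))"]])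
    fix d :: nat assume "d \<in> {1..}"
    then have d: "d \<ge> 1" by simp
    have "norm (geom_q (of_nat d * z) / of_nat d) = norm (q_exp z) ^ d / norm (1 - q_exp (of_nat d * z)) / real d"
      by (simp add: geom_q_def norm_divide norm_mult norm_power q_exp_of_nat_mult)
    also have "\<dots> \<le> norm (q_exp z) ^ d / (1 - norm (q_exp z)) / 1"
      using r d norm_one_minus_ge[OF assms d] by (intro frac_le divide_nonneg_pos) auto
    finally show "norm (geom_q (of_nat d * z) / of_nat d) \<le> 1 / (1 - norm (q_exp z)) * norm (q_exp z) ^ d" by simp
  qed
  then have "(\<lambda>d. geom_q (of_nat d * z) / of_nat d) summable_on {1..}" by (rule abs_summable_summable)
  then show ?thesis unfolding lambert_log_def by (rule has_sum_infsum)
qed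

lemma has_sum_from_1_sums:
  fixes f :: "nat \<Rightarrow> complex"
  assumes "(f has_sum S) {1..}"
  shows "(\<lambda>n. f (Suc n)) sums S"
proof -
  have "(f has_sum S) {1..} \<longleftrightarrow> ((\<lambda>n. f (Suc n)) has_sum S) UNIV"
    by (rule has_sum_reindex_bij_witness[of _ Suc "\<lambda>n. n - 1"]) auto
  then show ?thesis using assms by (auto intro: has_sum_imp_sums)
qed

lemma lambert_log_has_field_derivative:
  assumes z: "Im z > 0"
  shows "(lambert_log has_field_derivative lambert_deriv z) (at z)"
proof -
  \<comment> \<open>Half the height of \<open>z\<close> bounds a half-plane around \<open>z\<close>
    on which \<open>q_exp\<close> stays uniformly below 1, as the Weierstrass test needs.\<close>
  define y where "y = Im z / 2"
  have y: "y > 0" "y < Im z" using z by (auto simp: y_def)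
  define S where "S = {w. Im w > y}"
  have S: "convex S" "open S" "z \<in> S"
    using y by (auto simp: S_def convex_halfspace_Im_gt open_halfspace_Im_gt)
  define r where "r = exp (- (2 * pi * y))"
  have r: "0 < r" "r < 1" using y by (auto simp: r_def)
  define f where "f n w = geom_q (of_nat (Suc n) * w) / of_nat (Suc n)" for n and w :: complex
  define f' where "f' n w = geom_q_deriv (of_nat (Suc n) * w)" for n and w :: complex
  have Im_S: "Im w > 0" if "w \<in> S" for w using that y by (auto simp: S_def)
  have "(\<lambda>n. f n z) sums lambert_log z"
    using has_sum_from_1_sums[OF lambert_log_has_sum[OF z]] by (simp add: f_def)
  then have sf: "summable (\<lambda>n. f n z)" by (simp add: sums_iff)
  have unif: "uniformly_convergent_on S (\<lambda>n w. \<Sum>i<n. f' i w)"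
  proof (rule Weierstrass_m_test')
    show "summable (\<lambda>n. 2 * pi / (1 - r) ^ 2 * r ^ Suc n)"
      using r by (intro summable_mult) (auto intro!: summable_mult summable_geometric)
    fix n w assume w: "w \<in> S"
    have q: "norm (q_exp w) \<le> r" using w by (simp add: norm_q_exp r_def S_def)
    have "norm (f' n w) \<le> 2 * pi / (1 - norm (q_exp w)) ^ 2 * norm (q_exp w) ^ Suc n"
      unfolding f'_def by (rule geom_q_deriv_norm_le[OF Im_S[OF w]]) simp
    also have "\<dots> \<le> 2 * pi / (1 - r) ^ 2 * r ^ Suc n"
      using q r by (intro mult_mono frac_le power_mono) auto
    finally show "norm (f' n w) \<le> 2 * pi / (1 - r) ^ 2 * r ^ Suc n" .
  qed
  have "((\<lambda>w. \<Sum>n. f n w) has_field_derivative (\<Sum>n. f' n z)) (at z)"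
  proof (rule has_field_derivative_series'(2)[where S = S and f = f and f' = f' and ?x0.0 = z, OF S(1) _ unif S(3) sf])
    show "z \<in> interior S" using S by (simp add: interior_open)
    fix n w assume w: "w \<in> S"
    have "Im (of_nat (Suc n) * w) > 0" using Im_S[OF w] by simp
    then have "((\<lambda>w. geom_q (of_nat (Suc n) * w)) has_field_derivative geom_q_deriv (of_nat (Suc n) * w) * of_nat (Suc n)) (at w)"
      by (rule DERIV_chain2[where f = geom_q and g = "\<lambda>w. of_nat (Suc n) * w", OF geom_q_has_field_derivative DERIV_cmult_Id])
    then have "(f n has_field_derivative geom_q_deriv (of_nat (Suc n) * w) * of_nat (Suc n) / of_nat (Suc n)) (at w)"
      unfolding f_def[abs_def] by (rule DERIV_cdivide)
    moreover have "geom_q_deriv (of_nat (Suc n) * w) * of_nat (Suc n) / of_nat (Suc n) = f' n w"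
      unfolding f'_def by (rule nonzero_mult_div_cancel_right) (simp del: of_nat_Suc)
    ultimately show "(f n has_field_derivative f' n w) (at w within S)"
      by (metis has_field_derivative_at_within)
  qed
  also have "(\<Sum>n. f' n z) = lambert_deriv z"
    using has_sum_from_1_sums[OF lambert_deriv_has_sum[OF z]] by (simp add: f'_def sums_iff)
  finally have "((\<lambda>w. \<Sum>n. f n w) has_field_derivative lambert_deriv z) (at z)" .
  moreover have "eventually (\<lambda>w. w \<in> S) (nhds z)" by (rule eventually_nhds_in_open[OF S(2,3)])
  then have "eventually (\<lambda>w. lambert_log w = (\<Sum>n. f n w)) (nhds z)"
  proof eventually_elim
    case (elim w)
    show ?case using has_sum_from_1_sums[OF lambert_log_has_sum[OF Im_S[OF elim]]] by (simp add: f_def sums_iff)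
  qed
  ultimately show ?thesis by (subst DERIV_cong_ev[OF refl _ refl])
qed

lemma trigamma_sum_has_sum:
  assumes u: "Im u > 0"
  shows "((\<lambda>n. 1 / (u - of_nat n)\<^sup>2 + 1 / (u + of_nat n)\<^sup>2) has_sum (trigamma_sum u - 1 / u\<^sup>2)) {1..}"
proof -
  obtain K where K: "K > 0" "\<And>x y :: real. x\<^sup>2 + y\<^sup>2 \<le> K * norm (of_real x * u + of_real y) ^ 2"
    using kernel_lower_bound[OF u] by metis
  have nI: "u \<notin> \<int>" by (rule upper_half_plane_not_Int[OF u])
  have u0: "u \<noteq> 0" "1 - u \<noteq> 0" using nI by auto
  let ?f = "\<lambda>n::nat. 1 / (u - of_nat n)\<^sup>2 + 1 / (u + of_nat n)\<^sup>2"
  have bound: "norm (1 / (u + of_real s)\<^sup>2) \<le> K * (1 / real n ^ 2)" if "\<bar>s\<bar> = real n" "n \<ge> 1" for s n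
  proof -
    have "real n ^ 2 = s\<^sup>2" using that by (metis power2_abs)
    then have le: "real n ^ 2 \<le> K * norm (u + of_real s) ^ 2" using K(2)[of 1 s] by simp
    moreover have "real n ^ 2 > 0" using that by simp
    ultimately have "norm (u + of_real s) ^ 2 > 0" using K(1) by (metis less_le_trans zero_less_mult_pos)
    then show ?thesis using le that by (simp add: norm_divide norm_power field_simps)
  qed
  have "(\<lambda>n. norm (?f n)) summable_on {1..}"
  proof (rule Infinite_Sum.abs_summable_on_comparison_test')
    show "(\<lambda>n. (2 * K) * (1 / real n ^ 2)) summable_on {1..}"
      by (intro summable_on_cmult_right inverse_squares_summable)
    fix n :: nat assume "n \<in> {1..}"
    then have n: "n \<ge> 1" by simp
    have "norm (?f n) \<le> norm (1 / (u - of_nat n)\<^sup>2) + norm (1 / (u + of_nat n)\<^sup>2)" by (rule norm_triangle_ineq)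
    also have "\<dots> \<le> K * (1 / real n ^ 2) + K * (1 / real n ^ 2)"
      using bound[of "- real n" n] bound[of "real n" n] n by (intro add_mono) auto
    finally show "norm (?f n) \<le> (2 * K) * (1 / real n ^ 2)" by (simp add: algebra_simps)
  qed
  then have "?f summable_on {1..}" by (rule abs_summable_summable)
  then obtain S where S: "(?f has_sum S) {1..}" by (auto simp: summable_on_def)
  have pg: "(\<lambda>k. inverse ((v + of_nat k) ^ 2)) sums Polygamma 1 v" if "v \<noteq> 0" for v :: complex
    using Polygamma_LIMSEQ[OF that, of 1] by (simp add: numeral_2_eq_2)
  have "(\<lambda>k. inverse ((u + of_nat (Suc k)) ^ 2)) sums (Polygamma 1 u - inverse (u ^ 2))"
    using pg[OF u0(1)] by (subst sums_Suc_iff) simp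
  from sums_add[OF pg[OF u0(2)] this]
  have "(\<lambda>k. inverse ((1 - u + of_nat k) ^ 2) + inverse ((u + of_nat (Suc k)) ^ 2)) sums (trigamma_sum u - 1 / u\<^sup>2)"
    by (simp add: trigamma_sum_def inverse_eq_divide algebra_simps)
  moreover have "(\<lambda>k. inverse ((1 - u + of_nat k) ^ 2) + inverse ((u + of_nat (Suc k)) ^ 2)) = (\<lambda>n. ?f (Suc n))"
  proof
    fix k
    have "1 - u + of_nat k = - (u - of_nat (Suc k))" by simp
    then show "inverse ((1 - u + of_nat k) ^ 2) + inverse ((u + of_nat (Suc k)) ^ 2) = ?f (Suc k)"
      by (simp only: power2_minus inverse_eq_divide)
  qed
  ultimately have "(\<lambda>n. ?f (Suc n)) sums (trigamma_sum u - 1 / u\<^sup>2)" by simp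
  then have "S = trigamma_sum u - 1 / u\<^sup>2" using has_sum_from_1_sums[OF S] sums_unique2 by blast
  then show ?thesis using S by simp
qed

text \<open>The exponent 3/2 is half of the cubic decay of the telescoped terms, shared equally
  between \<open>d\<close> and \<open>n\<close>.\<close>

lemma sesqui_summable: "(\<lambda>n. 1 / (real n * sqrt (real n))) summable_on A"
proof -
  have "summable (\<lambda>n. real n powr (- (3 / 2)))" by (subst summable_real_powr_iff) simp
  also have "(\<lambda>n. real n powr (- (3 / 2))) = (\<lambda>n. 1 / (real n * sqrt (real n)))"
  proof
    fix n
    have "real n powr (1 + 1 / 2) = real n * sqrt (real n)"
      by (simp only: powr_add powr_half_sqrt[symmetric] powr_one of_nat_0_le_iff)
    then show "real n powr (- (3 / 2)) = 1 / (real n * sqrt (real n))" by (simp add: powr_minus_divide)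
  qed
  finally have "(\<lambda>n. 1 / (real n * sqrt (real n))) summable_on UNIV"
    by (subst summable_on_UNIV_nonneg_real_iff) auto
  then show ?thesis by (rule summable_on_subset_banach) auto
qed

lemma telescoped_term_bound:
  fixes a b :: complex
  assumes \<rho>: "\<rho> > 0" "\<rho> \<le> norm a ^ 2" "\<rho> \<le> norm b ^ 2"
  shows "norm (1 / (a\<^sup>2 * b)) \<le> 1 / (\<rho> * sqrt \<rho>)"
proof -
  have "sqrt \<rho> \<le> norm b" using \<rho>(3) by (intro real_le_lsqrt) auto
  then have "\<rho> * sqrt \<rho> \<le> norm a ^ 2 * norm b" using \<rho> by (intro mult_mono) auto
  then have "1 / (norm a ^ 2 * norm b) \<le> 1 / (\<rho> * sqrt \<rho>)" using \<rho> by (intro frac_le) auto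
  then show ?thesis by (simp add: norm_divide norm_mult norm_power)
qed

text \<open>The quasimodularity of the weight two Eisenstein series: its two iterated sums differ by \<open>\<pi> i / z\<close>.
  Subtracting the telescoping terms \<open>V d n - V d (n + 1)\<close> makes the double sum absolutely convergent.\<close>
lemma trigamma_double_sum_swap:
  assumes z: "Im z > 0"
    and A: "((\<lambda>d. trigamma_sum (of_nat d * z) - 1 / (of_nat d * z)\<^sup>2) has_sum A) {1..}"
    and B: "((\<lambda>n. trigamma_sum (of_nat n * (- 1 / z)) - 1 / (of_nat n * (- 1 / z))\<^sup>2) has_sum B) {1..}"
  shows "A = B / z\<^sup>2 + of_real pi * \<i> / z"
proof -
  define w where "w = - 1 / z"
  have z0: "z \<noteq> 0" using z by auto
  have w: "Im w > 0" unfolding w_def by (rule Im_neg_inverse_pos[OF z])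
  obtain K where K: "K > 0" "\<And>x y :: real. x\<^sup>2 + y\<^sup>2 \<le> K * norm (of_real x * z + of_real y) ^ 2"
    using kernel_lower_bound[OF z] by metis
  define T where "T d n = 1 / (of_nat d * z - of_nat n)\<^sup>2 + 1 / (of_nat d * z + of_nat n)\<^sup>2" for d n :: nat
  define V where "V d n = 1 / (of_nat n + of_nat d * z) + 1 / (of_nat n - of_nat d * z)" for d n :: nat
  \<comment> \<open>\<open>U\<close> imitates \<open>T\<close>: up to sign \<open>T\<close> is a
    derivative of \<open>V\<close> in \<open>n\<close>, and \<open>U\<close> is the corresponding
    difference. The error \<open>T - U\<close> is a sum of two terms
    \<open>1 / (a^2 * (a + 1))\<close>, hence of cubic decay.\<close>
  define U where "U d n = V d n - V d (Suc n)" for d n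
  have Im_d: "Im (of_nat d * z) > 0" "Im (of_nat d * w) > 0" if "d \<ge> 1" for d
    using that z w by simp_all
  have ne: "of_nat n + of_nat d * z \<noteq> 0" "of_nat n - of_nat d * z \<noteq> 0" if "d \<ge> 1" for d n
    using Im_d[OF that] by (auto dest!: arg_cong[where f = Im])
  \<comment> \<open>The denominators at \<open>n\<close> and at \<open>n + 1\<close> are both
    measured against the product \<open>d * n\<close>, so that the majorant splits.\<close>
  have low: "real d * real n / K \<le> norm (of_nat m + of_nat d * z) ^ 2"
    "real d * real n / K \<le> norm (of_nat m - of_nat d * z) ^ 2" if "m \<ge> n" for d n m
  proof -
    have "real d * real n \<le> real d * real m" using that by (intro mult_left_mono) auto
    also have "\<dots> \<le> real d ^ 2 + real m ^ 2"
    proof -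
      have "2 * (real d * real m) \<le> real d ^ 2 + real m ^ 2" using sum_squares_bound[of "real d" "real m"] by simp
      moreover have "0 \<le> real d * real m" by simp
      ultimately show ?thesis by linarith
    qed
    finally have *: "real d * real n \<le> real d ^ 2 + real m ^ 2" .
    have "real d * real n \<le> K * norm (of_nat m + of_nat d * z) ^ 2"
      using * K(2)[of "real d" "real m"] by (simp add: add.commute)
    then show "real d * real n / K \<le> norm (of_nat m + of_nat d * z) ^ 2"
      using K(1) by (simp add: divide_le_eq mult.commute)
    have "real d * real n \<le> K * norm (of_nat d * z - of_nat m) ^ 2"
      using * K(2)[of "real d" "- real m"] by simp
    then show "real d * real n / K \<le> norm (of_nat m - of_nat d * z) ^ 2"
      using K(1) by (simp add: divide_le_eq mult.commute norm_minus_commute)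
  qed
  have TU: "norm (T d n - U d n) \<le> (2 * K * sqrt K) * (1 / (real d * sqrt (real d)) * (1 / (real n * sqrt (real n))))"
    if dn: "d \<ge> 1" "n \<ge> 1" for d n
  proof -
    define \<rho> where "\<rho> = real d * real n / K"
    have \<rho>: "\<rho> > 0" using dn K by (simp add: \<rho>_def)
    define a b where "a = of_nat n + of_nat d * z" and "b = of_nat n - of_nat d * z"
    have n0: "a \<noteq> 0" "b \<noteq> 0" "a + 1 \<noteq> 0" "b + 1 \<noteq> 0"
      using ne[OF dn(1), of n] ne[OF dn(1), of "Suc n"] by (auto simp: a_def b_def algebra_simps)
    have *: "1 / x\<^sup>2 - (1 / x - 1 / (x + 1)) = 1 / (x\<^sup>2 * (x + 1))" if "x \<noteq> 0" "x + 1 \<noteq> 0" for x :: complex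
      using that by (simp add: divide_simps power2_eq_square)
    have "T d n - U d n = (1 / a\<^sup>2 - (1 / a - 1 / (a + 1))) + (1 / b\<^sup>2 - (1 / b - 1 / (b + 1)))"
    proof -
      have "(of_nat d * z - of_nat n)\<^sup>2 = b\<^sup>2" by (simp add: b_def power2_commute)
      moreover have "of_nat d * z + of_nat n = a" "of_nat (Suc n) + of_nat d * z = a + 1" "of_nat (Suc n) - of_nat d * z = b + 1"
        by (simp_all add: a_def b_def)
      ultimately show ?thesis by (simp add: T_def U_def V_def a_def[symmetric] b_def[symmetric] del: of_nat_Suc)
    qed
    also have "\<dots> = 1 / (a\<^sup>2 * (a + 1)) + 1 / (b\<^sup>2 * (b + 1))" using n0 by (simp add: *)
    finally have "norm (T d n - U d n) \<le> norm (1 / (a\<^sup>2 * (a + 1))) + norm (1 / (b\<^sup>2 * (b + 1)))"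
      by (simp only: norm_triangle_ineq)
    also have "\<dots> \<le> 1 / (\<rho> * sqrt \<rho>) + 1 / (\<rho> * sqrt \<rho>)"
      using low[of n n d] low[of n "Suc n" d]
      by (intro add_mono telescoped_term_bound \<rho>) (simp_all add: \<rho>_def a_def b_def algebra_simps)
    also have "\<dots> = (2 * K * sqrt K) * (1 / (real d * sqrt (real d)) * (1 / (real n * sqrt (real n))))"
      using K(1) by (simp add: \<rho>_def real_sqrt_divide real_sqrt_mult mult_ac)
    finally show ?thesis .
  qed
  have "(\<lambda>x. (2 * K * sqrt K) * (case x of (d, n) \<Rightarrow> 1 / (real d * sqrt (real d)) * (1 / (real n * sqrt (real n))))) summable_on ({1..} \<times> {1..})"
    by (intro summable_on_cmult_right product_summable_on sesqui_summable) auto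
  then have "(\<lambda>x. norm (case x of (d, n) \<Rightarrow> T d n - U d n)) summable_on ({1..} \<times> {1..})"
    by (rule Infinite_Sum.abs_summable_on_comparison_test') (use TU in auto)
  then have "(\<lambda>(d, n). T d n - U d n) summable_on ({1..} \<times> {1..})" by (rule abs_summable_summable)
  then obtain S where S: "((\<lambda>(d, n). T d n - U d n) has_sum S) ({1..} \<times> {1..})" by (auto simp: summable_on_def)
  \<comment> \<open>The column sum of \<open>V\<close>: as a series in \<open>d\<close>,
    \<open>V d n\<close> is the cotangent expansion at \<open>n * w\<close>.\<close>
  define v where "v n = - (1 / z) * (pi_cot (of_nat n * w) - 1 / (of_nat n * w))" for n
  have V_col: "((\<lambda>d. V d n) has_sum v n) {1..}" if n: "n \<ge> 1" for n
  proof -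
    have "((\<lambda>d. - (1 / z) * (2 * (of_nat n * w) / ((of_nat n * w)\<^sup>2 - of_nat d ^ 2))) has_sum v n) {1..}"
      unfolding v_def by (intro has_sum_cmult_right pi_cot_has_sum Im_d n)
    then show ?thesis
    proof (rule has_sum_cong[THEN iffD1, rotated])
      fix d :: nat assume "d \<in> {1..}"
      then have n0: "of_nat n + of_nat d * z \<noteq> 0" "of_nat n - of_nat d * z \<noteq> 0" using ne by auto
      have "(of_nat n * w)\<^sup>2 - of_nat d ^ 2 = (of_nat n + of_nat d * z) * (of_nat n - of_nat d * z) / z\<^sup>2"
        using z0 by (simp add: w_def power2_eq_square field_simps)
      then have "- (1 / z) * (2 * (of_nat n * w) / ((of_nat n * w)\<^sup>2 - of_nat d ^ 2)) =
          2 * of_nat n / ((of_nat n + of_nat d * z) * (of_nat n - of_nat d * z))"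
        using z0 by (simp add: w_def power2_eq_square)
      also have "\<dots> = V d n" using n0 by (simp add: V_def add_divide_eq_iff divide_add_eq_iff)
      finally show "- (1 / z) * (2 * (of_nat n * w) / ((of_nat n * w)\<^sup>2 - of_nat d ^ 2)) = V d n" .
    qed
  qed
  have V_lim: "(\<lambda>n. V d (Suc n)) \<longlonglongrightarrow> 0" for d
  proof -
    have "(\<lambda>n. 1 / (of_nat n + c)) \<longlonglongrightarrow> 0" for c :: complex
      by (rule tendsto_divide_0[OF tendsto_const])
         (use tendsto_add_filterlim_at_infinity'[OF tendsto_of_nat tendsto_const[of c]] in simp)
    from this[of "of_nat d * z"] this[of "- (of_nat d * z)"]
    have "(\<lambda>n. V d n) \<longlonglongrightarrow> 0 + 0" unfolding V_def by (intro tendsto_add) simp_all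
    then show ?thesis by (simp add: LIMSEQ_Suc)
  qed
  have rows: "((\<lambda>n. T d n - U d n) has_sum trigamma_sum (of_nat d * z) - 1 / (of_nat d * z)\<^sup>2 - V d 1) {1..}"
    if d: "d \<in> {1..}" for d
  proof -
    have Td: "(T d has_sum trigamma_sum (of_nat d * z) - 1 / (of_nat d * z)\<^sup>2) {1..}"
      unfolding T_def[abs_def] using d by (intro trigamma_sum_has_sum Im_d) auto
    have "(\<lambda>n. T d n - U d n) summable_on {1..}"
      using summable_on_SigmaD1[of "\<lambda>d n. T d n - U d n" "{1..}" "\<lambda>_. {1..}" d] d S
      by (auto simp: summable_on_def)
    then obtain s where s: "((\<lambda>n. T d n - U d n) has_sum s) {1..}" by (auto simp: summable_on_def)
    have "((\<lambda>n. T d n - (T d n - U d n)) has_sum (trigamma_sum (of_nat d * z) - 1 / (of_nat d * z)\<^sup>2 - s)) {1..}"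
      by (rule has_sum_diff[OF Td s])
    then have "(\<lambda>n. U d (Suc n)) sums (trigamma_sum (of_nat d * z) - 1 / (of_nat d * z)\<^sup>2 - s)"
      using has_sum_from_1_sums by fastforce
    moreover have "(\<lambda>n. U d (Suc n)) sums (V d (Suc 0) - 0)"
      unfolding U_def by (rule telescope_sums'[OF V_lim])
    ultimately have "trigamma_sum (of_nat d * z) - 1 / (of_nat d * z)\<^sup>2 - s = V d 1"
      using sums_unique2 by fastforce
    then have "s = trigamma_sum (of_nat d * z) - 1 / (of_nat d * z)\<^sup>2 - V d 1" by (simp add: algebra_simps)
    then show ?thesis using s by simp
  qed
  \<comment> \<open>Along rows the correction telescopes to \<open>V d 1\<close> because
    \<open>V\<close> tends to 0. Along columns it telescopes to \<open>v 1\<close> minus the limit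
    of \<open>v\<close>, and this limit is the entire discrepancy between the two orders.\<close>
  have "((\<lambda>d. trigamma_sum (of_nat d * z) - 1 / (of_nat d * z)\<^sup>2 - V d 1) has_sum S) {1..}"
    by (rule has_sum_SigmaD[OF S]) (use rows in auto)
  moreover have "((\<lambda>d. trigamma_sum (of_nat d * z) - 1 / (of_nat d * z)\<^sup>2 - V d 1) has_sum (A - v 1)) {1..}"
    by (intro has_sum_diff A V_col) simp
  ultimately have SA: "S = A - v 1" by (rule has_sum_unique)
  have cols: "((\<lambda>d. T d n - U d n) has_sum
      1 / z\<^sup>2 * (trigamma_sum (of_nat n * w) - 1 / (of_nat n * w)\<^sup>2) - (v n - v (Suc n))) {1..}"
    if n: "n \<in> {1..}" for n
  proof -
    have "((\<lambda>d. 1 / z\<^sup>2 * (1 / (of_nat n * w - of_nat d)\<^sup>2 + 1 / (of_nat n * w + of_nat d)\<^sup>2)) has_sum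
      1 / z\<^sup>2 * (trigamma_sum (of_nat n * w) - 1 / (of_nat n * w)\<^sup>2)) {1..}"
      using n by (intro has_sum_cmult_right trigamma_sum_has_sum Im_d) auto
    also have "(\<lambda>d. 1 / z\<^sup>2 * (1 / (of_nat n * w - of_nat d)\<^sup>2 + 1 / (of_nat n * w + of_nat d)\<^sup>2)) = (\<lambda>d. T d n)"
    proof
      fix d
      have "(z * (of_nat n * w - of_nat d))\<^sup>2 = (of_nat d * z + of_nat n)\<^sup>2"
        using z0 by (simp add: w_def power2_eq_square algebra_simps)
      moreover have "(z * (of_nat n * w + of_nat d))\<^sup>2 = (of_nat d * z - of_nat n)\<^sup>2"
        using z0 by (simp add: w_def power2_eq_square algebra_simps)
      ultimately show "1 / z\<^sup>2 * (1 / (of_nat n * w - of_nat d)\<^sup>2 + 1 / (of_nat n * w + of_nat d)\<^sup>2) = T d n"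
        unfolding T_def by (simp add: power_mult_distrib[symmetric] distrib_left)
    qed
    finally have "((\<lambda>d. T d n) has_sum 1 / z\<^sup>2 * (trigamma_sum (of_nat n * w) - 1 / (of_nat n * w)\<^sup>2)) {1..}" .
    moreover have "((\<lambda>d. U d n) has_sum (v n - v (Suc n))) {1..}"
      unfolding U_def using n by (intro has_sum_diff V_col) auto
    ultimately show ?thesis by (rule has_sum_diff)
  qed
  have "((\<lambda>n. 1 / z\<^sup>2 * (trigamma_sum (of_nat n * w) - 1 / (of_nat n * w)\<^sup>2) - (v n - v (Suc n))) has_sum S) {1..}"
    by (rule has_sum_SigmaD[OF has_sum_swap[THEN iffD1, OF S]]) (use cols in auto)
  from has_sum_diff[OF has_sum_cmult_right[OF B[folded w_def], of "1 / z\<^sup>2"] this]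
  have "((\<lambda>n. v n - v (Suc n)) has_sum (1 / z\<^sup>2 * B - S)) {1..}" by simp
  then have "(\<lambda>n. v (Suc n) - v (Suc (Suc n))) sums (1 / z\<^sup>2 * B - S)" by (rule has_sum_from_1_sums)
  \<comment> \<open>High in the upper half-plane \<open>geom_q\<close> vanishes, so
    \<open>pi_cot\<close> tends to \<open>- pi * i\<close>; division by \<open>- z\<close> gives the
    anomaly.\<close>
  moreover have "(\<lambda>n. v (Suc n)) \<longlonglongrightarrow> of_real pi * \<i> / z"
  proof -
    have q: "norm (q_exp w) < 1" by (rule norm_q_exp_less[OF w])
    have "(\<lambda>n. q_exp w ^ n / (1 - q_exp w ^ n)) \<longlonglongrightarrow> 0 / (1 - 0)"
      by (intro tendsto_intros LIMSEQ_power_zero q) simp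
    then have g: "(\<lambda>n. geom_q (of_nat n * w)) \<longlonglongrightarrow> 0" by (simp add: geom_q_def q_exp_of_nat_mult)
    have inv: "(\<lambda>n. 1 / of_nat n * (1 / w)) \<longlonglongrightarrow> 0 * (1 / w)"
      by (intro tendsto_mult lim_1_over_n tendsto_const)
    have "(\<lambda>n. - (1 / z) * ((2 * of_real pi / \<i>) * (geom_q (of_nat n * w) + 1 / 2) - 1 / of_nat n * (1 / w)))
        \<longlonglongrightarrow> - (1 / z) * ((2 * of_real pi / \<i>) * (0 + 1 / 2) - 0 * (1 / w))"
      by (intro tendsto_intros g inv)
    moreover have "eventually (\<lambda>n. - (1 / z) * ((2 * of_real pi / \<i>) * (geom_q (of_nat n * w) + 1 / 2) - 1 / of_nat n * (1 / w)) = v n) sequentially"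
      using eventually_ge_at_top[of 1]
    proof eventually_elim
      case (elim n)
      have "(2 * of_real pi / \<i>) * (geom_q (of_nat n * w) + 1 / 2) = pi_cot (of_nat n * w)"
        unfolding geom_q_pi_cot[OF Im_d(2)[OF elim]] by (simp add: field_simps)
      then show ?case by (simp add: v_def)
    qed
    ultimately have "v \<longlonglongrightarrow> - (1 / z) * ((2 * of_real pi / \<i>) * (0 + 1 / 2) - 0 * (1 / w))"
      by (blast intro: Lim_transform_eventually)
    moreover have "- (1 / z) * ((2 * of_real pi / \<i>) * (0 + 1 / 2) - 0 * (1 / w)) = of_real pi * \<i> / z"
      by (simp add: field_simps)
    ultimately have "v \<longlonglongrightarrow> of_real pi * \<i> / z" by (simp only:)
    then show ?thesis by (rule LIMSEQ_Suc)
  qed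
  then have "(\<lambda>n. v (Suc n) - v (Suc (Suc n))) sums (v (Suc 0) - of_real pi * \<i> / z)"
    by (rule telescope_sums')
  ultimately have "1 / z\<^sup>2 * B - S = v (Suc 0) - of_real pi * \<i> / z" by (rule sums_unique2)
  then show ?thesis using SA by (simp add: algebra_simps)
qed

text \<open>The swap of summations, rewritten by Lipschitz's formula. The \<open>zeta_nat 2\<close>
  terms stem from the terms \<open>n = 0\<close>, which the swap omits on both sides.\<close>

lemma lambert_deriv_reciprocity:
  assumes z: "Im z > 0"
  shows "lambert_deriv z = lambert_deriv (- 1 / z) / z\<^sup>2 +
           zeta_nat 2 / (2 * of_real pi * \<i>) * (1 / z\<^sup>2 - 1) + 1 / (2 * z)"
proof -
  have z0: "z \<noteq> 0" using z by auto
  have A: "((\<lambda>d. trigamma_sum (of_nat d * u) - 1 / (of_nat d * u)\<^sup>2) has_sum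
      2 * of_real pi * \<i> * lambert_deriv u - 1 / u\<^sup>2 * zeta_nat 2) {1..}" if u: "Im u > 0" for u
  proof -
    have "((\<lambda>d. 2 * of_real pi * \<i> * geom_q_deriv (of_nat d * u) - 1 / u\<^sup>2 * (1 / of_nat d ^ 2)) has_sum
      2 * of_real pi * \<i> * lambert_deriv u - 1 / u\<^sup>2 * zeta_nat 2) {1..}"
      by (intro has_sum_diff has_sum_cmult_right lambert_deriv_has_sum zeta_nat_has_sum u) simp
    then show ?thesis
      by (rule has_sum_cong[THEN iffD1, rotated]) (use u in \<open>simp add: trigamma_sum_eq power_mult_distrib\<close>)
  qed
  have "2 * of_real pi * \<i> * lambert_deriv z - 1 / z\<^sup>2 * zeta_nat 2 =
     (2 * of_real pi * \<i> * lambert_deriv (- 1 / z) - 1 / (- 1 / z)\<^sup>2 * zeta_nat 2) / z\<^sup>2 + of_real pi * \<i> / z"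
    by (rule trigamma_double_sum_swap[OF z A[OF z] A[OF Im_neg_inverse_pos[OF z]]])
  moreover have "1 / (- 1 / z)\<^sup>2 = z\<^sup>2" using z0 by (simp add: power2_eq_square)
  moreover define q where "q = 2 * of_real pi * \<i>"
  moreover have "of_real pi * \<i> / z = q / (2 * z)" by (simp add: q_def)
  ultimately have "q * lambert_deriv z - 1 / z\<^sup>2 * zeta_nat 2 =
      (q * lambert_deriv (- 1 / z) - z\<^sup>2 * zeta_nat 2) / z\<^sup>2 + q / (2 * z)" by (simp only:)
  moreover have "q \<noteq> 0" by (simp add: q_def)
  moreover have "a = b / z\<^sup>2 + s / q * (1 / z\<^sup>2 - 1) + 1 / (2 * z)"
    if "q * a - 1 / z\<^sup>2 * s = (q * b - z\<^sup>2 * s) / z\<^sup>2 + q / (2 * z)" "q \<noteq> 0" for a b s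
  proof -
    have "(q * b - z\<^sup>2 * s) / z\<^sup>2 = q * b / z\<^sup>2 - s" using z0 by (simp add: diff_divide_distrib)
    then have "q * a = q * b / z\<^sup>2 + s * (1 / z\<^sup>2 - 1) + q / (2 * z)"
      using that(1) by (simp add: algebra_simps)
    also have "\<dots> = q * (b / z\<^sup>2 + s / q * (1 / z\<^sup>2 - 1) + 1 / (2 * z))"
      using that(2) by (simp add: distrib_left)
    finally have "q * a = q * (b / z\<^sup>2 + s / q * (1 / z\<^sup>2 - 1) + 1 / (2 * z))" .
    then show ?thesis using that(2) by simp
  qed
  ultimately show ?thesis unfolding q_def[symmetric] by blast
qed

text \<open>Equivalent to the transformation law of the logarithm of Dedekind's eta function.\<close>
lemma lambert_log_reciprocity:
  assumes z: "Im z > 0"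
  shows "lambert_log (- 1 / z) - lambert_log z =
           zeta_nat 2 / (2 * of_real pi * \<i>) * (z + 1 / z) - Ln (z / \<i>) / 2"
proof -
  define c where "c = zeta_nat 2 / (2 * of_real pi * \<i>)"
  \<comment> \<open>The difference of both sides has derivative 0 by the weight two law, so it is
    constant on the half-plane.\<close>
  define Y where "Y u = lambert_log (- 1 / u) - lambert_log u - (c * (u + 1 / u) - Ln (u / \<i>) / 2)" for u
  have "\<exists>C. \<forall>u\<in>{u. Im u > 0}. Y u = C"
  proof (rule has_field_derivative_zero_constant)
    show "convex {u. Im u > 0}" by (rule convex_halfspace_Im_gt)
    fix u assume "u \<in> {u. Im u > 0}"
    then have u: "Im u > 0" by simp
    have u0: "u \<noteq> 0" using u by auto
    have Re: "Re (u / \<i>) > 0" using u by (simp add: Re_divide)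
    then have nr: "u / \<i> \<notin> \<real>\<^sub>\<le>\<^sub>0" by (auto simp: complex_nonpos_Reals_iff)
    have d1: "((\<lambda>u. lambert_log (- 1 / u)) has_field_derivative lambert_deriv (- 1 / u) * (1 / u\<^sup>2)) (at u)"
      by (rule DERIV_chain2[where f = lambert_log and g = "\<lambda>u. - 1 / u", OF lambert_log_has_field_derivative[OF Im_neg_inverse_pos[OF u]]])
         (use u0 in \<open>auto intro!: derivative_eq_intros simp: power2_eq_square field_simps\<close>)
    have d2: "((\<lambda>u. Ln (u / \<i>)) has_field_derivative inverse (u / \<i>) * (1 / \<i>)) (at u)"
      by (rule DERIV_chain2[where f = Ln and g = "\<lambda>u. u / \<i>", OF has_field_derivative_Ln[OF nr]]) (auto intro!: derivative_eq_intros)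
    have d3: "((\<lambda>u. u + 1 / u) has_field_derivative 1 - 1 / u\<^sup>2) (at u)"
      using u0 by (auto intro!: derivative_eq_intros simp: power2_eq_square field_simps)
    have "(Y has_field_derivative lambert_deriv (- 1 / u) * (1 / u\<^sup>2) - lambert_deriv u -
        (c * (1 - 1 / u\<^sup>2) - inverse (u / \<i>) * (1 / \<i>) / 2)) (at u)"
      unfolding Y_def[abs_def]
      by (intro DERIV_diff DERIV_cmult DERIV_cdivide d1 d2 d3 lambert_log_has_field_derivative u)
    also have "lambert_deriv (- 1 / u) * (1 / u\<^sup>2) - lambert_deriv u -
        (c * (1 - 1 / u\<^sup>2) - inverse (u / \<i>) * (1 / \<i>) / 2) = 0"
      unfolding lambert_deriv_reciprocity[OF u] c_def[symmetric] using u0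
      by (simp add: field_simps)
    finally show "(Y has_field_derivative 0) (at u within {u. Im u > 0})"
      by (rule has_field_derivative_at_within)
  qed
  then obtain C where C: "\<And>u. Im u > 0 \<Longrightarrow> Y u = C" by auto
  \<comment> \<open>\<open>i\<close> is the fixed point of \<open>u \<mapsto> - 1 / u\<close>; there
    \<open>u + 1 / u = 0\<close> and the logarithm is \<open>Ln 1\<close>.\<close>
  have "Y \<i> = 0" by (simp add: Y_def divide_i)
  then have "Y z = 0" using C[OF z] C[of \<i>] by simp
  then show ?thesis by (simp add: Y_def c_def)
qed

text \<open>The sum over all \<open>d\<close> minus the sum over the multiples \<open>p * d\<close>,
  where the twisted summand contributes \<open>1 / p\<close> times the series at \<open>p z\<close>
  and minus the series at \<open>p^2 z\<close>.\<close>

lemma F_char_1_lambert_log: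
  assumes p: "prime p" and z: "Im z > 0"
  shows "F_char 1 p z = lambert_log z - (of_nat p + 1 / of_nat p) * lambert_log (of_nat p * z) + lambert_log (of_nat p ^ 2 * z)"
proof -
  have p0: "p > 0" using p by (rule prime_gt_0_nat)
  have Im: "Im (of_nat p * z) > 0" "Im (of_nat p ^ 2 * z) > 0" using p0 z by (simp_all add: power2_eq_square mult.assoc)
  define f where "f d = twisted_geom p (of_nat d * z) / of_nat d" for d
  have "((\<lambda>d. geom_q (of_nat d * z) / of_nat d - of_nat p * (geom_q (of_nat d * (of_nat p * z)) / of_nat d)) has_sum
      lambert_log z - of_nat p * lambert_log (of_nat p * z)) {1..}"
    by (intro has_sum_diff has_sum_cmult_right lambert_log_has_sum z Im)
  then have all: "(f has_sum lambert_log z - of_nat p * lambert_log (of_nat p * z)) {1..}"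
    by (simp add: f_def[abs_def] twisted_geom_def diff_divide_distrib mult_ac)
  have "((\<lambda>d. 1 / of_nat p * (geom_q (of_nat d * (of_nat p * z)) / of_nat d) - geom_q (of_nat d * (of_nat p ^ 2 * z)) / of_nat d) has_sum
      1 / of_nat p * lambert_log (of_nat p * z) - lambert_log (of_nat p ^ 2 * z)) {1..}"
    by (intro has_sum_diff has_sum_cmult_right lambert_log_has_sum Im)
  also have "(\<lambda>d. 1 / of_nat p * (geom_q (of_nat d * (of_nat p * z)) / of_nat d) - geom_q (of_nat d * (of_nat p ^ 2 * z)) / of_nat d) = (\<lambda>d. f (p * d))"
    using p0 by (auto simp: fun_eq_iff f_def twisted_geom_def diff_divide_distrib power2_eq_square mult_ac)
  finally have "(f has_sum 1 / of_nat p * lambert_log (of_nat p * z) - lambert_log (of_nat p ^ 2 * z)) {n \<in> {1..}. p dvd n}"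
    by (rule multiples_has_sum[OF p0])
  from has_sum_Diff[OF all this]
  have "(f has_sum lambert_log z - of_nat p * lambert_log (of_nat p * z) -
      (1 / of_nat p * lambert_log (of_nat p * z) - lambert_log (of_nat p ^ 2 * z))) (prime_to p)"
    unfolding prime_to_eq by auto
  moreover have "(f has_sum F_char 1 p z) (prime_to p)"
    using F_char_lambert[OF p z, of 1] by (simp add: f_def[abs_def])
  ultimately have "F_char 1 p z = lambert_log z - of_nat p * lambert_log (of_nat p * z) -
      (1 / of_nat p * lambert_log (of_nat p * z) - lambert_log (of_nat p ^ 2 * z))"
    using has_sum_unique by blast
  then show ?thesis by (simp add: algebra_simps)
qed

text \<open>The involution matches the arguments \<open>z\<close>, \<open>p z\<close>,
  \<open>p^2 z\<close> in reverse order with their images under \<open>u \<mapsto> - 1 / u\<close>.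
  With the weights \<open>1\<close>, \<open>- (p + 1 / p)\<close>, \<open>1\<close> the
  \<open>zeta_nat 2\<close> terms and the \<open>log p\<close> terms cancel, and the logarithm keeps
  the factor \<open>(p + 1 / p - 2) / 2\<close>.\<close>

theorem F_char_log_reciprocity:
  assumes p: "prime p" and z: "Im z > 0"
  shows "F_char 1 p (- 1 / (of_nat p ^ 2 * z)) - F_char 1 p z = (of_nat p - 1) ^ 2 / (2 * of_nat p) * Ln (of_nat p * z / \<i>)"
proof -
  define P where "P = complex_of_nat p"
  have p0: "p > 0" "P \<noteq> 0" using prime_gt_0_nat[OF p] by (auto simp: P_def)
  have z0: "z \<noteq> 0" using z by auto
  have Im: "Im (P * z) > 0" "Im (P ^ 2 * z) > 0" using p0 z by (simp_all add: P_def power2_eq_square mult.assoc)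
  define w where "w = - 1 / (P ^ 2 * z)"
  have w: "Im w > 0" unfolding w_def by (rule Im_neg_inverse_pos[OF Im(2)])
  have pw: "P * w = - 1 / (P * z)" "P ^ 2 * w = - 1 / z" using p0 z0 by (simp_all add: w_def power2_eq_square)
  define c where "c = zeta_nat 2 / (2 * of_real pi * \<i>)"
  define L where "L = Ln (P * z / \<i>)"
  define l where "l = Ln P"
  have y0: "z / \<i> \<noteq> 0" "P * z / \<i> \<noteq> 0" using z0 p0 by auto
  have "Ln (P * (z / \<i>)) = Ln P + Ln (z / \<i>)"
    unfolding P_def by (rule Ln_times_of_nat) (use p0 y0 in auto)
  then have L0: "Ln (z / \<i>) = L - l" by (simp add: L_def l_def mult_ac)
  have "Ln (P * (P * z / \<i>)) = Ln P + Ln (P * z / \<i>)"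
    using Ln_times_of_nat[of p "P * z / \<i>"] p0 y0 by (simp add: P_def)
  then have L2: "Ln (P ^ 2 * z / \<i>) = L + l" by (simp add: L_def l_def power2_eq_square mult_ac)
  have r1: "lambert_log (P ^ 2 * w) = lambert_log z + (c * (z + 1 / z) - (L - l) / 2)"
    using lambert_log_reciprocity[OF z] unfolding pw L0 c_def[symmetric] by (simp add: algebra_simps)
  have r2: "lambert_log (P * w) = lambert_log (P * z) + (c * (P * z + 1 / (P * z)) - L / 2)"
    using lambert_log_reciprocity[OF Im(1)] unfolding pw L_def[symmetric] c_def[symmetric] by (simp add: algebra_simps)
  have r3: "lambert_log w = lambert_log (P ^ 2 * z) + (c * (P ^ 2 * z + 1 / (P ^ 2 * z)) - (L + l) / 2)"
    using lambert_log_reciprocity[OF Im(2)] unfolding w_def[symmetric] L2 c_def[symmetric] by (simp add: algebra_simps)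
  have "F_char 1 p w - F_char 1 p z = (P - 1) ^ 2 / (2 * P) * L"
    unfolding F_char_1_lambert_log[OF p w] F_char_1_lambert_log[OF p z] P_def[symmetric] r1 r2 r3
    using p0 z0 by (simp add: field_simps power2_eq_square)
  then show ?thesis by (simp add: w_def L_def P_def)
qed

section \<open>Exceptional points\<close>

lemma algebraic_Rats: "x \<in> \<rat> \<Longrightarrow> algebraic (complex_of_real x)"
proof -
  assume "x \<in> \<rat>"
  then obtain a b :: int where "x = of_int a / of_int b" by (auto elim: Rats_cases')
  then have "complex_of_real x = of_int a / of_int b" by simp
  then show ?thesis by (simp only:) (intro algebraic_divide algebraic_of_int)
qed

lemma algebraic_poly_R_poly:
  assumes "algebraic z"
  shows "algebraic (poly (R_poly k p) z)"
  unfolding poly_R_poly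
  by (intro algebraic_sum algebraic_mult algebraic_diff algebraic_pow algebraic_Rats bernoulli_coeff_rat assms) auto

lemma degree_R_poly: "degree (R_poly k p) \<le> 2 * k"
  unfolding R_poly_def
proof (rule degree_sum_le)
  fix j assume j: "j \<in> {1..k}"
  have "degree ([:0, of_nat p:] ^ (2 * k + 2 - 2 * j) :: complex poly) \<le> degree [:0, of_nat p :: complex:] * (2 * k + 2 - 2 * j)"
    by (rule degree_power_le)
  also have "\<dots> \<le> 1 * (2 * k + 2 - 2 * j)" by (intro mult_right_mono) auto
  also have "\<dots> \<le> 2 * k" using j by auto
  finally show "degree (Polynomial.smult c ([:0, of_nat p:] ^ (2 * k + 2 - 2 * j) :: complex poly)) \<le> 2 * k" for c
    by (rule order_trans[OF degree_smult_le])
qed simp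

text \<open>Two exceptional points off the roots of \<open>(pz)^(2k) = 1\<close> give the same value of
  \<open>R(z) / (z ((pz)^(2k) - 1))\<close>, because otherwise \<open>\<pi>^(2k+1)\<close> would be algebraic.\<close>
lemma exceptional_points_card:
  fixes k p :: nat and c \<kappa> :: complex and S :: "complex set"
  assumes k: "k \<ge> 1" and p: "p > 0" and \<kappa>: "algebraic \<kappa>" "\<kappa> \<noteq> 0"
    and S: "\<And>z. z \<in> S \<Longrightarrow> algebraic z \<and> z \<noteq> 0 \<and> \<not> (poly (R_poly k p) z = 0 \<and> (of_nat p * z) ^ (2 * k) = 1) \<and>
        algebraic (c * ((of_nat p * z) ^ (2 * k) - 1) + of_real pi ^ (2 * k + 1) * (\<kappa> * (poly (R_poly k p) z / z)))"
    and R0: "R_poly k p \<noteq> 0"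
  shows "finite S \<and> card S \<le> 2 * k"
proof (cases "S = {}")
  case False
  then obtain z0 where z0: "z0 \<in> S" by blast
  define Pi where "Pi = complex_of_real pi ^ (2 * k + 1)"
  have Pi: "\<not> algebraic (Pi * a)" if "algebraic a" "a \<noteq> 0" for a
  proof
    assume "algebraic (Pi * a)"
    then have "algebraic (Pi * a / a)" using that by (intro algebraic_divide) auto
    then have "algebraic Pi" using that by simp
    then have "algebraic (complex_of_real pi)"
      by (rule algebraic_root[where p = "monom 1 (2 * k + 1)"]) (auto simp: Pi_def poly_monom degree_monom_eq)
    then show False using pi_transcendental by simp
  qed
  define g where "g z = (of_nat p * z) ^ (2 * k) - 1" for z :: complex
  define h where "h z = poly (R_poly k p) z / (z * g z)" for z
  have alg_g: "algebraic (g z)" if "algebraic z" for z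
    unfolding g_def by (intro algebraic_diff algebraic_pow algebraic_mult that) auto
  \<comment> \<open>At a zero of \<open>g\<close> the unknown \<open>c\<close> drops out. A power of
    \<open>pi\<close> times an algebraic number remains, and that number is nonzero because
    \<open>z\<close> is not a common root.\<close>
  have g0: "g z \<noteq> 0" if "z \<in> S" for z
  proof
    assume 0: "g z = 0"
    have Sz: "algebraic z" "z \<noteq> 0" using S[OF that] by auto
    have R: "poly (R_poly k p) z \<noteq> 0" using 0 S[OF that] by (auto simp: g_def)
    have "algebraic (Pi * (\<kappa> * (poly (R_poly k p) z / z)))"
      using S[OF that] 0 by (simp add: g_def Pi_def)
    moreover have "algebraic (\<kappa> * (poly (R_poly k p) z / z))"
      by (intro algebraic_mult algebraic_divide algebraic_poly_R_poly \<kappa> Sz)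
    ultimately show False using Pi[of "\<kappa> * (poly (R_poly k p) z / z)"] R Sz \<kappa> by simp
  qed
  have val: "algebraic (c + Pi * (\<kappa> * h z))" if "z \<in> S" for z
  proof -
    have "algebraic ((c * g z + Pi * (\<kappa> * (poly (R_poly k p) z / z))) / g z)"
      using S[OF that] unfolding g_def[symmetric] Pi_def by (intro algebraic_divide alg_g) auto
    also have "(c * g z + Pi * (\<kappa> * (poly (R_poly k p) z / z))) / g z = c + Pi * (\<kappa> * h z)"
      using g0[OF that] S[OF that] by (simp add: h_def field_simps)
    finally show ?thesis .
  qed
  have alg_h: "algebraic (h z)" if "z \<in> S" for z
    unfolding h_def using S[OF that] by (intro algebraic_divide algebraic_mult alg_g algebraic_poly_R_poly) auto
  have h_eq: "h z = h z0" if z: "z \<in> S" for z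
  proof (rule ccontr)
    assume ne: "h z \<noteq> h z0"
    \<comment> \<open>Subtraction eliminates \<open>c\<close>, about which nothing arithmetic is
      known.\<close>
    have "algebraic ((c + Pi * (\<kappa> * h z)) - (c + Pi * (\<kappa> * h z0)))" by (intro algebraic_diff val z z0)
    then have "algebraic (Pi * (\<kappa> * (h z - h z0)))" by (simp add: algebra_simps)
    moreover have "algebraic (\<kappa> * (h z - h z0))" by (intro algebraic_mult algebraic_diff alg_h z z0 \<kappa>)
    ultimately show False using Pi[of "\<kappa> * (h z - h z0)"] \<kappa> ne by simp
  qed
  define G where "G = [:0, of_nat p:] ^ (2 * k) - (1 :: complex poly)"
  define Q where "Q = R_poly k p - Polynomial.smult (h z0) ([:0, 1:] * G)"
  have polyQ: "poly Q z = poly (R_poly k p) z - h z0 * (z * g z)" for z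
    by (simp add: Q_def G_def g_def mult.commute)
  have degG: "degree G = 2 * k"
  proof -
    have "degree ([:0, of_nat p:] ^ (2 * k) :: complex poly) = 2 * k"
      using p by (subst degree_power_eq) auto
    then show ?thesis using k unfolding G_def diff_conv_add_uminus by (subst degree_add_eq_left) auto
  qed
  have degXG: "degree ([:0, 1:] * G) = 2 * k + 1"
    using degG k by (subst degree_mult_eq) auto
  \<comment> \<open>If \<open>h z0\<close> is 0 then \<open>Q\<close> is \<open>R_poly\<close>
    itself; otherwise the coefficient in degree \<open>2 * k + 1\<close> comes from the second
    summand alone.\<close>
  have Q0: "Q \<noteq> 0"
  proof (cases "h z0 = 0")
    case True
    then show ?thesis using R0 by (simp add: Q_def)
  next
    case False
    have "coeff Q (2 * k + 1) = - h z0 * lead_coeff ([:0, 1:] * G)"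
      using degree_R_poly[of k p] unfolding Q_def coeff_diff coeff_smult degXG[symmetric]
      by (subst coeff_eq_0) (simp_all add: degXG del: mult_pCons_left)
    moreover have "lead_coeff ([:0, 1:] * G) \<noteq> 0" using degXG by (metis leading_coeff_0_iff degree_0 add_is_0 zero_neq_one)
    ultimately show ?thesis using False by (metis coeff_0 mult_eq_0_iff neg_equal_0_iff_equal)
  qed
  have degQ: "degree Q \<le> 2 * k + 1"
    unfolding Q_def
    by (rule degree_diff_le) (use degree_R_poly[of k p] degree_smult_le[of "h z0" "[:0, 1:] * G"] degXG in auto)
  \<comment> \<open>The additional root 0 is not in \<open>S\<close>, so the degree bound
    \<open>2 * k + 1\<close> leaves room for \<open>2 * k\<close> points.\<close>
  have "insert 0 S \<subseteq> {z. poly Q z = 0}"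
  proof
    fix z assume "z \<in> insert 0 S"
    then consider "z = 0" | "z \<in> S" by blast
    then show "z \<in> {z. poly Q z = 0}"
    proof cases
      case 1
      have "poly (R_poly k p) 0 = 0"
        unfolding poly_R_poly by (intro sum.neutral) auto
      then show ?thesis using 1 by (simp add: polyQ)
    next
      case 2
      then show ?thesis using g0[OF 2] S[OF 2] by (simp add: polyQ h_eq[OF 2, symmetric]) (simp add: h_def)
    qed
  qed
  moreover have "finite {z. poly Q z = 0}" using Q0 by (rule poly_roots_finite)
  ultimately have "finite (insert 0 S)" "card (insert 0 S) \<le> card {z. poly Q z = 0}"
    by (auto intro: finite_subset card_mono)
  moreover have "card {z. poly Q z = 0} \<le> degree Q" using Q0 by (rule card_poly_roots_bound)
  moreover have "0 \<notin> S" using S by auto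
  ultimately show ?thesis using degQ by auto
qed simp

theorem theorem5:
  fixes k p :: nat
  assumes "prime p"
    and "k \<ge> 1 \<Longrightarrow> odd k \<Longrightarrow>
           common_roots (R_poly k p) ([:0, of_nat p:] ^ (2 * k) - 1) = {}"
    and "k \<ge> 1 \<Longrightarrow> even k \<Longrightarrow>
           common_roots (R_poly k p) ([:0, of_nat p:] ^ (2 * k) - 1)
             = {\<i> / of_nat p, - \<i> / of_nat p}"
  shows "(\<exists>E \<subseteq> upper_half_plane.
            finite E \<and> card E \<le> 2 * k + delta k \<and>
            (\<forall>z \<in> upper_half_plane - E. algebraic z \<longrightarrow>
               \<not> algebraic ((z * of_nat p) ^ (2 * k) *
                              F_char (2 * k + 1) p (- 1 / (of_nat p ^ 2 * z))
                            - F_char (2 * k + 1) p z))) \<and>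
         finite {z \<in> upper_half_plane. algebraic z \<and>
                   algebraic (F_char (2 * k + 1) p z) \<and>
                   algebraic (F_char (2 * k + 1) p (- 1 / (of_nat p ^ 2 * z)))} \<and>
         card {z \<in> upper_half_plane. algebraic z \<and>
                   algebraic (F_char (2 * k + 1) p z) \<and>
                   algebraic (F_char (2 * k + 1) p (- 1 / (of_nat p ^ 2 * z)))}
           \<le> 2 * k + delta k"
proof -
  define D where "D z = (z * of_nat p) ^ (2 * k) * F_char (2 * k + 1) p (- 1 / (of_nat p ^ 2 * z)) - F_char (2 * k + 1) p z" for z
  define E where "E = {z \<in> upper_half_plane. algebraic z \<and> algebraic (D z)}"
  have p0: "p > 0" using assms(1) by (rule prime_gt_0_nat)
  have E: "finite E \<and> card E \<le> 2 * k + delta k"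
  proof (cases "k = 0")
    case True
    \<comment> \<open>The bound to be met is \<open>delta 0 = 1\<close>, because
      \<open>gcd 0 2 = 2\<close>. Hermite-Lindemann applied to \<open>Ln y\<close> leaves only
      \<open>y = 1\<close>.\<close>
    have "E \<subseteq> {\<i> / of_nat p}"
    proof
      fix z assume z: "z \<in> E"
      then have im: "Im z > 0" and alg: "algebraic z" "algebraic (D z)" by (auto simp: E_def upper_half_plane_def)
      define y where "y = of_nat p * z / \<i>"
      have y0: "y \<noteq> 0" using im p0 by (auto simp: y_def)
      have D: "D z = (of_nat p - 1) ^ 2 / (2 * of_nat p) * Ln y"
        using F_char_log_reciprocity[OF assms(1) im] by (simp add: D_def True y_def)
      define r where "r = (of_nat p - 1 :: complex) ^ 2 / (2 * of_nat p)"
      have r: "algebraic r" "r \<noteq> 0"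
        using prime_gt_1_nat[OF assms(1)] p0 unfolding r_def by (auto intro!: algebraic_divide algebraic_pow algebraic_diff algebraic_mult)
      have "algebraic (D z / r)" by (intro algebraic_divide alg r)
      then have "algebraic (Ln y)" using r by (simp add: D r_def[symmetric])
      moreover have "algebraic (exp (Ln y))"
        using y0 alg by (auto simp: y_def intro!: algebraic_divide algebraic_mult)
      ultimately have "Ln y = 0" using hermite_lindemann by blast
      then have "y = 1" using y0 by (metis exp_Ln exp_zero)
      moreover have "of_nat p * z = y * \<i>" unfolding y_def by (metis complex_i_not_zero nonzero_eq_divide_eq)
      ultimately have "of_nat p * z = \<i>" by simp
      then have "z = \<i> / of_nat p" using p0 by (simp add: eq_divide_eq mult.commute)
      then show "z \<in> {\<i> / of_nat p}" by simp
    qed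
    then show ?thesis using True by (auto simp: delta_def dest: card_mono[rotated] intro: finite_subset)
  next
    case False
    then have k: "k \<ge> 1" by simp
    define c where "c = (of_nat p - 1) / 2 * zeta_prime_to p (2 * k + 1)"
    define \<kappa> where "\<kappa> = (- \<i> * (2 * \<i>) ^ (2 * k + 2) / (4 * of_nat p ^ (2 * k + 2)) :: complex)"
    have \<kappa>: "algebraic \<kappa>" "\<kappa> \<noteq> 0"
      using p0 unfolding \<kappa>_def by (auto intro!: algebraic_divide algebraic_mult algebraic_pow)
    \<comment> \<open>The common roots in the half-plane: \<open>- i / p\<close> has negative
      imaginary part, so for \<open>k \<ge> 1\<close> the set has \<open>delta k\<close>
      elements.\<close>
    define X where "X = (if even k then {\<i> / of_nat p} else {} :: complex set)"
    have root_iff: "poly ([:0, of_nat p:] ^ (2 * k) - 1) z = 0 \<longleftrightarrow> (of_nat p * z) ^ (2 * k) = 1" for z :: complex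
      by (simp add: mult.commute)
    have common: "z \<in> common_roots (R_poly k p) ([:0, of_nat p:] ^ (2 * k) - 1) \<longleftrightarrow>
        poly (R_poly k p) z = 0 \<and> (of_nat p * z) ^ (2 * k) = 1" for z
      unfolding common_roots_def by (simp only: mem_Collect_eq root_iff)
    \<comment> \<open>For the zero polynomial every root of \<open>(p z) ^ (2 * k) = 1\<close> would
      be common, among them \<open>1 / p\<close>, against the hypotheses in either parity.\<close>
    have R0: "R_poly k p \<noteq> 0"
    proof
      assume "R_poly k p = 0"
      then have "1 / of_nat p \<in> common_roots (R_poly k p) ([:0, of_nat p:] ^ (2 * k) - 1)"
        using p0 unfolding common by simp
      then have "1 / complex_of_nat p \<in> {\<i> / of_nat p, - \<i> / of_nat p}"
        using assms(2,3) k by (cases "even k") auto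
      then show False using p0 by (auto simp: field_simps complex_eq_iff)
    qed
    have "finite (E - X) \<and> card (E - X) \<le> 2 * k"
    proof (rule exceptional_points_card[OF k p0 \<kappa> _ R0, of "E - X" c])
      fix z assume z: "z \<in> E - X"
      then have im: "Im z > 0" and alg: "algebraic z" "algebraic (D z)" by (auto simp: E_def upper_half_plane_def)
      have "\<not> (poly (R_poly k p) z = 0 \<and> (of_nat p * z) ^ (2 * k) = 1)"
      proof
        assume "poly (R_poly k p) z = 0 \<and> (of_nat p * z) ^ (2 * k) = 1"
        then have zc: "z \<in> common_roots (R_poly k p) ([:0, of_nat p:] ^ (2 * k) - 1)" unfolding common .
        show False
        proof (cases "even k")
          case True
          then have "z = \<i> / of_nat p \<or> z = - \<i> / of_nat p" using zc assms(3)[OF k] by auto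
          moreover have "Im (- \<i> / of_nat p) < 0" using p0 by simp
          ultimately show False using z im True by (auto simp: X_def)
        qed (use zc assms(2)[OF k] in auto)
      qed
      moreover have "D z = c * ((of_nat p * z) ^ (2 * k) - 1) + of_real pi ^ (2 * k + 1) * (\<kappa> * (poly (R_poly k p) z / z))"
        unfolding D_def F_char_reciprocity_R_poly[OF assms(1) im k] c_def \<kappa>_def ..
      ultimately show "algebraic z \<and> z \<noteq> 0 \<and> \<not> (poly (R_poly k p) z = 0 \<and> (of_nat p * z) ^ (2 * k) = 1) \<and>
        algebraic (c * ((of_nat p * z) ^ (2 * k) - 1) + of_real pi ^ (2 * k + 1) * (\<kappa> * (poly (R_poly k p) z / z)))"
        using alg im by auto
    qed
    moreover have X: "finite X" "card X = delta k"
      by (auto simp: X_def delta_def coprime_iff_gcd_eq_1[symmetric] coprime_right_2_iff_odd)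
    moreover have sub: "E \<subseteq> (E - X) \<union> X" by blast
    ultimately have fin: "finite ((E - X) \<union> X)" "card (E - X) + card X \<le> 2 * k + delta k" by auto
    have "card E \<le> card ((E - X) \<union> X)" by (rule card_mono[OF fin(1) sub])
    also have "\<dots> \<le> card (E - X) + card X" by (rule card_Un_le)
    finally show ?thesis using fin finite_subset[OF sub] by auto
  qed
  define T where "T = {z \<in> upper_half_plane. algebraic z \<and> algebraic (F_char (2 * k + 1) p z) \<and>
                   algebraic (F_char (2 * k + 1) p (- 1 / (of_nat p ^ 2 * z)))}"
  \<comment> \<open>For algebraic \<open>z\<close> the quantity \<open>D z\<close> is a combination
    of the two values with algebraic coefficients.\<close>
  have "T \<subseteq> E"
    unfolding T_def E_def D_def by (auto intro!: algebraic_diff algebraic_mult algebraic_pow)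
  then have "finite T" "card T \<le> 2 * k + delta k"
    using E by (auto intro: finite_subset order_trans[OF card_mono])
  moreover have "E \<subseteq> upper_half_plane" "\<forall>z \<in> upper_half_plane - E. algebraic z \<longrightarrow> \<not> algebraic (D z)"
    by (auto simp: E_def)
  ultimately show ?thesis using E unfolding T_def D_def by blast
qed

end
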